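(* Let $\alpha\in(0,2)$, let $\omega$ be an open and nonempty subset of $(0,1)$ and let $T>0$. There exist an increasing sequence $(t_m)_{m\in\mathbb{N}}$ of positive real numbers converging to $T$ and a sequence $(\mathcal{F}_m)_{m\in\mathbb{N}}$ of bounded linear operators from $L^2(0,1)$ into $L^2(0,1)$ such that for every $z_0\in L^2(0,1)$ the solution $z=z(x,t)$ of $$\begin{cases}\partial_tz-\partial_x(x^\alpha\partial_xz)=\sum_{m\in\mathbb{N}}\delta_{t=(t_{m+1}+t_m)/2}\otimes1_\omega\mathcal{F}_m\big(z|_{t=t_m}\big)&\text{in }(0,1)\times(0,T),\\ \mathrm{BC}_\alpha(z)=0&\text{on }(0,T),\\ z|_{x=1}=0&\text{on }(0,T),\\ z|_{t=0}=z_0&\text{in }(0,1),\end{cases}$$ satisfies $\lim_{t\to T_-}\|z(\cdot,t)\|_{L^2(0,1)}=0$.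
   Context: $\delta_{t=s}$ is the Dirac measure at $t=s$ and $1_\omega$ the characteristic function of $\omega$. $\mathrm{BC}_\alpha(\vartheta)=\vartheta|_{x=0}$ if $\alpha\in(0,1)$ and $\mathrm{BC}_\alpha(\vartheta)=(x^\alpha\vartheta')|_{x=0}$ if $\alpha\in[1,2)$. Let $H^1_\alpha(0,1)$ be the set of $\vartheta\in L^2(0,1)$ that are (locally) absolutely continuous in $(0,1)$ with $\int_0^1x^\alpha|\vartheta'|^2dx<\infty$ and $\vartheta(1)=0$. The operator $\mathcal{P}\vartheta=-(x^\alpha\vartheta')'$ with domain $D(\mathcal{P})=\{\vartheta\in H^1_\alpha(0,1):\ \mathcal{P}\vartheta\in L^2(0,1),\ \mathrm{BC}_\alpha(\vartheta)=0\}$ is self-adjoint, positive, with compact resolvent on $L^2(0,1)$. The system is understood equivalently as an impulsive system: $z$ solves $z'+\mathcal{P}z=0$ (evolution by the semigroup $e^{-t\mathcal{P}}$) on $(0,T)$ away from the times $\frac{t_m+t_{m+1}}2$, $m\ge0$, starts from $z(0)=z_0$, and at each of these times jumps according to $z\big(\cdot,\tfrac{t_m+t_{m+1}}2\big)=z\big(\cdot,(\tfrac{t_m+t_{m+1}}2)_-\big)+1_\omega\mathcal{F}_m(z(\cdot,t_m))$, where $s_-$ denotes the left limit at $s$. *)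

theory Defs
  imports "HOL-Analysis.Analysis"
begin

section \<open>The Hilbert space \<open>L\<^sup>2(0,1)\<close>\<close>

abbreviation unit_leb :: "real measure" where
  "unit_leb \<equiv> lebesgue_on {0<..<1}"

definition square_int :: "(real \<Rightarrow> real) \<Rightarrow> bool" where
  "square_int f \<longleftrightarrow> f \<in> borel_measurable unit_leb \<and> integrable unit_leb (\<lambda>x. (f x)\<^sup>2)"

definition eq_L2 :: "(real \<Rightarrow> real) \<Rightarrow> (real \<Rightarrow> real) \<Rightarrow> bool" where
  "eq_L2 f g \<longleftrightarrow> square_int f \<and> square_int g \<and> (AE x in unit_leb. f x = g x)"

lemma square_int_prod:
  assumes "square_int f" "square_int g"
  shows "integrable unit_leb (\<lambda>x. f x * g x)"
proof (rule Bochner_Integration.integrable_bound)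
  show "integrable unit_leb (\<lambda>x. (f x)\<^sup>2 + (g x)\<^sup>2)"
    using assms by (auto simp: square_int_def)
  show "(\<lambda>x. f x * g x) \<in> borel_measurable unit_leb"
    using assms by (auto simp: square_int_def)
  have "\<bar>a * b\<bar> \<le> a\<^sup>2 + b\<^sup>2" for a b :: real
  proof -
    have "2 * (\<bar>a\<bar> * \<bar>b\<bar>) \<le> \<bar>a\<bar>\<^sup>2 + \<bar>b\<bar>\<^sup>2"
      using sum_squares_bound[of "\<bar>a\<bar>" "\<bar>b\<bar>"] by (simp add: mult.assoc)
    moreover have "0 \<le> \<bar>a\<bar> * \<bar>b\<bar>"
      by simp
    ultimately show ?thesis
      unfolding abs_mult power2_abs by linarith
  qed
  then show "AE x in unit_leb. norm (f x * g x) \<le> norm ((f x)\<^sup>2 + (g x)\<^sup>2)"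
    by (intro AE_I2) simp
qed

lemma square_int_zero: "square_int (\<lambda>x. 0)"
  by (simp add: square_int_def)

lemma square_int_add:
  assumes "square_int f" "square_int g"
  shows "square_int (\<lambda>x. f x + g x)"
proof -
  have "integrable unit_leb (\<lambda>x. (f x)\<^sup>2 + (g x)\<^sup>2 + 2 * (f x * g x))"
    using assms square_int_prod[OF assms] by (auto simp: square_int_def)
  then have "integrable unit_leb (\<lambda>x. (f x + g x)\<^sup>2)"
    by (simp add: power2_sum mult.assoc)
  then show ?thesis
    using assms by (auto simp: square_int_def)
qed

lemma square_int_scale:
  assumes "square_int f"
  shows "square_int (\<lambda>x. c * f x)"
  using assms by (auto simp: square_int_def power_mult_distrib)

lemma square_int_uminus:
  assumes "square_int f"
  shows "square_int (\<lambda>x. - f x)"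
  using assms by (auto simp: square_int_def)

lemma square_int_diff:
  assumes "square_int f" "square_int g"
  shows "square_int (\<lambda>x. f x - g x)"
  using square_int_add[OF assms(1) square_int_uminus[OF assms(2)]] by simp

quotient_type L2 = "real \<Rightarrow> real" / partial: eq_L2
proof (rule part_equivpI)
  show "\<exists>f. eq_L2 f f"
    using square_int_zero by (intro exI[of _ "\<lambda>x. 0"]) (simp add: eq_L2_def)
  show "symp eq_L2"
    by (intro sympI) (auto simp: eq_L2_def)
  show "transp eq_L2"
  proof (intro transpI)
    fix f g h assume "eq_L2 f g" "eq_L2 g h"
    then show "eq_L2 f h"
      unfolding eq_L2_def by auto
  qed
qed

instantiation L2 :: real_vector
begin

lift_definition zero_L2 :: L2 is "\<lambda>x. 0"
  by (simp add: eq_L2_def square_int_zero)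

lift_definition plus_L2 :: "L2 \<Rightarrow> L2 \<Rightarrow> L2" is "\<lambda>f g x. f x + g x"
  unfolding eq_L2_def by (auto intro: square_int_add)

lift_definition minus_L2 :: "L2 \<Rightarrow> L2 \<Rightarrow> L2" is "\<lambda>f g x. f x - g x"
  unfolding eq_L2_def by (auto intro: square_int_diff)

lift_definition uminus_L2 :: "L2 \<Rightarrow> L2" is "\<lambda>f x. - f x"
  unfolding eq_L2_def by (auto intro: square_int_uminus)

lift_definition scaleR_L2 :: "real \<Rightarrow> L2 \<Rightarrow> L2" is "\<lambda>c f x. c * f x"
  unfolding eq_L2_def by (auto intro: square_int_scale)

instance
proof
  fix a b c :: L2 and r s :: real
  show "a + b + c = a + (b + c)"
    by transfer (auto simp: eq_L2_def add.assoc intro!: square_int_add)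
  show "a + b = b + a"
    by transfer (auto simp: eq_L2_def add.commute intro!: square_int_add)
  show "0 + a = a"
    by transfer (auto simp: eq_L2_def)
  show "- a + a = 0"
    by transfer (auto simp: eq_L2_def square_int_zero)
  show "a - b = a + - b"
    by transfer (auto simp: eq_L2_def intro!: square_int_diff)
  show "r *\<^sub>R (a + b) = r *\<^sub>R a + r *\<^sub>R b"
    by transfer (auto simp: eq_L2_def distrib_left intro!: square_int_add square_int_scale)
  show "(r + s) *\<^sub>R a = r *\<^sub>R a + s *\<^sub>R a"
    by transfer (auto simp: eq_L2_def distrib_right intro!: square_int_add square_int_scale)
  show "r *\<^sub>R s *\<^sub>R a = (r * s) *\<^sub>R a"
    by transfer (auto simp: eq_L2_def mult.assoc intro!: square_int_scale)
  show "1 *\<^sub>R a = a"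
    by transfer (auto simp: eq_L2_def)
qed

end

instantiation L2 :: real_inner
begin

lift_definition inner_L2 :: "L2 \<Rightarrow> L2 \<Rightarrow> real" is "\<lambda>f g. \<integral>x. f x * g x \<partial>unit_leb"
  unfolding eq_L2_def
  by (intro Bochner_Integration.integral_cong_AE) (auto simp: square_int_def)

definition norm_L2 :: "L2 \<Rightarrow> real" where
  "norm_L2 u = sqrt (u \<bullet> u)"

definition sgn_L2 :: "L2 \<Rightarrow> L2" where
  "sgn_L2 u = u /\<^sub>R norm u"

definition dist_L2 :: "L2 \<Rightarrow> L2 \<Rightarrow> real" where
  "dist_L2 u v = norm (u - v)"

definition uniformity_L2 :: "(L2 \<times> L2) filter" where
  "uniformity_L2 = (INF e\<in>{0<..}. principal {(u, v). dist u v < e})"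

definition open_L2 :: "L2 set \<Rightarrow> bool" where
  "open_L2 U \<longleftrightarrow> (\<forall>u\<in>U. \<forall>\<^sub>F (u', v) in uniformity. u' = u \<longrightarrow> v \<in> U)"

instance
proof
  fix a b c :: L2 and r :: real and U :: "L2 set"
  show "dist a b = norm (a - b)"
    by (rule dist_L2_def)
  show "sgn a = a /\<^sub>R norm a"
    by (rule sgn_L2_def)
  show "(uniformity :: (L2 \<times> L2) filter) = (INF e\<in>{0<..}. principal {(u, v). dist u v < e})"
    by (rule uniformity_L2_def)
  show "open U \<longleftrightarrow> (\<forall>u\<in>U. \<forall>\<^sub>F (u', v) in uniformity. u' = u \<longrightarrow> v \<in> U)"
    by (rule open_L2_def)
  show "norm a = sqrt (a \<bullet> a)"
    by (rule norm_L2_def)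
  show "a \<bullet> b = b \<bullet> a"
    by transfer (simp add: mult.commute)
  show "(a + b) \<bullet> c = a \<bullet> c + b \<bullet> c"
    by transfer (simp add: eq_L2_def distrib_right square_int_prod)
  show "(r *\<^sub>R a) \<bullet> b = r * (a \<bullet> b)"
    by transfer (simp add: mult.assoc)
  show "0 \<le> a \<bullet> a"
    by transfer simp
  show "a \<bullet> a = 0 \<longleftrightarrow> a = 0"
  proof transfer
    fix f :: "real \<Rightarrow> real"
    assume "eq_L2 f f"
    then have f: "square_int f"
      by (simp add: eq_L2_def)
    have "(\<integral>x. f x * f x \<partial>unit_leb) = 0 \<longleftrightarrow> (AE x in unit_leb. f x * f x = 0)"
      using square_int_prod[OF f f]
      by (intro integral_nonneg_eq_0_iff_AE) auto
    then show "(\<integral>x. f x * f x \<partial>unit_leb) = 0 \<longleftrightarrow> eq_L2 f (\<lambda>x. 0)"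
      using f by (simp add: eq_L2_def square_int_zero)
  qed
qed

end

text \<open>
  Multiplication by the characteristic function of a (Lebesgue measurable) set; the result
  does not depend on the representative of \<open>u\<close>.
\<close>

definition cutoff :: "real set \<Rightarrow> L2 \<Rightarrow> L2" where
  "cutoff \<omega> u = abs_L2 (\<lambda>x. indicator \<omega> x * rep_L2 u x)"


section \<open>The degenerate operator\<close>

definition abs_cont_on :: "real \<Rightarrow> real \<Rightarrow> (real \<Rightarrow> real) \<Rightarrow> bool" where
  "abs_cont_on a b f \<longleftrightarrow>
    (\<forall>\<epsilon>>0. \<exists>\<delta>>0. \<forall>(n::nat) u v.
      (\<forall>i<n. a \<le> u i \<and> u i \<le> v i \<and> v i \<le> b) \<longrightarrow>
      disjoint_family_on (\<lambda>i. {u i<..<v i}) {..<n} \<longrightarrow>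
      (\<Sum>i<n. v i - u i) < \<delta> \<longrightarrow> (\<Sum>i<n. \<bar>f (v i) - f (u i)\<bar>) < \<epsilon>)"

definition loc_abs_cont :: "(real \<Rightarrow> real) \<Rightarrow> bool" where
  "loc_abs_cont f \<longleftrightarrow> (\<forall>a b. 0 < a \<longrightarrow> a < b \<longrightarrow> b < 1 \<longrightarrow> abs_cont_on a b f)"

text \<open>
  Functions in \<open>H_space \<alpha>\<close> are only constrained on \<open>(0,1)\<close>. The boundary values at \<open>0\<close> and \<open>1\<close>
  (in \<open>H_space\<close>, \<open>BC\<close>) are those of the continuous extension, that is, one-sided limits.
  The derivative of a locally absolutely continuous function exists almost everywhere; the
  arbitrary values of \<open>deriv\<close> at the other points form a null set.
\<close>

definition H_space :: "real \<Rightarrow> (real \<Rightarrow> real) set" where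
  "H_space \<alpha> = {\<theta>. square_int \<theta> \<and> loc_abs_cont \<theta> \<and>
     integrable unit_leb (\<lambda>x. x powr \<alpha> * \<bar>deriv \<theta> x\<bar>\<^sup>2) \<and> (\<theta> \<longlongrightarrow> 0) (at_left 1)}"

text \<open>
  \<open>x\<^sup>\<alpha>\<theta>'\<close> is required to have a locally absolutely continuous representative \<open>q\<close>, which is
  unique on \<open>(0,1)\<close>; this is what gives a meaning to \<open>(x\<^sup>\<alpha>\<theta>')'\<close> as a function and to the
  trace of \<open>x\<^sup>\<alpha>\<theta>'\<close> at \<open>0\<close>.
\<close>

definition is_flux :: "real \<Rightarrow> (real \<Rightarrow> real) \<Rightarrow> (real \<Rightarrow> real) \<Rightarrow> bool" where
  "is_flux \<alpha> \<theta> q \<longleftrightarrow> loc_abs_cont q \<and> (AE x in unit_leb. q x = x powr \<alpha> * deriv \<theta> x)"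

definition BC :: "real \<Rightarrow> (real \<Rightarrow> real) \<Rightarrow> (real \<Rightarrow> real) \<Rightarrow> bool" where
  "BC \<alpha> \<theta> q \<longleftrightarrow> (if \<alpha> < 1 then (\<theta> \<longlongrightarrow> 0) (at_right 0) else (q \<longlongrightarrow> 0) (at_right 0))"

text \<open>
  The operator \<open>\<P>\<theta> = -(x\<^sup>\<alpha>\<theta>')'\<close> on \<open>L\<^sup>2(0,1)\<close>, given by its graph; it is single-valued.
\<close>

definition P_graph :: "real \<Rightarrow> (L2 \<times> L2) set" where
  "P_graph \<alpha> = {(abs_L2 \<theta>, abs_L2 (\<lambda>x. - deriv q x)) | \<theta> q.
     \<theta> \<in> H_space \<alpha> \<and> is_flux \<alpha> \<theta> q \<and> square_int (deriv q) \<and> BC \<alpha> \<theta> q}"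


section \<open>The semigroup and the impulsive system\<close>

definition C0_semigroup :: "(real \<Rightarrow> 'a::real_normed_vector \<Rightarrow> 'a) \<Rightarrow> bool" where
  "C0_semigroup S \<longleftrightarrow>
     (\<forall>t\<ge>0. bounded_linear (S t)) \<and> (\<forall>u. S 0 u = u) \<and>
     (\<forall>s\<ge>0. \<forall>t\<ge>0. \<forall>u. S (s + t) u = S s (S t u)) \<and>
     (\<forall>u. ((\<lambda>h. S h u) \<longlongrightarrow> u) (at_right 0))"

definition generator_graph :: "(real \<Rightarrow> 'a::real_normed_vector \<Rightarrow> 'a) \<Rightarrow> ('a \<times> 'a) set" where
  "generator_graph S = {(u, w). ((\<lambda>h. (S h u - u) /\<^sub>R h) \<longlongrightarrow> w) (at_right 0)}"

text \<open>
  \<open>heat_semigroup \<alpha> t\<close> is \<open>e\<^sup>-\<^sup>t\<^sup>\<P>\<close>, the strongly continuous semigroup generated by \<open>-\<P>\<close>. A semigroup is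
  determined by its generator for \<open>t \<ge> 0\<close>; the choice only affects the irrelevant values at
  \<open>t < 0\<close>.
\<close>

definition heat_semigroup :: "real \<Rightarrow> real \<Rightarrow> L2 \<Rightarrow> L2" where
  "heat_semigroup \<alpha> = (SOME S. C0_semigroup S \<and> generator_graph S = {(u, - w) | u w. (u, w) \<in> P_graph \<alpha>})"

definition jump_time :: "(nat \<Rightarrow> real) \<Rightarrow> nat \<Rightarrow> real" where
  "jump_time t m = (t m + t (Suc m)) / 2"

text \<open>
  \<open>z\<close> is right-continuous at the jump times: \<open>z (jump_time t m)\<close> is the value after the jump.
  Only the values of \<open>z\<close> on \<open>[0, sup t)\<close> are constrained.
\<close>

definition impulse_solution ::
  "real \<Rightarrow> real set \<Rightarrow> (nat \<Rightarrow> real) \<Rightarrow> (nat \<Rightarrow> L2 \<Rightarrow> L2) \<Rightarrow> L2 \<Rightarrow> (real \<Rightarrow> L2) \<Rightarrow> bool" where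
  "impulse_solution \<alpha> \<omega> t F z0 z \<longleftrightarrow>
     z 0 = z0 \<and>
     (\<forall>s. 0 \<le> s \<and> s < jump_time t 0 \<longrightarrow> z s = heat_semigroup \<alpha> s (z 0)) \<and>
     (\<forall>m s. jump_time t m \<le> s \<and> s < jump_time t (Suc m) \<longrightarrow>
        z s = heat_semigroup \<alpha> (s - jump_time t m) (z (jump_time t m))) \<and>
     (\<forall>m. \<exists>l. (z \<longlongrightarrow> l) (at_left (jump_time t m)) \<and>
        z (jump_time t m) = l + cutoff \<omega> (F m (z (t m))))"

end

theory Submission
  imports Defs "HOL-Complex_Analysis.Great_Picard"
begin

text \<open>
  The inverse of \<open>\<P>\<close> is an explicit integral operator, which is compact, symmetric and positive; its
  eigenvectors form an orthonormal basis \<open>B\<close> in which the semigroup is diagonal, \<open>b \<mapsto> exp (- \<lambda>\<^sub>b t) b\<close>. That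
  every element of the graph of \<open>\<P>\<close> is of the form \<open>(\<P>\<^sup>-\<^sup>1 f, f)\<close> rests on the theorem that an absolutely
  continuous function is the integral of its derivative.

  Up to a factor, the eigenfunction for \<open>\<lambda>\<close> is \<open>x\<^sup>\<kappa> G(\<lambda> x\<^sup>\<beta>)\<close> with \<open>\<beta> = 2 - \<alpha>\<close> and one entire function
  \<open>G\<close> of order \<open>1/2\<close>. So a combination \<open>u\<close> of eigenfunctions with \<open>\<lambda> \<le> s\<^sup>2\<close> is, up to the factor \<open>x\<^sup>\<kappa>\<close>, an entire
  function of \<open>y = x\<^sup>\<beta>\<close> whose \<open>k\<close>-th Taylor coefficient is at most \<open>M (A s\<^sup>2)\<^sup>k / k!\<^sup>2\<close>. Its Taylor polynomial
  of degree \<open>O(s)\<close> approximates it so well that Lagrange interpolation at nodes in \<open>\<omega>\<close> gives the spectral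
  inequality \<open>\<parallel>u\<parallel> \<le> exp (C s) \<parallel>1\<^sub>\<omega> u\<parallel>\<close>.

  By duality an impulse of norm at most \<open>exp (2 C s) \<parallel>z\<parallel>\<close> cancels all modes with \<open>\<lambda> \<le> s\<^sup>2\<close>, after which the
  solution decays like \<open>exp (- s\<^sup>2 t)\<close>. With \<open>t\<^sub>m = T - T / 2\<^sup>m\<^sup>+\<^sup>1\<close> and \<open>s\<^sub>m = 4\<^sup>m R\<close> the decay beats the
  cost of all impulses.
\<close>

section \<open>Absolutely continuous functions are indefinite integrals\<close>

text \<open>\<open>heat_semigroup\<close> is an arbitrary choice among the semigroups with the
  prescribed generator. The diagonal semigroup shows that there is one; that the chosen one
  coincides with it is a uniqueness statement, and this is where simplicity of the spectrum enters.

  Square summability of \<open>1 / lam b\<close> leaves O(\<Lambda>^2) eigenvalues below \<Lambda>,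
  and the normalising factors of the eigenfunctions grow polynomially with the eigenvalue; both
  losses are absorbed in exp (C s). The delicate point is that the exponent is s for frequencies up
  to s^2: the two factorials in the Taylor bound are what lets O(s) nodes suffice.

  An impulse acts at a midpoint but sees only the state at \<open>t m\<close>. It is therefore
  computed from the state that the semigroup predicts just before the jump, and only the second half
  of each interval serves the decay. With frequency s and remaining time h, the decay exponent s^2 h
  has to exceed a multiple of s, so \<open>s m\<close> must grow at least as fast as 1 / h, which
  doubles at each step; quadrupling leaves a factor 2^m to spare.\<close>

text \<open>The variation of \<open>F\<close> is taken over monotone sequences of points, so that splitting an interval is clipping
  with \<open>min\<close> and \<open>max\<close>, and \<open>ac_mod\<close> drops the restriction of \<open>abs_cont_on\<close> to a compact interval: it is applied to
  functions that are extended by constants.\<close>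

definition ac_mod :: "(real \<Rightarrow> real) \<Rightarrow> real \<Rightarrow> real \<Rightarrow> bool" where
  "ac_mod F \<epsilon> \<delta> \<longleftrightarrow> (\<forall>(n::nat) u v. (\<forall>i<n. u i \<le> v i) \<longrightarrow>
      disjoint_family_on (\<lambda>i. {u i<..<v i}) {..<n} \<longrightarrow>
      (\<Sum>i<n. v i - u i) < \<delta> \<longrightarrow> (\<Sum>i<n. \<bar>F (v i) - F (u i)\<bar>) < \<epsilon>)"

text \<open>A bijection with an initial segment of the naturals frees the index set;
  \<open>V_ac\<close> needs the estimate for a family indexed by pairs.\<close>

lemma ac_mod_finite:
  assumes "ac_mod F \<epsilon> \<delta>" "finite I" "\<And>i. i \<in> I \<Longrightarrow> u i \<le> v i"
    "disjoint_family_on (\<lambda>i. {u i<..<v i}) I" "(\<Sum>i\<in>I. v i - u i) < \<delta>"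
  shows "(\<Sum>i\<in>I. \<bar>F (v i) - F (u i)\<bar>) < \<epsilon>"
proof -
  obtain h where h: "bij_betw h {..<card I} I"
    using ex_bij_betw_nat_finite[OF assms(2)] by (auto simp: atLeast0LessThan)
  have "(\<Sum>i<card I. \<bar>F ((v \<circ> h) i) - F ((u \<circ> h) i)\<bar>) < \<epsilon>"
  proof (rule assms(1)[unfolded ac_mod_def, rule_format])
    show "(u \<circ> h) i \<le> (v \<circ> h) i" if "i < card I" for i
      using that h assms(3) by (auto simp: bij_betw_def)
    show "disjoint_family_on (\<lambda>i. {(u \<circ> h) i<..<(v \<circ> h) i}) {..<card I}"
      unfolding disjoint_family_on_def
    proof (intro ballI impI)
      fix i j assume ij: "i \<in> {..<card I}" "j \<in> {..<card I}" "i \<noteq> j"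
      have "h i \<in> I" "h j \<in> I" "h i \<noteq> h j"
        using ij h by (auto simp: bij_betw_def inj_on_def)
      then show "{(u \<circ> h) i<..<(v \<circ> h) i} \<inter> {(u \<circ> h) j<..<(v \<circ> h) j} = {}"
        using assms(4)[unfolded disjoint_family_on_def] unfolding comp_def by blast
    qed
    show "(\<Sum>i<card I. (v \<circ> h) i - (u \<circ> h) i) < \<delta>"
      using assms(5) sum.reindex_bij_betw[OF h, of "\<lambda>i. v i - u i"] by simp
  qed
  then show ?thesis
    using sum.reindex_bij_betw[OF h, of "\<lambda>i. \<bar>F (v i) - F (u i)\<bar>"] by simp
qed

text \<open>Clamping to [a,b] is monotone and does not increase distances: the clamped intervals lie
  inside the original ones, so they remain disjoint and short.\<close>

lemma ac_mod_clamp: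
  assumes "abs_cont_on a b F" "a \<le> b" "0 < \<epsilon>"
  obtains \<delta> where "0 < \<delta>" "ac_mod (\<lambda>x. F (max a (min b x))) \<epsilon> \<delta>"
proof -
  let ?c = "\<lambda>x. max a (min b x)"
  obtain \<delta> where \<delta>: "\<delta> > 0" and H: "\<And>(n::nat) u v. (\<forall>i<n. a \<le> u i \<and> u i \<le> v i \<and> v i \<le> b) \<Longrightarrow>
      disjoint_family_on (\<lambda>i. {u i<..<v i}) {..<n} \<Longrightarrow>
      (\<Sum>i<n. v i - u i) < \<delta> \<Longrightarrow> (\<Sum>i<n. \<bar>F (v i) - F (u i)\<bar>) < \<epsilon>"
    using assms(1)[unfolded abs_cont_on_def, rule_format, OF assms(3)] by blast
  have "ac_mod (\<lambda>x. F (?c x)) \<epsilon> \<delta>"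
    unfolding ac_mod_def
  proof (intro allI impI)
    fix n :: nat and u v
    assume uv: "\<forall>i<n. u i \<le> v i" and dis: "disjoint_family_on (\<lambda>i. {u i<..<v i}) {..<n}"
      and len: "(\<Sum>i<n. v i - u i) < \<delta>"
    show "(\<Sum>i<n. \<bar>F (?c (v i)) - F (?c (u i))\<bar>) < \<epsilon>"
    proof (rule H)
      show "\<forall>i<n. a \<le> ?c (u i) \<and> ?c (u i) \<le> ?c (v i) \<and> ?c (v i) \<le> b"
        using uv assms(2) by (auto simp: max_def min_def)
      have sub: "{?c (u i)<..<?c (v i)} \<subseteq> {u i<..<v i}" for i
        by auto
      show "disjoint_family_on (\<lambda>i. {?c (u i)<..<?c (v i)}) {..<n}"
        unfolding disjoint_family_on_def
      proof (intro ballI impI)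
        fix i j assume "i \<in> {..<n}" "j \<in> {..<n}" "i \<noteq> j"
        then have "{u i<..<v i} \<inter> {u j<..<v j} = {}"
          using dis unfolding disjoint_family_on_def by blast
        then show "{?c (u i)<..<?c (v i)} \<inter> {?c (u j)<..<?c (v j)} = {}"
          using sub[of i] sub[of j] by blast
      qed
      have "(\<Sum>i<n. ?c (v i) - ?c (u i)) \<le> (\<Sum>i<n. v i - u i)"
      proof (rule sum_mono)
        fix i assume "i \<in> {..<n}"
        then have "u i \<le> v i" using uv by auto
        then show "?c (v i) - ?c (u i) \<le> v i - u i"
          by (auto simp: max_def min_def)
      qed
      then show "(\<Sum>i<n. ?c (v i) - ?c (u i)) < \<delta>"
        using len by simp
    qed
  qed
  then show ?thesis using \<delta> that by blast
qed

section \<open>The variation function of an absolutely continuous function\<close>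

definition vsum :: "(real \<Rightarrow> real) \<Rightarrow> (nat \<Rightarrow> real) \<Rightarrow> nat \<Rightarrow> real" where
  "vsum F p n = (\<Sum>i<n. \<bar>F (p (Suc i)) - F (p i)\<bar>)"

text \<open>No left end point is prescribed. In \<open>ac_fun\<close> the function is constant to
  the left of \<open>a\<close>, so the supremum over all sequences ending before \<open>y\<close> is
  the variation accumulated from \<open>a\<close> on.\<close>

definition vset :: "(real \<Rightarrow> real) \<Rightarrow> real \<Rightarrow> real set" where
  "vset F y = {vsum F p n |p n. mono p \<and> p n \<le> y}"

lemma mono_clip:
  fixes p :: "nat \<Rightarrow> real"
  assumes "mono p" shows "mono (\<lambda>i. min (p i) x)" "mono (\<lambda>i. max (p i) x)"
  using assms unfolding mono_def by (meson min.mono max.mono order_refl)+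

text \<open>Triangle inequality at \<open>x\<close> for an increment that straddles it; any other
  increment survives in the clipped sequence of its own side.\<close>

lemma vsum_split: "vsum F p n \<le> vsum F (\<lambda>i. min (p i) x) n + vsum F (\<lambda>i. max (p i) x) n"
  unfolding vsum_def sum.distrib[symmetric]
proof (rule sum_mono)
  fix i
  consider "p i \<le> x" "p (Suc i) \<le> x" | "p i \<le> x" "x \<le> p (Suc i)" | "x \<le> p i" "p (Suc i) \<le> x"
    | "x \<le> p i" "x \<le> p (Suc i)" by linarith
  then show "\<bar>F (p (Suc i)) - F (p i)\<bar> \<le> \<bar>F (min (p (Suc i)) x) - F (min (p i) x)\<bar>
      + \<bar>F (max (p (Suc i)) x) - F (max (p i) x)\<bar>"
    by cases (simp_all add: min_def max_def, arith+)
qed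

lemma disjoint_mono_intervals:
  fixes p :: "nat \<Rightarrow> real"
  assumes "mono p"
  shows "disjoint_family_on (\<lambda>i. {p i<..<p (Suc i)}) I"
  unfolding disjoint_family_on_def
proof (intro ballI impI)
  fix i j :: nat assume "i \<noteq> j"
  then have "Suc i \<le> j \<or> Suc j \<le> i" by auto
  then have "p (Suc i) \<le> p j \<or> p (Suc j) \<le> p i"
    using assms by (auto simp: mono_def)
  then show "{p i<..<p (Suc i)} \<inter> {p j<..<p (Suc j)} = {}" by auto
qed

lemma vsum_less:
  assumes "ac_mod F \<epsilon> \<delta>" "mono p" "p n - p 0 < \<delta>"
  shows "vsum F p n < \<epsilon>"
  unfolding vsum_def
  by (rule ac_mod_finite[OF assms(1)])
    (use assms in \<open>auto simp: disjoint_mono_intervals sum_lessThan_telescope mono_def\<close>)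

locale ac_fun =
  fixes F :: "real \<Rightarrow> real" and a :: real
  assumes ac: "\<And>\<epsilon>. \<epsilon> > 0 \<Longrightarrow> \<exists>\<delta>>0. ac_mod F \<epsilon> \<delta>"
    and const: "\<And>x. x \<le> a \<Longrightarrow> F x = F a"
begin

definition V :: "real \<Rightarrow> real" where "V y = Sup (vset F y)"

lemma vset_step:
  assumes "ac_mod F 1 \<delta>" "0 \<le> h" "h < \<delta>" "s \<in> vset F (y + h)"
  shows "\<exists>s'\<in>vset F y. s \<le> s' + 1"
proof -
  obtain p n where s: "s = vsum F p n" and p: "mono p" "p n \<le> y + h"
    using assms(4) by (auto simp: vset_def)
  have m: "mono (\<lambda>i. min (p i) y)" "mono (\<lambda>i. max (p i) y)"
    using p(1) by (auto intro: mono_clip)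
  have "vsum F (\<lambda>i. max (p i) y) n < 1"
    by (rule vsum_less[OF assms(1) m(2)]) (use p(2) assms in auto)
  then show ?thesis
    using vsum_split[of F p n y] m(1) unfolding s vset_def
    by (intro bexI[of _ "vsum F (\<lambda>i. min (p i) y) n"]) (auto intro!: exI[of _ "\<lambda>i. min (p i) y"] exI[of _ n])
qed

text \<open>Induction over steps of length \<delta>/2: the variation vanishes up to
  \<open>a\<close>, and by \<open>vset_step\<close> each step raises it by at most 1.\<close>

lemma bdd_vset: "bdd_above (vset F y)"
proof -
  obtain \<delta> where \<delta>: "\<delta> > 0" "ac_mod F 1 \<delta>" using ac[of 1] by auto
  define h where "h = \<delta> / 2"
  have h: "h > 0" "h < \<delta>" using \<delta> by (auto simp: h_def)
  have bd: "\<forall>s\<in>vset F (a + real k * h). s \<le> real k" for k :: nat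
  proof (induction k)
    case 0
    show ?case
    proof
      fix s assume "s \<in> vset F (a + real 0 * h)"
      then obtain p n where s: "s = vsum F p n" and p: "mono p" "p n \<le> a"
        by (auto simp: vset_def)
      have "F (p i) = F a" if "i \<le> n" for i
        by (rule const) (use p that in \<open>auto simp: mono_def intro: order_trans\<close>)
      then show "s \<le> real 0" by (simp add: s vsum_def)
    qed
  next
    case (Suc k)
    show ?case
    proof
      fix s assume s: "s \<in> vset F (a + real (Suc k) * h)"
      have "a + real (Suc k) * h = (a + real k * h) + h" by (simp add: algebra_simps)
      then obtain s' where "s' \<in> vset F (a + real k * h)" "s \<le> s' + 1"
        using vset_step[OF \<delta>(2) _ h(2)] h(1) s by (metis less_imp_le)
      then show "s \<le> real (Suc k)" using Suc by fastforce
    qed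
  qed
  obtain k :: nat where "(y - a) / h < real k" using reals_Archimedean2 by blast
  then have "y \<le> a + real k * h" using h by (simp add: field_simps)
  then have "vset F y \<subseteq> vset F (a + real k * h)"
    by (auto simp: vset_def intro: order_trans)
  then show ?thesis using bd[of k] by (meson bdd_above.I bdd_above_mono)
qed

lemma vset_nonempty: "vset F y \<noteq> {}"
proof -
  have "vsum F (\<lambda>_. y) 0 \<in> vset F y" unfolding vset_def by (auto simp: mono_def intro!: exI[of _ "\<lambda>_. y"])
  then show ?thesis by auto
qed

text \<open>A sequence ending before \<open>x\<close> can be prolonged by \<open>x\<close> and
  \<open>y\<close>. The purpose of the estimate is that V + F and V - F are both increasing.\<close>

lemma V_super:
  assumes "x \<le> y" shows "V x + \<bar>F y - F x\<bar> \<le> V y"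
proof -
  have "V x \<le> V y - \<bar>F y - F x\<bar>"
    unfolding V_def[of x]
  proof (rule cSup_least[OF vset_nonempty])
    fix s assume "s \<in> vset F x"
    then obtain p n where s: "s = vsum F p n" and p: "mono p" "p n \<le> x"
      by (auto simp: vset_def)
    define p' where "p' i = (if i \<le> n then p i else if i = Suc n then x else y)" for i
    have m: "mono p'"
    proof (rule monoI)
      fix i j :: nat assume ij: "i \<le> j"
      have "p i \<le> p j" using p(1) ij by (auto simp: mono_def)
      moreover have "p i \<le> x" if "i \<le> n"
        using p that by (auto simp: mono_def intro: order_trans)
      ultimately show "p' i \<le> p' j"
        using ij assms by (auto simp: p'_def)
    qed
    have "vsum F p' (Suc (Suc n)) \<in> vset F y"
      using m unfolding vset_def p'_def by (auto intro!: exI)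
    then have "vsum F p' (Suc (Suc n)) \<le> V y"
      unfolding V_def by (rule cSup_upper[OF _ bdd_vset])
    moreover have "(\<Sum>i<n. \<bar>F (p' (Suc i)) - F (p' i)\<bar>) = vsum F p n"
      unfolding vsum_def by (rule sum.cong) (auto simp: p'_def)
    ultimately show "s \<le> V y - \<bar>F y - F x\<bar>"
      unfolding s vsum_def by (simp add: p'_def)
  qed
  then show ?thesis by simp
qed

text \<open>A sequence nearly optimal up to \<open>y\<close> is clipped at \<open>x\<close>: the
  part below \<open>x\<close> contributes at most V x, so the part above carries almost the whole
  increment.\<close>

lemma V_diff:
  assumes "x \<le> y" "0 < \<eta>"
  obtains p n where "mono p" "x \<le> p 0" "p n \<le> y" "V y - V x \<le> vsum F p n + \<eta>"
proof -
  obtain s where "s \<in> vset F y" "V y - \<eta> < s"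
    using less_cSup_iff[OF vset_nonempty bdd_vset, of "V y - \<eta>" y] assms(2) unfolding V_def by auto
  then obtain p n where p: "mono p" "p n \<le> y" "V y - \<eta> < vsum F p n"
    by (auto simp: vset_def)
  have m: "mono (\<lambda>i. min (p i) x)" "mono (\<lambda>i. max (p i) x)"
    using p(1) by (auto intro: mono_clip)
  have "vsum F (\<lambda>i. min (p i) x) n \<le> V x"
    unfolding V_def by (rule cSup_upper[OF _ bdd_vset]) (use m in \<open>auto simp: vset_def intro!: exI[of _ "\<lambda>i. min (p i) x"] exI[of _ n]\<close>)
  then show ?thesis
    using vsum_split[of F p n x] p assms(1) m(2)
    by (intro that[of "\<lambda>i. max (p i) x" n]) auto
qed

text \<open>\<open>V\<close> inherits the modulus \<delta>: the nearly optimal sequences inside the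
  single intervals form together one disjoint family whose total length is still below
  \<delta>.\<close>

lemma V_ac:
  assumes "ac_mod F \<epsilon> \<delta>" "finite I" "\<And>i. i \<in> I \<Longrightarrow> u i \<le> v i"
    "disjoint_family_on (\<lambda>i. {u i<..<v i}) I" "(\<Sum>i\<in>I. v i - u i) < \<delta>"
  shows "(\<Sum>i\<in>I. V (v i) - V (u i)) \<le> \<epsilon>"
proof (rule field_le_epsilon)
  fix \<eta> :: real assume \<eta>: "\<eta> > 0"
  \<comment> \<open>The error \<eta> is shared among the intervals; the 1 in the denominator covers
    an empty index set.\<close>
  define \<eta>' where "\<eta>' = \<eta> / (1 + real (card I))"
  have \<eta>': "\<eta>' > 0" "real (card I) * \<eta>' \<le> \<eta>" using \<eta> by (auto simp: \<eta>'_def field_simps add_pos_nonneg)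
  have "\<exists>p n. mono p \<and> u i \<le> p 0 \<and> p n \<le> v i \<and> V (v i) - V (u i) \<le> vsum F p n + \<eta>'" if "i \<in> I" for i
    using V_diff[OF assms(3)[OF that] \<eta>'(1)] by metis
  then obtain p n where pn: "\<And>i. i \<in> I \<Longrightarrow> mono (p i) \<and> u i \<le> p i 0 \<and> p i (n i) \<le> v i
      \<and> V (v i) - V (u i) \<le> vsum F (p i) (n i) + \<eta>'"
    by metis
  let ?J = "SIGMA i:I. {..<n i}"
  have "(\<Sum>(i,j)\<in>?J. \<bar>F (p i (Suc j)) - F (p i j)\<bar>) < \<epsilon>"
    unfolding case_prod_unfold
  proof (rule ac_mod_finite[OF assms(1)])
    show "finite ?J" using assms(2) by auto
    show "p (fst k) (snd k) \<le> p (fst k) (Suc (snd k))" if "k \<in> ?J" for k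
      using that pn by (auto simp: mono_def)
    show "disjoint_family_on (\<lambda>k. {p (fst k) (snd k)<..<p (fst k) (Suc (snd k))}) ?J"
      unfolding disjoint_family_on_def
    proof (intro ballI impI)
      fix k l assume kl: "k \<in> ?J" "l \<in> ?J" "k \<noteq> l"
      obtain i j i' j' where [simp]: "k = (i,j)" "l = (i',j')" by (cases k, cases l)
      show "{p (fst k) (snd k)<..<p (fst k) (Suc (snd k))} \<inter> {p (fst l) (snd l)<..<p (fst l) (Suc (snd l))} = {}"
      proof (cases "i = i'")
        case True
        then have "j \<noteq> j'" using kl by auto
        then show ?thesis
          using disjoint_mono_intervals[of "p i" UNIV] pn kl True
          unfolding disjoint_family_on_def by auto
      next
        case False
        have sub: "{p i j<..<p i (Suc j)} \<subseteq> {u i<..<v i}" if "i \<in> I" "j < n i" for i j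
        proof -
          have "p i 0 \<le> p i j" "p i (Suc j) \<le> p i (n i)"
            using pn[OF that(1)] that(2) by (auto simp: mono_def)
          then show ?thesis using pn[OF that(1)] by auto
        qed
        have "{u i<..<v i} \<inter> {u i'<..<v i'} = {}"
          using assms(4) kl False unfolding disjoint_family_on_def by auto
        then show ?thesis
          using sub[of i j] sub[of i' j'] kl by fastforce
      qed
    qed
    have "(\<Sum>k\<in>?J. p (fst k) (Suc (snd k)) - p (fst k) (snd k)) = (\<Sum>i\<in>I. \<Sum>j<n i. p i (Suc j) - p i j)"
      using assms(2) by (subst sum.Sigma) (auto simp: case_prod_unfold)
    also have "\<dots> \<le> (\<Sum>i\<in>I. v i - u i)"
    proof (rule sum_mono)
      fix i assume "i \<in> I"
      then show "(\<Sum>j<n i. p i (Suc j) - p i j) \<le> v i - u i"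
        using pn[of i] by (simp add: sum_lessThan_telescope)
    qed
    finally show "(\<Sum>k\<in>?J. p (fst k) (Suc (snd k)) - p (fst k) (snd k)) < \<delta>"
      using assms(5) by simp
  qed
  then have "(\<Sum>i\<in>I. vsum F (p i) (n i)) < \<epsilon>"
    unfolding vsum_def using assms(2) by (subst sum.Sigma) auto
  moreover have "(\<Sum>i\<in>I. V (v i) - V (u i)) \<le> (\<Sum>i\<in>I. vsum F (p i) (n i) + \<eta>')"
    by (rule sum_mono) (use pn in auto)
  ultimately show "(\<Sum>i\<in>I. V (v i) - V (u i)) \<le> \<epsilon> + \<eta>"
    using \<eta>' by (simp add: sum.distrib)
qed

end


text \<open>Luzin's property N for the Stieltjes measure: a null set is covered by non-overlapping
  closed intervals of total length below \<delta>, and their measures add up to at most \<epsilon>.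
  The intervals of the cover serve as their own indices, hence the index type
  \<open>real set\<close>.\<close>

lemma mono_ac_null:
  fixes H :: "real \<Rightarrow> real"
  assumes mono: "mono H" and cont: "continuous_on UNIV H"
    and ac: "\<And>\<epsilon>. \<epsilon> > 0 \<Longrightarrow> \<exists>\<delta>>0. \<forall>(I :: real set set) u v. finite I \<longrightarrow> (\<forall>i\<in>I. u i \<le> v i) \<longrightarrow>
      disjoint_family_on (\<lambda>i. {u i<..<v i}) I \<longrightarrow> (\<Sum>i\<in>I. v i - u i) < \<delta> \<longrightarrow> (\<Sum>i\<in>I. H (v i) - H (u i)) \<le> \<epsilon>"
    and N: "N \<in> null_sets lborel" and ab: "a < b"
  shows "emeasure (interval_measure H) (N \<inter> {a..b}) = 0"
proof -
  let ?M = "interval_measure H"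
  have em: "emeasure ?M {x..y} = ennreal (H y - H x)" if "x \<le> y" for x y
    by (rule emeasure_interval_measure_Icc[OF that monoD[OF mono] cont])
  have "emeasure ?M (N \<inter> {a..b}) \<le> 0 + ennreal \<epsilon>" if \<epsilon>: "\<epsilon> > 0" for \<epsilon>
  proof -
    obtain \<delta> where \<delta>: "\<delta> > 0" and H: "\<And>(I :: real set set) u v. finite I \<Longrightarrow> (\<forall>i\<in>I. u i \<le> v i) \<Longrightarrow>
      disjoint_family_on (\<lambda>i. {u i<..<v i}) I \<Longrightarrow> (\<Sum>i\<in>I. v i - u i) < \<delta> \<Longrightarrow> (\<Sum>i\<in>I. H (v i) - H (u i)) \<le> \<epsilon>"
      using ac[OF \<epsilon>] by blast
    let ?S = "N \<inter> {a..b}"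
    have S0: "?S \<in> null_sets lborel" by (rule null_set_Int2[OF N]) simp
    then have S1: "?S \<in> null_sets lebesgue" by (rule null_sets_completionI)
    have Slm: "?S \<in> lmeasurable" using S1 by (auto simp: fmeasurable_def null_sets_def)
    obtain \<D> where D: "countable \<D>"
      and DK: "\<And>K. K \<in> \<D> \<Longrightarrow> K \<subseteq> cbox a b \<and> K \<noteq> {} \<and> (\<exists>c d. K = cbox c d)"
      and Ddis: "pairwise (\<lambda>A B. interior A \<inter> interior B = {}) \<D>"
      and cov: "?S \<subseteq> \<Union>\<D>" and lmD: "\<Union>\<D> \<in> lmeasurable"
      and mD: "measure lebesgue (\<Union>\<D>) \<le> measure lebesgue ?S + \<delta> / 2"
      by (rule measurable_outer_intervals_bounded[OF Slm _ half_gt_zero[OF \<delta>], of a b]) (simp, blast)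
    have m0: "measure lebesgue ?S = 0" using S1 by (simp add: measure_eq_0_null_sets)
    have K: "K = {Inf K..Sup K}" "Inf K \<le> Sup K" "interior K = {Inf K<..<Sup K}" if KD: "K \<in> \<D>" for K
    proof -
      obtain c d where K: "K = {c..d}" "c \<le> d" using DK[OF KD] by auto
      then show "K = {Inf K..Sup K}" "Inf K \<le> Sup K" "interior K = {Inf K<..<Sup K}" by auto
    qed
    have fin: "emeasure ?M (\<Union>E) \<le> ennreal \<epsilon>" if E: "finite E" "E \<subseteq> \<D>" for E
    proof -
      have dis: "disjoint_family_on (\<lambda>K. {Inf K<..<Sup K}) E"
        unfolding disjoint_family_on_def
      proof (intro ballI impI)
        fix A B assume AB: "A \<in> E" "B \<in> E" "A \<noteq> B"
        then have "interior A \<inter> interior B = {}" using Ddis E(2) unfolding pairwise_def by blast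
        then show "{Inf A<..<Sup A} \<inter> {Inf B<..<Sup B} = {}"
          using K(3) AB E(2) by (metis subsetD)
      qed
      have "(\<Sum>K\<in>E. Sup K - Inf K) = (\<Sum>K\<in>E. measure lebesgue {Inf K<..<Sup K})"
        by (rule sum.cong) (use K E in auto)
      also have "\<dots> = measure lebesgue (\<Union>K\<in>E. {Inf K<..<Sup K})"
        by (rule measure_finite_Union[symmetric, OF E(1) _ dis]) (use K(2) E(2) in \<open>auto simp: subset_iff\<close>)
      also have "\<dots> \<le> measure lebesgue (\<Union>\<D>)"
      proof (rule measure_mono_fmeasurable[OF _ _ lmD])
        show "(\<Union>K\<in>E. {Inf K<..<Sup K}) \<subseteq> \<Union>\<D>"
          using K(3) E(2) interior_subset by (smt (verit) UN_least Union_upper subset_iff)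
      qed (use E in auto)
      finally have "(\<Sum>K\<in>E. Sup K - Inf K) < \<delta>"
        using mD m0 \<delta> by simp
      then have le: "(\<Sum>K\<in>E. H (Sup K) - H (Inf K)) \<le> \<epsilon>"
        using H[OF E(1) _ dis] K(2) E(2) by blast
      have "emeasure ?M (\<Union>E) = emeasure ?M (\<Union>K\<in>E. {Inf K..Sup K})"
        using K(1) E(2) by (metis (no_types, lifting) SUP_cong image_ident subsetD)
      also have "\<dots> \<le> (\<Sum>K\<in>E. emeasure ?M {Inf K..Sup K})"
        by (rule emeasure_subadditive_finite) (use E in auto)
      also have "\<dots> = (\<Sum>K\<in>E. ennreal (H (Sup K) - H (Inf K)))"
        using em K(2) E(2) by (intro sum.cong refl) blast
      also have "\<dots> = ennreal (\<Sum>K\<in>E. H (Sup K) - H (Inf K))"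
        by (rule sum_ennreal) (use monoD[OF mono] K(2) E(2) in auto)
      also have "\<dots> \<le> ennreal \<epsilon>" using le by (rule ennreal_leI)
      finally show ?thesis .
    qed
    show ?thesis
    proof (cases "\<D> = {}")
      case True
      then show ?thesis using cov by auto
    next
      case False
      \<comment> \<open>Absolute continuity controls finite subfamilies only; the countable cover is
        the increasing limit of the unions of its first members.\<close>
      define A where "A n = \<Union>(from_nat_into \<D> ` {..<n})" for n
      have fD: "from_nat_into \<D> i \<in> \<D>" for i using from_nat_into[OF False] .
      have sA: "range A \<subseteq> sets ?M"
        unfolding A_def using fD K(1) by (auto intro!: sets.finite_UN) (metis atLeastAtMost_borel)
      have iA: "incseq A" unfolding A_def by (rule monoI) (auto intro: order_less_le_trans)
      have "\<Union>\<D> = (\<Union>n. A n)"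
      proof -
        have "(\<Union>n. A n) = \<Union>(range (from_nat_into \<D>))"
          unfolding A_def by (auto intro: lessI)
        then show ?thesis using range_from_nat_into[OF False D] by simp
      qed
      then have "emeasure ?M (\<Union>\<D>) = (SUP n. emeasure ?M (A n))"
        using SUP_emeasure_incseq[OF sA iA] by simp
      also have "\<dots> \<le> ennreal \<epsilon>"
        by (rule SUP_least) (use fin fD in \<open>auto simp: A_def\<close>)
      finally have "emeasure ?M (\<Union>\<D>) \<le> ennreal \<epsilon>" .
      moreover have "\<Union>\<D> \<in> sets ?M"
        using sA \<open>\<Union>\<D> = (\<Union>n. A n)\<close> by auto
      ultimately show ?thesis
        using emeasure_mono[OF cov, of ?M] by auto
    qed
  qed
  then have "emeasure ?M (N \<inter> {a..b}) \<le> 0" by (rule ennreal_le_epsilon) auto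
  then show ?thesis by simp
qed

text \<open>By \<open>mono_ac_null\<close> the Stieltjes measure of \<open>H\<close> is absolutely
  continuous, so Radon-Nikodym yields an extended real density. Its integrals over bounded intervals
  are finite, hence it is finite almost everywhere and can be replaced by a real function.\<close>

lemma mono_ac_density:
  fixes H :: "real \<Rightarrow> real"
  assumes mono: "mono H" and cont: "continuous_on UNIV H"
    and ac: "\<And>\<epsilon>. \<epsilon> > 0 \<Longrightarrow> \<exists>\<delta>>0. \<forall>(I :: real set set) u v. finite I \<longrightarrow> (\<forall>i\<in>I. u i \<le> v i) \<longrightarrow>
      disjoint_family_on (\<lambda>i. {u i<..<v i}) I \<longrightarrow> (\<Sum>i\<in>I. v i - u i) < \<delta> \<longrightarrow> (\<Sum>i\<in>I. H (v i) - H (u i)) \<le> \<epsilon>"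
  obtains f where "\<And>x y. f absolutely_integrable_on {x..y}" "\<And>x y. x \<le> y \<Longrightarrow> integral {x..y} f = H y - H x"
proof -
  let ?M = "interval_measure H"
  have em: "emeasure ?M {x..y} = ennreal (H y - H x)" if "x \<le> y" for x y
    by (rule emeasure_interval_measure_Icc[OF that monoD[OF mono] cont])
  have "absolutely_continuous lborel ?M"
    unfolding absolutely_continuous_def
  proof
    fix N :: "real set" assume N: "N \<in> null_sets lborel"
    have "N \<inter> {- real (Suc n)..real (Suc n)} \<in> null_sets ?M" for n
      using mono_ac_null[OF mono cont ac N, of "- real (Suc n)" "real (Suc n)"] N
      by (auto simp: null_sets_def)
    then have "(\<Union>n. N \<inter> {- real (Suc n)..real (Suc n)}) \<in> null_sets ?M" by blast
    moreover have "(\<Union>n. N \<inter> {- real (Suc n)..real (Suc n)}) = N"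
    proof -
      have "\<exists>n. - real (Suc n) \<le> x \<and> x \<le> real (Suc n)" for x
      proof -
        obtain n :: nat where "\<bar>x\<bar> < real n" using reals_Archimedean2 by blast
        then show ?thesis by (intro exI[of _ n]) auto
      qed
      then show ?thesis by auto
    qed
    ultimately show "N \<in> null_sets ?M" by simp
  qed
  then obtain f where f[measurable]: "f \<in> borel_measurable lborel" and d: "density lborel f = ?M"
    using sigma_finite_measure.Radon_Nikodym[OF sigma_finite_lborel, of ?M] by auto
  have nn: "(\<integral>\<^sup>+t. f t * indicator {x..y} t \<partial>lborel) = ennreal (H y - H x)" if "x \<le> y" for x y
  proof -
    have "ennreal (H y - H x) = emeasure (density lborel f) {x..y}"
      unfolding d using em[OF that] by simp
    also have "\<dots> = (\<integral>\<^sup>+t. f t * indicator {x..y} t \<partial>lborel)"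
      by (rule emeasure_density) auto
    finally show ?thesis by simp
  qed
  define g where "g t = enn2real (f t)" for t
  have [measurable]: "g \<in> borel_measurable lborel" unfolding g_def by simp
  have "AE t in lborel. \<forall>n::nat. f t * indicator {- real n..real n} t \<noteq> \<infinity>"
    unfolding AE_all_countable
  proof
    fix n :: nat
    show "AE t in lborel. f t * indicator {- real n..real n} t \<noteq> \<infinity>"
      by (rule nn_integral_PInf_AE) (use nn[of "- real n" "real n"] in auto)
  qed
  then have fin: "AE t in lborel. f t = ennreal (g t)"
  proof eventually_elim
    case (elim t)
    obtain n :: nat where "\<bar>t\<bar> < real n" using reals_Archimedean2 by blast
    then have "f t \<noteq> \<infinity>" using elim[rule_format, of n] by (auto simp: indicator_def abs_le_iff abs_less_iff split: if_splits)
    then show ?case by (simp add: g_def less_top)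
  qed
  have nng: "(\<integral>\<^sup>+t. ennreal (indicator {x..y} t * g t) \<partial>lborel) = ennreal (H y - H x)" if "x \<le> y" for x y
  proof -
    have "(\<integral>\<^sup>+t. ennreal (indicator {x..y} t * g t) \<partial>lborel) = (\<integral>\<^sup>+t. f t * indicator {x..y} t \<partial>lborel)"
      by (rule nn_integral_cong_AE) (use fin in \<open>eventually_elim, auto simp: indicator_def\<close>)
    then show ?thesis using nn[OF that] by simp
  qed
  have g0: "0 \<le> g t" for t by (simp add: g_def)
  have int: "integrable lborel (\<lambda>t. indicator {x..y} t * g t)" for x y :: real
  proof (cases "x \<le> y")
    case True
    show ?thesis
      by (rule integrableI_nonneg) (use nng[OF True] g0 in auto)
  qed auto
  have "g absolutely_integrable_on {x..y}" for x y
    using int[of x y] unfolding set_integrable_def by (auto intro!: integrable_completion[THEN iffD2])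
  moreover have "integral {x..y} g = H y - H x" if "x \<le> y" for x y
  proof -
    have "integral {x..y} g = (LINT t:{x..y}|lebesgue. g t)"
      by (rule set_lebesgue_integral_eq_integral(2)[symmetric]) fact
    also have "\<dots> = integral\<^sup>L lborel (\<lambda>t. indicator {x..y} t * g t)"
      unfolding set_lebesgue_integral_def by (simp add: integral_completion)
    also have "\<dots> = H y - H x"
      by (subst integral_eq_nn_integral) (use nng[OF that] g0 monoD[OF mono that] in auto)
    finally show ?thesis .
  qed
  ultimately show ?thesis using that by blast
qed

text \<open>\<open>integrable_ccontinuous_explicit\<close> controls difference quotients to the
  right; those to the left come from the reflected function, at the cost of a reflected null
  set.\<close>

lemma lebesgue_differentiation:
  fixes f :: "real \<Rightarrow> real"
  assumes f: "\<And>x y. f integrable_on {x..y}"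
  obtains N where "negligible N"
    "\<And>x c. x \<notin> N \<Longrightarrow> c < x \<Longrightarrow> ((\<lambda>y. integral {c..y} f) has_real_derivative f x) (at x)"
proof -
  obtain N1 where N1: "negligible N1" and R: "\<And>x e. \<lbrakk>x \<notin> N1; 0 < e\<rbrakk> \<Longrightarrow>
      \<exists>d>0. \<forall>h. 0 < h \<and> h < d \<longrightarrow> \<bar>integral {x..x+h} f / h - f x\<bar> < e"
  proof (rule integrable_ccontinuous_explicit[of f])
    show "f integrable_on cbox a b" for a b using f by simp
  qed (auto simp: divide_inverse mult.commute)
  have refl: "(\<lambda>t. f (- t)) integrable_on {x..y}" for x y
    using f[of "-y" "-x"] Henstock_Kurzweil_Integration.integrable_reflect_real[where f=f and a="-y" and b="-x"] by simp
  obtain N2 where N2: "negligible N2" and L: "\<And>x e. \<lbrakk>x \<notin> N2; 0 < e\<rbrakk> \<Longrightarrow>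
      \<exists>d>0. \<forall>h. 0 < h \<and> h < d \<longrightarrow> \<bar>integral {x..x+h} (\<lambda>t. f (- t)) / h - f (- x)\<bar> < e"
  proof (rule integrable_ccontinuous_explicit[of "\<lambda>t. f (- t)"])
    show "(\<lambda>t. f (- t)) integrable_on cbox a b" for a b using refl by simp
  qed (auto simp: divide_inverse mult.commute)
  have N3: "negligible (uminus ` N2)"
    by (rule negligible_differentiable_image_negligible[OF order_refl N2]) (auto intro!: derivative_intros)
  show ?thesis
  proof (rule that[of "N1 \<union> uminus ` N2"])
    show "negligible (N1 \<union> uminus ` N2)" using N1 N3 by simp
    fix x c :: real assume x: "x \<notin> N1 \<union> uminus ` N2" and c: "c < x"
    have x2: "- x \<notin> N2" using x by force
    show "((\<lambda>y. integral {c..y} f) has_real_derivative f x) (at x)"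
      unfolding DERIV_def
    proof (rule LIM_I)
      fix r :: real assume r: "0 < r"
      obtain d1 where d1: "d1 > 0" "\<And>h. 0 < h \<Longrightarrow> h < d1 \<Longrightarrow> \<bar>integral {x..x+h} f / h - f x\<bar> < r"
        using R[OF _ r, of x] x by auto
      obtain d2 where d2: "d2 > 0" "\<And>h. 0 < h \<Longrightarrow> h < d2 \<Longrightarrow> \<bar>integral {-x..-x+h} (\<lambda>t. f (- t)) / h - f x\<bar> < r"
        using L[OF x2 r] by auto
      define s where "s = min (min d1 d2) (x - c)"
      have "norm ((integral {c..x + h} f - integral {c..x} f) / h - f x) < r" if h: "h \<noteq> 0" "norm (h - 0) < s" for h
      proof (cases "h > 0")
        case True
        have "integral {c..x} f + integral {x..x+h} f = integral {c..x+h} f"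
          by (rule Henstock_Kurzweil_Integration.integral_combine) (use c True f in auto)
        then have "integral {c..x + h} f - integral {c..x} f = integral {x..x+h} f" by linarith
        then show ?thesis using d1(2)[of h] True h by (simp add: s_def)
      next
        case False
        define k where "k = - h"
        have k: "0 < k" "k < d2" "k < x - c" using False h by (auto simp: k_def s_def)
        have "integral {c..x-k} f + integral {x-k..x} f = integral {c..x} f"
          by (rule Henstock_Kurzweil_Integration.integral_combine) (use c k f in auto)
        moreover have "integral {-x..-x+k} (\<lambda>t. f (- t)) = integral {x-k..x} f"
          using Henstock_Kurzweil_Integration.integral_reflect_real[where a="x - k" and b=x and f=f] by simp
        ultimately have *: "integral {c..x + h} f - integral {c..x} f = - integral {-x..-x+k} (\<lambda>t. f (- t))"
          by (simp add: k_def)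
        have "(integral {c..x + h} f - integral {c..x} f) / h = integral {-x..-x+k} (\<lambda>t. f (- t)) / k"
          unfolding * by (simp add: k_def)
        then show ?thesis using d2(2)[of k] k by simp
      qed
      then show "\<exists>s>0. \<forall>h. h \<noteq> 0 \<and> norm (h - 0) < s \<longrightarrow>
          norm ((integral {c..x + h} f - integral {c..x} f) / h - f x) < r"
        using d1 d2 c by (intro exI[of _ s]) (auto simp: s_def)
    qed
  qed
qed

text \<open>The function is half the difference of V + G and V - G, where \<open>G\<close> is its
  clamped extension. Both are increasing and absolutely continuous, so their densities can be
  subtracted.\<close>

theorem abs_cont_on_integral:
  assumes ac: "abs_cont_on a b F" and ab: "a < b"
  obtains f N where "f absolutely_integrable_on {a..b}"
    "\<And>x y. a \<le> x \<Longrightarrow> x \<le> y \<Longrightarrow> y \<le> b \<Longrightarrow> F y - F x = integral {x..y} f"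
    "negligible N" "\<And>x. a < x \<Longrightarrow> x < b \<Longrightarrow> x \<notin> N \<Longrightarrow> (F has_real_derivative f x) (at x)"
proof -
  define G where "G x = F (max a (min b x))" for x
  interpret ac_fun G a
  proof
    show "\<exists>\<delta>>0. ac_mod G \<epsilon> \<delta>" if "\<epsilon> > 0" for \<epsilon>
      using ac_mod_clamp[OF ac less_imp_le[OF ab] that] unfolding G_def by metis
    show "G x = G a" if "x \<le> a" for x using that ab by (simp add: G_def)
  qed
  \<comment> \<open>Domination by 2 (V y - V x) lets one argument serve both V + G and V -
    G.\<close>
  have dens: "\<exists>f. (\<forall>x y. f absolutely_integrable_on {x..y}) \<and> (\<forall>x y. x \<le> y \<longrightarrow> integral {x..y} f = H y - H x)"
    if H: "\<And>x y. x \<le> y \<Longrightarrow> 0 \<le> H y - H x \<and> H y - H x \<le> 2 * (V y - V x)" for H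
  proof -
    have acH: "\<exists>\<delta>>0. \<forall>(I :: real set set) u v. finite I \<longrightarrow> (\<forall>i\<in>I. u i \<le> v i) \<longrightarrow>
      disjoint_family_on (\<lambda>i. {u i<..<v i}) I \<longrightarrow> (\<Sum>i\<in>I. v i - u i) < \<delta> \<longrightarrow> (\<Sum>i\<in>I. H (v i) - H (u i)) \<le> \<epsilon>"
      if \<epsilon>: "\<epsilon> > 0" for \<epsilon>
    proof -
      obtain \<delta> where \<delta>: "\<delta> > 0" "ac_mod G (\<epsilon>/2) \<delta>" using ac[of "\<epsilon>/2"] \<epsilon> by auto
      have "(\<Sum>i\<in>I. H (v i) - H (u i)) \<le> \<epsilon>" if "finite I" "\<forall>i\<in>I. u i \<le> v i"
        "disjoint_family_on (\<lambda>i. {u i<..<v i}) I" "(\<Sum>i\<in>I. v i - u i) < \<delta>" for I :: "real set set" and u v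
      proof -
        have "(\<Sum>i\<in>I. H (v i) - H (u i)) \<le> (\<Sum>i\<in>I. 2 * (V (v i) - V (u i)))"
          by (rule sum_mono) (use H that in auto)
        also have "\<dots> = 2 * (\<Sum>i\<in>I. V (v i) - V (u i))" by (rule sum_distrib_left[symmetric])
        also have "(\<Sum>i\<in>I. V (v i) - V (u i)) \<le> \<epsilon> / 2"
          by (rule V_ac[OF \<delta>(2) that(1) _ that(3,4)]) (use that(2) in auto)
        finally show ?thesis by simp
      qed
      then show ?thesis using \<delta>(1) by blast
    qed
    have mono: "mono H" by (rule monoI) (use H in force)
    have "continuous_on UNIV H"
      unfolding continuous_on_iff
    proof (intro ballI allI impI)
      fix x e :: real assume e: "e > 0"
      obtain \<delta> where \<delta>: "\<delta> > 0" and D: "\<And>(I :: real set set) u v. finite I \<Longrightarrow> (\<forall>i\<in>I. u i \<le> v i) \<Longrightarrow>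
        disjoint_family_on (\<lambda>i. {u i<..<v i}) I \<Longrightarrow> (\<Sum>i\<in>I. v i - u i) < \<delta> \<Longrightarrow> (\<Sum>i\<in>I. H (v i) - H (u i)) \<le> e/2"
        using acH[OF half_gt_zero[OF e]] by blast
      \<comment> \<open>A single interval, indexed by the one-element family \<open>{{}}\<close>,
        gives uniform continuity.\<close>
      have *: "H v - H u \<le> e/2" if "u \<le> v" "v - u < \<delta>" for u v
        using D[of "{{}}" "\<lambda>_. u" "\<lambda>_. v"] that by (simp add: disjoint_family_on_def)
      have "\<bar>H y - H x\<bar> < e" if "\<bar>y - x\<bar> < \<delta>" for y
      proof (cases "x \<le> y")
        case True
        then show ?thesis using *[of x y] H[of x y] that e by auto
      next
        case False
        then show ?thesis using *[of y x] H[of y x] that e by auto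
      qed
      then show "\<exists>d>0. \<forall>x'\<in>UNIV. dist x' x < d \<longrightarrow> dist (H x') (H x) < e"
        using \<delta> by (auto simp: dist_real_def)
    qed
    then show ?thesis using mono_ac_density[OF mono _ acH] by metis
  qed
  have "0 \<le> (V y + G y) - (V x + G x) \<and> (V y + G y) - (V x + G x) \<le> 2 * (V y - V x)"
    "0 \<le> (V y - G y) - (V x - G x) \<and> (V y - G y) - (V x - G x) \<le> 2 * (V y - V x)" if "x \<le> y" for x y
    using V_super[OF that] by auto
  then obtain f1 f2 where f1: "\<And>x y. f1 absolutely_integrable_on {x..y}"
      "\<And>x y. x \<le> y \<Longrightarrow> integral {x..y} f1 = (V y + G y) - (V x + G x)"
    and f2: "\<And>x y. f2 absolutely_integrable_on {x..y}"
      "\<And>x y. x \<le> y \<Longrightarrow> integral {x..y} f2 = (V y - G y) - (V x - G x)"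
    using dens[of "\<lambda>x. V x + G x"] dens[of "\<lambda>x. V x - G x"] by metis
  define f where "f t = (f1 t - f2 t) / 2" for t
  have fa: "f absolutely_integrable_on {x..y}" for x y
    unfolding f_def using f1(1)[of x y] f2(1)[of x y] by (auto intro!: set_integral_diff(1))
  have fi: "f integrable_on {x..y}" for x y
    using fa by (rule set_lebesgue_integral_eq_integral(1))
  have i12: "f1 integrable_on {x..y}" "f2 integrable_on {x..y}" for x y
    using f1(1) f2(1) by (auto intro: set_lebesgue_integral_eq_integral(1))
  have ig: "integral {x..y} f = G y - G x" if "x \<le> y" for x y
    unfolding f_def using f1(2)[OF that] f2(2)[OF that] i12[of x y]
    by (simp add: integral_diff)
  obtain N where N: "negligible N"
    "\<And>x c. x \<notin> N \<Longrightarrow> c < x \<Longrightarrow> ((\<lambda>y. integral {c..y} f) has_real_derivative f x) (at x)"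
    using lebesgue_differentiation[of f] fi by metis
  show ?thesis
  proof (rule that[of f N])
    show "f absolutely_integrable_on {a..b}" by (rule fa)
    show "F y - F x = integral {x..y} f" if "a \<le> x" "x \<le> y" "y \<le> b" for x y
      using ig[OF that(2)] that by (simp add: G_def)
    show "negligible N" by fact
    fix x assume x: "a < x" "x < b" "x \<notin> N"
    have "((\<lambda>y. G a + integral {a..y} f) has_real_derivative f x) (at x)"
      using N(2)[OF x(3,1)] by (auto intro!: derivative_eq_intros)
    then show "(F has_real_derivative f x) (at x)"
    proof (rule has_field_derivative_transform_within_open[of _ _ _ "{a<..<b}"])
      fix y assume "y \<in> {a<..<b}"
      then show "G a + integral {a..y} f = F y"
        using ig[of a y] by (simp add: G_def)
    qed (use x in auto)
  qed
qed

section \<open>Completeness of \<open>L\<^sup>2(0,1)\<close>\<close>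

lemma finite_measure_unit_leb: "finite_measure unit_leb"
  by (rule finite_measureI) (simp add: emeasure_restrict_space)

interpretation unit_leb: finite_measure unit_leb
  by (rule finite_measure_unit_leb)

lemma measure_unit_leb: "measure unit_leb (space unit_leb) = 1"
  by (simp add: measure_restrict_space)

lemma square_int_rep: "square_int (rep_L2 u)"
  using Quotient_rep_reflp[OF Quotient_L2, of u] by (simp add: eq_L2_def)

lemma abs_rep_L2 [simp]: "abs_L2 (rep_L2 u) = u"
  using Quotient_abs_rep[OF Quotient_L2] .

lemma rep_abs_L2: "square_int f \<Longrightarrow> AE x in unit_leb. rep_L2 (abs_L2 f) x = f x"
  using Quotient_rep_abs[OF Quotient_L2, of f] by (auto simp: eq_L2_def)

lemma abs_L2_eqI: "square_int f \<Longrightarrow> square_int g \<Longrightarrow> AE x in unit_leb. f x = g x \<Longrightarrow> abs_L2 f = abs_L2 g"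
  using Quotient_rel_abs[OF Quotient_L2, of f g] by (auto simp: eq_L2_def)

lemma abs_L2_eq_iff:
  "square_int f \<Longrightarrow> square_int g \<Longrightarrow> abs_L2 f = abs_L2 g \<longleftrightarrow> (AE x in unit_leb. f x = g x)"
  using Quotient_rel[OF Quotient_L2, of f g] by (auto simp: eq_L2_def)

lemma abs_L2_add: "square_int f \<Longrightarrow> square_int g \<Longrightarrow> abs_L2 f + abs_L2 g = abs_L2 (\<lambda>x. f x + g x)"
  by (simp add: plus_L2.abs_eq eq_L2_def)

lemma abs_L2_diff: "square_int f \<Longrightarrow> square_int g \<Longrightarrow> abs_L2 f - abs_L2 g = abs_L2 (\<lambda>x. f x - g x)"
  by (simp add: minus_L2.abs_eq eq_L2_def)

lemma abs_L2_scaleR: "square_int f \<Longrightarrow> c *\<^sub>R abs_L2 f = abs_L2 (\<lambda>x. c * f x)"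
  by (simp add: scaleR_L2.abs_eq eq_L2_def)

lemma inner_abs_L2: "square_int f \<Longrightarrow> square_int g \<Longrightarrow> abs_L2 f \<bullet> abs_L2 g = (\<integral>x. f x * g x \<partial>unit_leb)"
  by (simp add: inner_L2.abs_eq eq_L2_def)

lemma norm_abs_L2_sq: "square_int f \<Longrightarrow> (norm (abs_L2 f))\<^sup>2 = (\<integral>x. (f x)\<^sup>2 \<partial>unit_leb)"
  by (simp add: power2_norm_eq_inner inner_abs_L2 flip: power2_eq_square)

lemma rep_L2_add: "AE x in unit_leb. rep_L2 (u + v) x = rep_L2 u x + rep_L2 v x"
  using rep_abs_L2[OF square_int_add[OF square_int_rep square_int_rep], of u v]
    abs_L2_add[OF square_int_rep square_int_rep, of u v] by simp

lemma rep_L2_scaleR: "AE x in unit_leb. rep_L2 (c *\<^sub>R u) x = c * rep_L2 u x"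
  using rep_abs_L2[OF square_int_scale[OF square_int_rep], of c u]
    abs_L2_scaleR[OF square_int_rep, of c u] by simp

lemma square_int_integrable: "square_int f \<Longrightarrow> integrable unit_leb f"
  using square_int_prod[of f "\<lambda>x. 1"] by (simp add: square_int_def)

text \<open>Young's inequality with weight \<open>e\<close> on a space of total mass 1. It turns a
  Cauchy sequence in L2 into one in L1, which has a subsequence converging almost
  everywhere.\<close>

lemma integral_abs_less:
  assumes "square_int f" "0 < e" "(\<integral>x. (f x)\<^sup>2 \<partial>unit_leb) < e\<^sup>2"
  shows "(\<integral>x. \<bar>f x\<bar> \<partial>unit_leb) < e"
proof -
  have "\<bar>f x\<bar> \<le> e / 2 + (f x)\<^sup>2 / (2 * e)" for x
  proof -
    have "2 * (e * \<bar>f x\<bar>) \<le> e\<^sup>2 + \<bar>f x\<bar>\<^sup>2"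
      using sum_squares_bound[of e "\<bar>f x\<bar>"] by (simp add: mult.assoc)
    then show ?thesis using assms(2) by (simp add: field_simps power2_eq_square)
  qed
  then have "(\<integral>x. \<bar>f x\<bar> \<partial>unit_leb) \<le> (\<integral>x. e / 2 + (f x)\<^sup>2 / (2 * e) \<partial>unit_leb)"
    using assms(1) square_int_integrable[OF assms(1)]
    by (intro integral_mono) (auto simp: square_int_def)
  also have "\<dots> = e / 2 + (\<integral>x. (f x)\<^sup>2 \<partial>unit_leb) / (2 * e)"
    using assms(1) measure_unit_leb by (simp add: square_int_def)
  also have "\<dots> < e / 2 + e\<^sup>2 / (2 * e)"
    using assms(2,3) by (intro add_strict_left_mono divide_strict_right_mono) auto
  also have "\<dots> = e" using assms(2) by (simp add: power2_eq_square)
  finally show ?thesis .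
qed

text \<open>Riesz-Fischer: a subsequence converges almost everywhere to \<open>g\<close>, and
  Fatou's lemma along it bounds the mean square distance of late terms to \<open>g\<close>.\<close>

instance L2 :: complete_space
proof
  fix X :: "nat \<Rightarrow> L2" assume X: "Cauchy X"
  define f where "f n = rep_L2 (X n)" for n
  have f: "square_int (f n)" for n by (simp add: f_def square_int_rep)
  have Xf: "X n = abs_L2 (f n)" for n by (simp add: f_def)
  have meas [measurable]: "f n \<in> borel_measurable unit_leb" for n using f by (auto simp: square_int_def)
  have dist: "(dist (X i) (X j))\<^sup>2 = (\<integral>x. (f i x - f j x)\<^sup>2 \<partial>unit_leb)" for i j
    by (simp add: dist_norm Xf abs_L2_diff[OF f f] norm_abs_L2_sq[OF square_int_diff[OF f f]])
  obtain r where r: "strict_mono r" and cau: "AE x in unit_leb. Cauchy (\<lambda>i. f (r i) x)"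
  proof (rule cauchy_L1_AE_cauchy_subseq[of unit_leb f])
    show "integrable unit_leb (f n)" for n using f square_int_integrable by blast
    fix e :: real assume e: "e > 0"
    obtain N where N: "\<And>i j. i \<ge> N \<Longrightarrow> j \<ge> N \<Longrightarrow> dist (X i) (X j) < e"
      using X e unfolding Cauchy_def by blast
    have "(\<integral>x. norm (f i x - f j x) \<partial>unit_leb) < e" if "i \<ge> N" "j \<ge> N" for i j
    proof -
      have "(\<integral>x. (f i x - f j x)\<^sup>2 \<partial>unit_leb) < e\<^sup>2"
        unfolding dist[symmetric] using N[OF that] e by (intro power_strict_mono) auto
      then show ?thesis
        using integral_abs_less[OF square_int_diff[OF f f] e] by simp
    qed
    then show "\<exists>N. \<forall>i\<ge>N. \<forall>j\<ge>N. (\<integral>x. norm (f i x - f j x) \<partial>unit_leb) < e" by blast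
  qed
  define g where "g x = lim (\<lambda>i. f (r i) x)" for x
  have [measurable]: "g \<in> borel_measurable unit_leb"
    unfolding g_def by (rule borel_measurable_lim_metric) measurable
  have lim: "AE x in unit_leb. (\<lambda>i. f (r i) x) \<longlonglongrightarrow> g x"
    using cau by eventually_elim (auto simp: g_def Cauchy_convergent_iff convergent_LIMSEQ_iff)
  have key: "(\<integral>\<^sup>+x. ennreal ((f i x - g x)\<^sup>2) \<partial>unit_leb) \<le> ennreal (e\<^sup>2)"
    if N: "\<And>i j. i \<ge> N \<Longrightarrow> j \<ge> N \<Longrightarrow> dist (X i) (X j) < e" and i: "i \<ge> N" and e: "e > 0" for N i e
  proof -
    have "(\<integral>\<^sup>+x. ennreal ((f i x - g x)\<^sup>2) \<partial>unit_leb)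
        = (\<integral>\<^sup>+x. liminf (\<lambda>j. ennreal ((f i x - f (r j) x)\<^sup>2)) \<partial>unit_leb)"
    proof (rule nn_integral_cong_AE, use lim in eventually_elim)
      case (elim x)
      then have "(\<lambda>j. ennreal ((f i x - f (r j) x)\<^sup>2)) \<longlonglongrightarrow> ennreal ((f i x - g x)\<^sup>2)"
        by (intro tendsto_intros)
      then show ?case by (rule lim_imp_Liminf[OF sequentially_bot, symmetric])
    qed
    also have "\<dots> \<le> liminf (\<lambda>j. \<integral>\<^sup>+x. ennreal ((f i x - f (r j) x)\<^sup>2) \<partial>unit_leb)"
      by (rule nn_integral_liminf) measurable
    also have "\<dots> \<le> ennreal (e\<^sup>2)"
    proof (rule Liminf_le)
      show "\<forall>\<^sub>F j in sequentially. (\<integral>\<^sup>+x. ennreal ((f i x - f (r j) x)\<^sup>2) \<partial>unit_leb) \<le> ennreal (e\<^sup>2)"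
      proof (rule eventually_sequentiallyI[of N])
        fix j assume "N \<le> j"
        then have "N \<le> r j" using seq_suble[OF r, of j] by simp
        then have "dist (X i) (X (r j)) < e" using N i by blast
        then have le: "(dist (X i) (X (r j)))\<^sup>2 \<le> e\<^sup>2" by (intro power_mono) auto
        have "(\<integral>\<^sup>+x. ennreal ((f i x - f (r j) x)\<^sup>2) \<partial>unit_leb) = ennreal ((dist (X i) (X (r j)))\<^sup>2)"
          unfolding dist using square_int_diff[OF f f, of i "r j"]
          by (intro nn_integral_eq_integral) (auto simp: square_int_def)
        then show "(\<integral>\<^sup>+x. ennreal ((f i x - f (r j) x)\<^sup>2) \<partial>unit_leb) \<le> ennreal (e\<^sup>2)"
          using le by (simp add: ennreal_leI)
      qed
    qed simp
    finally show ?thesis .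
  qed
  have sd: "square_int (\<lambda>x. f i x - g x)" if "\<And>i j. i \<ge> N \<Longrightarrow> j \<ge> N \<Longrightarrow> dist (X i) (X j) < e" "i \<ge> N" "e > 0" for N i e
    unfolding square_int_def
  proof (intro conjI)
    show "integrable unit_leb (\<lambda>x. (f i x - g x)\<^sup>2)"
      by (rule integrableI_bounded) (use le_less_trans[OF key[OF that]] in auto)
  qed measurable
  obtain N1 where N1: "\<And>i j. i \<ge> N1 \<Longrightarrow> j \<ge> N1 \<Longrightarrow> dist (X i) (X j) < 1"
    using X unfolding Cauchy_def by (meson zero_less_one)
  have "square_int (\<lambda>x. f N1 x - (f N1 x - g x))"
    by (rule square_int_diff[OF f sd[OF N1]]) auto
  then have g: "square_int g" by simp
  have "X \<longlonglongrightarrow> abs_L2 g"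
    unfolding lim_sequentially
  proof (intro allI impI)
    fix e :: real assume e: "0 < e"
    obtain N where N: "\<And>i j. i \<ge> N \<Longrightarrow> j \<ge> N \<Longrightarrow> dist (X i) (X j) < e / 2"
      using X half_gt_zero[OF e] unfolding Cauchy_def by blast
    have "dist (X i) (abs_L2 g) < e" if "i \<ge> N" for i
    proof -
      have "(\<integral>x. (f i x - g x)\<^sup>2 \<partial>unit_leb) \<le> (e/2)\<^sup>2"
      proof -
        have i: "integrable unit_leb (\<lambda>x. (f i x - g x)\<^sup>2)"
          using sd[of N "e/2" i] N that e by (auto simp: square_int_def)
        have nn: "(\<integral>\<^sup>+x. ennreal ((f i x - g x)\<^sup>2) \<partial>unit_leb) = ennreal (\<integral>x. (f i x - g x)\<^sup>2 \<partial>unit_leb)"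
          by (rule nn_integral_eq_integral[OF i]) simp
        have "(\<integral>\<^sup>+x. ennreal ((f i x - g x)\<^sup>2) \<partial>unit_leb) \<le> ennreal ((e/2)\<^sup>2)"
          by (rule key[of N]) (use N that e in auto)
        then have "ennreal (\<integral>x. (f i x - g x)\<^sup>2 \<partial>unit_leb) \<le> ennreal ((e/2)\<^sup>2)"
          unfolding nn .
        then show ?thesis by (subst (asm) ennreal_le_iff) auto
      qed
      moreover have "(dist (X i) (abs_L2 g))\<^sup>2 = (\<integral>x. (f i x - g x)\<^sup>2 \<partial>unit_leb)"
        by (simp add: dist_norm Xf abs_L2_diff[OF f g] norm_abs_L2_sq[OF square_int_diff[OF f g]])
      ultimately have "(dist (X i) (abs_L2 g))\<^sup>2 \<le> (e / 2)\<^sup>2" by simp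
      then have "dist (X i) (abs_L2 g) \<le> e / 2"
        by (rule power2_le_imp_le) (use e in simp)
      then show ?thesis using e by simp
    qed
    then show "\<exists>N. \<forall>n\<ge>N. dist (X n) (abs_L2 g) < e" by blast
  qed
  then show "convergent X" by (auto simp: convergent_def)
qed

lemma square_int_indicator_mult:
  assumes "A \<in> sets lebesgue" "square_int f"
  shows "square_int (\<lambda>x. indicator A x * f x)"
proof -
  have [measurable]: "f \<in> borel_measurable unit_leb" using assms by (auto simp: square_int_def)
  have [measurable]: "(\<lambda>x. indicator A x :: real) \<in> borel_measurable unit_leb"
    using assms(1) by (intro measurable_restrict_space1 borel_measurable_indicator)
  have "integrable unit_leb (\<lambda>x. (indicator A x * f x)\<^sup>2)"
    by (rule Bochner_Integration.integrable_bound[of _ "\<lambda>x. (f x)\<^sup>2"])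
      (use assms in \<open>simp_all add: square_int_def, auto simp: indicator_def\<close>)
  then show ?thesis unfolding square_int_def by auto
qed

lemma
  assumes "A \<in> sets lebesgue"
  shows bounded_linear_cutoff: "bounded_linear (cutoff A)"
    and norm_cutoff_sq: "(norm (cutoff A u))\<^sup>2 = cutoff A u \<bullet> u"
    and norm_cutoff_le: "norm (cutoff A u) \<le> norm u"
    and norm_cutoff_eq: "(norm (cutoff A u))\<^sup>2 = (\<integral>x. indicator A x * (rep_L2 u x)\<^sup>2 \<partial>unit_leb)"
proof -
  note s = square_int_indicator_mult[OF assms]
  have add: "cutoff A (u + v) = cutoff A u + cutoff A v" for u v
    unfolding cutoff_def abs_L2_add[OF s[OF square_int_rep] s[OF square_int_rep]]
    by (rule abs_L2_eqI[OF s[OF square_int_rep] square_int_add[OF s[OF square_int_rep] s[OF square_int_rep]]])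
      (use rep_L2_add[of u v] in \<open>eventually_elim, simp add: algebra_simps\<close>)
  have sc: "cutoff A (c *\<^sub>R u) = c *\<^sub>R cutoff A u" for c u
    unfolding cutoff_def abs_L2_scaleR[OF s[OF square_int_rep]]
    by (rule abs_L2_eqI[OF s[OF square_int_rep] square_int_scale[OF s[OF square_int_rep]]])
      (use rep_L2_scaleR[of c u] in \<open>eventually_elim, simp add: algebra_simps\<close>)
  have eq: "(norm (cutoff A u))\<^sup>2 = (\<integral>x. indicator A x * (rep_L2 u x)\<^sup>2 \<partial>unit_leb)" for u
    unfolding cutoff_def norm_abs_L2_sq[OF s[OF square_int_rep]]
    by (rule Bochner_Integration.integral_cong) (auto simp: indicator_def)
  have sq: "(norm (cutoff A u))\<^sup>2 = cutoff A u \<bullet> u" for u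
  proof -
    have "cutoff A u \<bullet> abs_L2 (rep_L2 u) = (\<integral>x. indicator A x * (rep_L2 u x)\<^sup>2 \<partial>unit_leb)"
      unfolding cutoff_def inner_abs_L2[OF s[OF square_int_rep] square_int_rep]
      by (simp add: power2_eq_square mult.assoc)
    then show ?thesis unfolding eq by simp
  qed
  have le: "norm (cutoff A u) \<le> norm u" for u
  proof -
    have "norm (cutoff A u) * norm (cutoff A u) \<le> norm (cutoff A u) * norm u"
      using sq[of u] norm_cauchy_schwarz[of "cutoff A u" u] by (simp add: power2_eq_square)
    then show ?thesis
      using mult_left_le_imp_le[of "norm (cutoff A u)" "norm (cutoff A u)" "norm u"]
      by (cases "norm (cutoff A u) = 0") auto
  qed
  show "bounded_linear (cutoff A)"
    by (rule bounded_linear_intro[of _ 1]) (use add sc le in auto)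
  show "(norm (cutoff A u))\<^sup>2 = cutoff A u \<bullet> u" by (rule sq)
  show "norm (cutoff A u) \<le> norm u" by (rule le)
  show "(norm (cutoff A u))\<^sup>2 = (\<integral>x. indicator A x * (rep_L2 u x)\<^sup>2 \<partial>unit_leb)" by (rule eq)
qed

section \<open>Eigenbases of compact symmetric operators\<close>

text \<open>\<open>s\<close> is the norm of \<open>K\<close> on \<open>M\<close>. Vectors nearly
  attaining it are nearly eigenvectors of K^2 for s^2, compactness produces an exact one
  \<open>x\<close>, and (K - s) (K + s) x = 0 makes K x + s x an eigenvector of \<open>K\<close>
  unless it vanishes, which positivity forbids.\<close>

lemma symmetric_compact_eigenvector:
  fixes K :: "'a::real_inner \<Rightarrow> 'a"
  assumes bl: "bounded_linear K"
    and sym: "\<And>u v. K u \<bullet> v = u \<bullet> K v"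
    and pos: "\<And>u. 0 \<le> K u \<bullet> u"
    and inj: "\<And>u. K u = 0 \<Longrightarrow> u = 0"
    and comp: "\<And>u. (\<And>n. norm (u n) \<le> 1) \<Longrightarrow> \<exists>r l. strict_mono (r :: nat \<Rightarrow> nat) \<and> (\<lambda>n. K (u (r n))) \<longlonglongrightarrow> l"
    and M: "subspace M" "closed M" "\<And>u. u \<in> M \<Longrightarrow> K u \<in> M"
    and v: "v \<in> M" "v \<noteq> 0"
  obtains w s where "w \<in> M" "norm w = 1" "s > 0" "K w = s *\<^sub>R w"
proof -
  interpret K: bounded_linear K by (rule bl)
  define S where "S = {norm (K u) |u. u \<in> M \<and> norm u = 1}"
  obtain C where C: "\<And>u. norm (K u) \<le> norm u * C" using K.bounded by blast
  have bdd: "bdd_above S"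
  proof (rule bdd_aboveI[of _ C])
    fix y assume "y \<in> S"
    then obtain u where "y = norm (K u)" "norm u = 1" unfolding S_def by blast
    then show "y \<le> C" using C[of u] by simp
  qed
  have un: "(1 / norm v) *\<^sub>R v \<in> M" "norm ((1 / norm v) *\<^sub>R v) = 1"
    using v M(1) by (auto simp: subspace_scale)
  then have inS: "norm (K ((1 / norm v) *\<^sub>R v)) \<in> S" unfolding S_def by blast
  define s where "s = Sup S"
  have "0 < norm (K ((1 / norm v) *\<^sub>R v))" using inj[of "(1 / norm v) *\<^sub>R v"] un(2) v(2) by auto
  also have "\<dots> \<le> s" unfolding s_def by (rule cSup_upper[OF inS bdd])
  finally have s: "s > 0" .
  have le: "norm (K u) \<le> s * norm u" if "u \<in> M" for u
  proof (cases "u = 0")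
    case False
    then have "norm (K ((1 / norm u) *\<^sub>R u)) \<in> S"
      unfolding S_def using that M(1) by (auto simp: subspace_scale intro!: exI[of _ "(1 / norm u) *\<^sub>R u"])
    then have "norm (K ((1 / norm u) *\<^sub>R u)) \<le> s" unfolding s_def by (rule cSup_upper[OF _ bdd])
    then show ?thesis using False by (simp add: K.scaleR field_simps)
  qed (simp add: K.zero)
  have "\<exists>u. u \<in> M \<and> norm u = 1 \<and> s - 1 / real (Suc n) < norm (K u)" for n
  proof -
    have "s - 1 / real (Suc n) < Sup S" by (simp add: s_def)
    then obtain y where "y \<in> S" "s - 1 / real (Suc n) < y"
      using less_cSup_iff[of S] inS bdd by blast
    then show ?thesis by (auto simp: S_def)
  qed
  then obtain u where u: "\<And>n. u n \<in> M" "\<And>n. norm (u n) = 1" "\<And>n. s - 1 / real (Suc n) < norm (K (u n))"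
    by metis
  have up: "norm (K (u n)) \<le> s" for n using le[OF u(1), of n] u(2) by simp
  have lims: "(\<lambda>n. norm (K (u n))) \<longlonglongrightarrow> s"
  proof (rule tendsto_sandwich[where h = "\<lambda>_. s"])
    show "(\<lambda>n. s - 1 / real (Suc n)) \<longlonglongrightarrow> s"
      using tendsto_diff[OF tendsto_const[of s] LIMSEQ_inverse_real_of_nat] by (simp add: inverse_eq_divide)
  qed (use u(3) up in \<open>auto intro!: always_eventually less_imp_le\<close>)
  \<comment> \<open>Expanding the square and using symmetry leaves |K K u|^2 - 2 s^2 |K u|^2 + s^4,
    and |K K u| \<le> s |K u|.\<close>
  have sq: "(norm (K (K (u n)) - s\<^sup>2 *\<^sub>R u n))\<^sup>2 \<le> s\<^sup>2 * (s\<^sup>2 - (norm (K (u n)))\<^sup>2)" for n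
  proof -
    have "norm (K (K (u n))) \<le> s * norm (K (u n))" using le[OF M(3)[OF u(1)]] .
    then have "(norm (K (K (u n))))\<^sup>2 \<le> s\<^sup>2 * (norm (K (u n)))\<^sup>2"
      by (metis norm_ge_zero power_mono power_mult_distrib)
    moreover have "(norm (K (K (u n)) - s\<^sup>2 *\<^sub>R u n))\<^sup>2
        = (norm (K (K (u n))))\<^sup>2 - 2 * s\<^sup>2 * (norm (K (u n)))\<^sup>2 + s\<^sup>2 * s\<^sup>2"
    proof -
      have "K (K (u n)) \<bullet> u n = (norm (K (u n)))\<^sup>2"
        by (simp add: sym power2_norm_eq_inner)
      moreover have "u n \<bullet> u n = 1" using u(2)[of n] by (simp add: norm_eq_1)
      ultimately show ?thesis
        by (simp add: power2_norm_eq_inner inner_diff_left inner_diff_right inner_commute algebra_simps)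
    qed
    ultimately show ?thesis by (simp add: algebra_simps)
  qed
  have "(\<lambda>n. (norm (K (K (u n)) - s\<^sup>2 *\<^sub>R u n))\<^sup>2) \<longlonglongrightarrow> 0"
  proof (rule tendsto_sandwich[where f = "\<lambda>_. 0" and h = "\<lambda>n. s\<^sup>2 * (s\<^sup>2 - (norm (K (u n)))\<^sup>2)"])
    have "(\<lambda>n. s\<^sup>2 * (s\<^sup>2 - (norm (K (u n)))\<^sup>2)) \<longlonglongrightarrow> s\<^sup>2 * (s\<^sup>2 - s\<^sup>2)"
      by (intro tendsto_intros lims)
    then show "(\<lambda>n. s\<^sup>2 * (s\<^sup>2 - (norm (K (u n)))\<^sup>2)) \<longlonglongrightarrow> 0" by simp
  qed (use sq in \<open>auto intro!: always_eventually\<close>)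
  from tendsto_real_sqrt[OF this]
  have d0: "(\<lambda>n. K (K (u n)) - s\<^sup>2 *\<^sub>R u n) \<longlonglongrightarrow> 0"
    by (simp add: tendsto_norm_zero_iff)
  obtain r l where r: "strict_mono r" and l: "(\<lambda>n. K (u (r n))) \<longlonglongrightarrow> l"
    using comp[of u] u(2) by auto
  have "(\<lambda>n. K (K (u (r n))) - (K (K (u (r n))) - s\<^sup>2 *\<^sub>R u (r n))) \<longlonglongrightarrow> K l - 0"
    using LIMSEQ_subseq_LIMSEQ[OF d0 r] by (intro tendsto_diff K.tendsto l) (simp add: comp_def)
  then have "(\<lambda>n. (1 / s\<^sup>2) *\<^sub>R (s\<^sup>2 *\<^sub>R u (r n))) \<longlonglongrightarrow> (1 / s\<^sup>2) *\<^sub>R K l"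
    by (intro tendsto_intros) simp
  then have lim: "(\<lambda>n. u (r n)) \<longlonglongrightarrow> (1 / s\<^sup>2) *\<^sub>R K l" using s by simp
  define x where "x = (1 / s\<^sup>2) *\<^sub>R K l"
  have xM: "x \<in> M" using closed_sequentially[OF M(2), of "\<lambda>n. u (r n)"] u(1) lim by (simp add: x_def)
  have nx: "norm x = 1"
  proof -
    have "(\<lambda>n. norm (u (r n))) \<longlonglongrightarrow> norm x" unfolding x_def by (rule tendsto_norm[OF lim])
    then show ?thesis using u(2) by (simp only: LIMSEQ_const_iff)
  qed
  have "(\<lambda>n. K (K (u (r n))) - s\<^sup>2 *\<^sub>R u (r n)) \<longlonglongrightarrow> K (K x) - s\<^sup>2 *\<^sub>R x"
    unfolding x_def by (intro tendsto_intros K.tendsto lim)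
  moreover have "(\<lambda>n. K (K (u (r n))) - s\<^sup>2 *\<^sub>R u (r n)) \<longlonglongrightarrow> 0"
    using LIMSEQ_subseq_LIMSEQ[OF d0 r] by (simp add: comp_def)
  ultimately have KK: "K (K x) = s\<^sup>2 *\<^sub>R x" using LIMSEQ_unique by fastforce
  define w where "w = K x + s *\<^sub>R x"
  have Kw: "K w = s *\<^sub>R w"
    by (simp add: w_def K.add K.scaleR KK power2_eq_square algebra_simps)
  have w0: "w \<noteq> 0"
  proof
    assume "w = 0"
    then have "K x = - (s *\<^sub>R x)" by (simp add: w_def eq_neg_iff_add_eq_0)
    then have "K x \<bullet> x = - s" using nx by (simp add: norm_eq_1)
    then show False using pos[of x] s by simp
  qed
  have wM: "w \<in> M" unfolding w_def by (intro subspace_add[OF M(1)] subspace_scale[OF M(1)] M(3) xM)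
  show ?thesis
    by (rule that[of "(1 / norm w) *\<^sub>R w" s]) (use w0 wM Kw s M(1) in \<open>auto simp: subspace_scale K.scaleR\<close>)
qed

text \<open>Zorn's lemma provides a maximal orthonormal set of eigenvectors. Its orthogonal
  complement is closed and invariant under \<open>K\<close>, so a nonzero vector in it would lead to
  a further eigenvector.\<close>

lemma compact_symmetric_eigenbasis:
  fixes K :: "'a::real_inner \<Rightarrow> 'a"
  assumes bl: "bounded_linear K"
    and sym: "\<And>u v. K u \<bullet> v = u \<bullet> K v"
    and pos: "\<And>u. 0 \<le> K u \<bullet> u"
    and inj: "\<And>u. K u = 0 \<Longrightarrow> u = 0"
    and comp: "\<And>u. (\<And>n. norm (u n) \<le> 1) \<Longrightarrow> \<exists>r l. strict_mono (r :: nat \<Rightarrow> nat) \<and> (\<lambda>n. K (u (r n))) \<longlonglongrightarrow> l"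
  obtains B where "\<And>b. b \<in> B \<Longrightarrow> norm b = 1" "\<And>b c. b \<in> B \<Longrightarrow> c \<in> B \<Longrightarrow> b \<noteq> c \<Longrightarrow> b \<bullet> c = 0"
    "\<And>b. b \<in> B \<Longrightarrow> \<exists>s>0. K b = s *\<^sub>R b" "\<And>u. (\<And>b. b \<in> B \<Longrightarrow> u \<bullet> b = 0) \<Longrightarrow> u = 0"
proof -
  define A where "A = {B. (\<forall>b\<in>B. norm b = 1 \<and> (\<exists>s>0. K b = s *\<^sub>R b)) \<and> (\<forall>b\<in>B. \<forall>c\<in>B. b \<noteq> c \<longrightarrow> b \<bullet> c = 0)}"
  have "\<exists>M\<in>A. \<forall>X\<in>A. M \<subseteq> X \<longrightarrow> X = M"
  proof (rule subset_Zorn')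
    fix C assume C: "subset.chain A C"
    then have CA: "C \<subseteq> A" and ch: "\<And>X Y. X \<in> C \<Longrightarrow> Y \<in> C \<Longrightarrow> X \<subseteq> Y \<or> Y \<subseteq> X"
      by (auto simp: subset.chain_def)
    show "\<Union>C \<in> A"
      unfolding A_def
    proof (intro CollectI conjI ballI impI)
      fix b c assume bc: "b \<in> \<Union>C" "c \<in> \<Union>C" "b \<noteq> c"
      then obtain X Y where "X \<in> C" "Y \<in> C" "b \<in> X" "c \<in> Y" by blast
      then obtain Z where "Z \<in> C" "b \<in> Z" "c \<in> Z" using ch by blast
      then show "b \<bullet> c = 0" using CA bc(3) unfolding A_def by blast
    qed (use CA in \<open>auto simp: A_def\<close>)
  qed
  then obtain B where B: "B \<in> A" and max: "\<And>X. X \<in> A \<Longrightarrow> B \<subseteq> X \<Longrightarrow> X = B" by blast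
  define M where "M = {u. \<forall>b\<in>B. u \<bullet> b = 0}"
  have subM: "subspace M" by (auto simp: M_def subspace_def inner_add_left)
  have clM: "closed M"
  proof -
    have "M = (\<Inter>b\<in>B. {u. u \<bullet> b = 0})" by (auto simp: M_def)
    then show ?thesis
      by (auto intro!: closed_INT closed_Collect_eq continuous_intros)
  qed
  have invM: "K u \<in> M" if "u \<in> M" for u
    unfolding M_def
  proof (intro CollectI ballI)
    fix b assume b: "b \<in> B"
    then obtain s where "K b = s *\<^sub>R b" using B unfolding A_def by blast
    then show "K u \<bullet> b = 0" using that b by (simp add: sym M_def)
  qed
  have total: "u = 0" if u: "\<And>b. b \<in> B \<Longrightarrow> u \<bullet> b = 0" for u
  proof (rule ccontr)
    assume "u \<noteq> 0"
    moreover have "u \<in> M" using u by (simp add: M_def)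
    ultimately obtain w s where w: "w \<in> M" "norm w = 1" "s > 0" "K w = s *\<^sub>R w"
      using symmetric_compact_eigenvector[OF bl sym pos inj comp subM clM invM] by blast
    have "insert w B \<in> A"
      using B w unfolding A_def M_def by (auto simp: inner_commute)
    then have "w \<in> B" using max[of "insert w B"] by blast
    then have "w \<bullet> w = 0" using w(1) by (auto simp: M_def)
    then show False using w(2) by simp
  qed
  show ?thesis
    by (rule that[of B]) (use B total in \<open>auto simp: A_def\<close>)
qed

text \<open>Lax-Milgram: coercivity makes u - \<rho> (H u - w) a contraction in \<open>u\<close>,
  and its fixed point solves H u = w.\<close>

lemma coercive_right_inverse:
  fixes H :: "'a::{real_inner,complete_space} \<Rightarrow> 'a"
  assumes bl: "bounded_linear H" and c: "c > 0" and co: "\<And>u. c * (norm u)\<^sup>2 \<le> H u \<bullet> u"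
  obtains R where "bounded_linear R" "\<And>w. H (R w) = w" "\<And>w. norm (R w) \<le> norm w / c"
proof -
  interpret H: bounded_linear H by (rule bl)
  obtain L where L: "L > 0" "\<And>u. norm (H u) \<le> norm u * L" using H.pos_bounded by blast
  \<comment> \<open>Enlarging the bound to at least \<open>c\<close> keeps the radicand in
    \<open>q\<close> nonnegative.\<close>
  define L' where "L' = max L c"
  have L': "L' > 0" "c \<le> L'" using L c by (auto simp: L'_def)
  have L'3: "norm (H u) \<le> L' * norm u" for u
  proof -
    have "norm u * L \<le> norm u * L'" by (rule mult_left_mono) (auto simp: L'_def)
    then show ?thesis using L(2)[of u] by (simp add: mult.commute)
  qed
  \<comment> \<open>This value minimises 1 - 2 \<rho> c + \<rho>^2 L'^2, the bound for the squared
    contraction factor.\<close>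
  define \<rho> where "\<rho> = c / L'\<^sup>2"
  define q where "q = sqrt (1 - c\<^sup>2 / L'\<^sup>2)"
  have cL: "0 < c\<^sup>2 / L'\<^sup>2" "c\<^sup>2 / L'\<^sup>2 \<le> 1" using L' c by (auto simp: power_mono)
  have q: "0 \<le> q" "q < 1" using cL by (auto simp: q_def)
  have contr: "norm (d - \<rho> *\<^sub>R H d) \<le> q * norm d" for d
  proof (rule power2_le_imp_le)
    have "(norm (H d))\<^sup>2 \<le> L'\<^sup>2 * (norm d)\<^sup>2"
      using L'3[of d] by (metis norm_ge_zero power_mono power_mult_distrib)
    then have 1: "\<rho>\<^sup>2 * (norm (H d))\<^sup>2 \<le> \<rho>\<^sup>2 * (L'\<^sup>2 * (norm d)\<^sup>2)" by (intro mult_left_mono) auto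
    have 2: "\<rho> * (c * (norm d)\<^sup>2) \<le> \<rho> * (H d \<bullet> d)" using co L' c by (intro mult_left_mono) (auto simp: \<rho>_def)
    have "(norm (d - \<rho> *\<^sub>R H d))\<^sup>2 = (norm d)\<^sup>2 - 2 * (\<rho> * (H d \<bullet> d)) + \<rho>\<^sup>2 * (norm (H d))\<^sup>2"
      unfolding power2_norm_eq_inner
      by (simp add: inner_diff_left inner_diff_right inner_commute power2_eq_square algebra_simps)
    also have "\<dots> \<le> (norm d)\<^sup>2 - 2 * (\<rho> * (c * (norm d)\<^sup>2)) + \<rho>\<^sup>2 * (L'\<^sup>2 * (norm d)\<^sup>2)"
      using 1 2 by linarith
    also have "\<dots> = (1 - c\<^sup>2 / L'\<^sup>2) * (norm d)\<^sup>2"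
      using L'(1) by (simp add: \<rho>_def field_simps power2_eq_square)
    also have "\<dots> = (q * norm d)\<^sup>2" using cL by (simp add: q_def power_mult_distrib)
    finally show "(norm (d - \<rho> *\<^sub>R H d))\<^sup>2 \<le> (q * norm d)\<^sup>2" .
  qed (use q in auto)
  have low: "c * norm u \<le> norm (H u)" for u
  proof (cases "u = 0")
    case False
    have "c * norm u * norm u \<le> norm (H u) * norm u"
      using co[of u] norm_cauchy_schwarz[of "H u" u] by (simp add: power2_eq_square mult.assoc)
    then show ?thesis using False by simp
  qed (simp add: H.zero)
  have ex: "\<exists>u. H u = w" for w
  proof -
    have "\<exists>!u. u - \<rho> *\<^sub>R (H u - w) = u"
    proof (rule banach_fix_type[OF q], intro allI)
      show "dist (x - \<rho> *\<^sub>R (H x - w)) (y - \<rho> *\<^sub>R (H y - w)) \<le> q * dist x y" for x y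
      proof -
        have "x - \<rho> *\<^sub>R (H x - w) - (y - \<rho> *\<^sub>R (H y - w)) = (x - y) - \<rho> *\<^sub>R H (x - y)"
          by (simp add: H.diff algebra_simps)
        then show ?thesis using contr[of "x - y"] unfolding dist_norm by (simp only:)
      qed
    qed
    then obtain u where "u - \<rho> *\<^sub>R (H u - w) = u" by blast
    then have "\<rho> *\<^sub>R (H u - w) = 0" by (metis diff_zero diff_left_imp_eq)
    moreover have "\<rho> > 0" using L' c by (simp add: \<rho>_def)
    ultimately have "H u = w" by simp
    then show ?thesis by blast
  qed
  define R where "R w = (SOME u. H u = w)" for w
  have HR: "H (R w) = w" for w unfolding R_def using someI_ex[OF ex] .
  have inj: "u = v" if "H u = H v" for u v
  proof -
    have "c * norm (u - v) \<le> 0" using low[of "u - v"] that by (simp add: H.diff)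
    then show ?thesis using c by (simp add: mult_le_0_iff)
  qed
  have nR: "norm (R w) \<le> norm w / c" for w
    using low[of "R w"] c by (simp add: HR field_simps)
  have "bounded_linear R"
  proof (rule bounded_linear_intro[of _ "1 / c"])
    show "R (x + y) = R x + R y" for x y by (rule inj) (simp add: HR H.add)
    show "R (r *\<^sub>R x) = r *\<^sub>R R x" for r x by (rule inj) (simp add: HR H.scaleR)
    show "norm (R x) \<le> norm x * (1 / c)" for x using nR[of x] by simp
  qed
  then show ?thesis using HR nR that by blast
qed

section \<open>Orthonormal bases, Fourier coefficients and diagonal operators\<close>

locale orthobasis =
  fixes B :: "'a::{real_inner,complete_space} set"
  assumes norm1: "\<And>b. b \<in> B \<Longrightarrow> norm b = 1"
    and orth: "\<And>b c. b \<in> B \<Longrightarrow> c \<in> B \<Longrightarrow> b \<noteq> c \<Longrightarrow> b \<bullet> c = 0"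
    and total: "\<And>u. (\<And>b. b \<in> B \<Longrightarrow> u \<bullet> b = 0) \<Longrightarrow> u = 0"
begin

lemma eqI: "(\<And>b. b \<in> B \<Longrightarrow> u \<bullet> b = v \<bullet> b) \<Longrightarrow> u = v"
  using total[of "u - v"] by (simp add: inner_diff_left)

lemma inner_basis: "b \<in> B \<Longrightarrow> c \<in> B \<Longrightarrow> b \<bullet> c = (if b = c then 1 else 0)"
  using norm1 orth by (auto simp: norm_eq_1)

lemma inner_sum_basis:
  assumes "finite F" "F \<subseteq> B" "c \<in> B"
  shows "(\<Sum>b\<in>F. a b *\<^sub>R b) \<bullet> c = (if c \<in> F then a c else 0)"
proof -
  have "(\<Sum>b\<in>F. a b *\<^sub>R b) \<bullet> c = (\<Sum>b\<in>F. if b = c then a b else 0)"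
    unfolding inner_sum_left using assms inner_basis by (intro sum.cong) auto
  then show ?thesis using assms(1) by simp
qed

lemma norm_sum_basis:
  assumes "finite F" "F \<subseteq> B"
  shows "(norm (\<Sum>b\<in>F. a b *\<^sub>R b))\<^sup>2 = (\<Sum>b\<in>F. (a b)\<^sup>2)"
proof -
  have "(\<Sum>b\<in>F. a b *\<^sub>R b) \<bullet> (\<Sum>c\<in>F. a c *\<^sub>R c) = (\<Sum>c\<in>F. a c * (if c \<in> F then a c else 0))"
    unfolding inner_sum_right using assms by (intro sum.cong) (auto simp: inner_sum_basis subset_iff)
  also have "\<dots> = (\<Sum>b\<in>F. (a b)\<^sup>2)"
    by (rule sum.cong) (auto simp: power2_eq_square)
  finally show ?thesis by (simp only: power2_norm_eq_inner)
qed

lemma norm_diff_partial: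
  assumes "finite F" "F \<subseteq> B"
  shows "(norm (u - (\<Sum>b\<in>F. (u \<bullet> b) *\<^sub>R b)))\<^sup>2 = (norm u)\<^sup>2 - (\<Sum>b\<in>F. (u \<bullet> b)\<^sup>2)"
proof -
  let ?s = "\<Sum>b\<in>F. (u \<bullet> b) *\<^sub>R b"
  have "u \<bullet> ?s = (\<Sum>b\<in>F. (u \<bullet> b)\<^sup>2)" by (simp add: inner_sum_right power2_eq_square)
  moreover have "?s \<bullet> ?s = (\<Sum>b\<in>F. (u \<bullet> b)\<^sup>2)" using norm_sum_basis[OF assms] by (simp add: power2_norm_eq_inner)
  ultimately show ?thesis
    by (simp add: power2_norm_eq_inner inner_diff_left inner_diff_right inner_commute)
qed

lemma bessel: "finite F \<Longrightarrow> F \<subseteq> B \<Longrightarrow> (\<Sum>b\<in>F. (u \<bullet> b)\<^sup>2) \<le> (norm u)\<^sup>2"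
  using norm_diff_partial[of F u] zero_le_power2[of "norm (u - (\<Sum>b\<in>F. (u \<bullet> b) *\<^sub>R b))"] by linarith

text \<open>The basis may have any cardinality, so partial sums run over finite sets
  \<open>F n\<close> that miss at most 4^-n of the square sum. These sets need not be nested, and
  the difference of two partial sums has a tail on either side.\<close>

lemma riesz_fischer:
  assumes "\<And>F. finite F \<Longrightarrow> F \<subseteq> B \<Longrightarrow> (\<Sum>b\<in>F. (a b)\<^sup>2) \<le> C"
  shows "\<exists>v F. (\<forall>n::nat. finite (F n) \<and> F n \<subseteq> B) \<and> (\<lambda>n. \<Sum>b\<in>F n. a b *\<^sub>R b) \<longlonglongrightarrow> v \<and>
    (\<forall>b\<in>B. v \<bullet> b = a b)"
proof -
  have sm: "(\<lambda>b. (a b)\<^sup>2) summable_on B"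
    by (rule nonneg_bdd_above_summable_on) (use assms in \<open>auto intro!: bdd_aboveI[of _ C]\<close>)
  let ?I = "infsum (\<lambda>b. (a b)\<^sup>2) B"
  have up: "(\<Sum>b\<in>F. (a b)\<^sup>2) \<le> ?I" if "finite F" "F \<subseteq> B" for F
    by (rule finite_sum_le_infsum[OF sm that]) auto
  have "\<exists>F. finite F \<and> F \<subseteq> B \<and> ?I \<le> (\<Sum>b\<in>F. (a b)\<^sup>2) + (1/4)^n" for n :: nat
  proof -
    obtain F where "finite F" "F \<subseteq> B" "dist (\<Sum>b\<in>F. (a b)\<^sup>2) ?I \<le> (1/4)^n"
      using infsum_finite_approximation[OF sm, of "(1/4)^n"] by auto
    then show ?thesis by (intro exI[of _ F]) (auto simp: dist_real_def abs_le_iff)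
  qed
  then obtain F where F: "\<And>n. finite (F n)" "\<And>n. F n \<subseteq> B" "\<And>n. ?I \<le> (\<Sum>b\<in>F n. (a b)\<^sup>2) + (1/4)^n"
    by metis
  have tail: "(\<Sum>b\<in>G. (a b)\<^sup>2) \<le> (1/4)^n" if "finite G" "G \<subseteq> B" "G \<inter> F n = {}" for G n
  proof -
    have "F n \<inter> G = {}" using that(3) by blast
    then have "(\<Sum>b\<in>F n \<union> G. (a b)\<^sup>2) = (\<Sum>b\<in>F n. (a b)\<^sup>2) + (\<Sum>b\<in>G. (a b)\<^sup>2)"
      by (rule sum.union_disjoint[OF F(1) that(1)])
    then show ?thesis using up[of "F n \<union> G"] F[of n] that by simp
  qed
  have quarter: "(1/4)^n = ((1/2::real)^n)\<^sup>2" for n :: nat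
    by (simp add: power2_eq_square flip: power_mult_distrib)
  let ?s = "\<lambda>n. \<Sum>b\<in>F n. a b *\<^sub>R b"
  have half: "norm (?s m - ?s n) \<le> 2 * (1/2)^n" if "n \<le> m" for m n
  proof -
    have d: "?s m - ?s n = (\<Sum>b\<in>F m - F n. a b *\<^sub>R b) - (\<Sum>b\<in>F n - F m. a b *\<^sub>R b)"
      using sum.Int_Diff[OF F(1), of "\<lambda>b. a b *\<^sub>R b" m "F n"] sum.Int_Diff[OF F(1), of "\<lambda>b. a b *\<^sub>R b" n "F m"]
      by (simp add: Int_commute)
    have sub: "F m - F n \<subseteq> B" "F n - F m \<subseteq> B" using F(2) by auto
    have "(norm (\<Sum>b\<in>F m - F n. a b *\<^sub>R b))\<^sup>2 \<le> ((1/2)^n)\<^sup>2"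
      unfolding norm_sum_basis[OF finite_Diff[OF F(1)] sub(1)] quarter[symmetric]
      by (rule tail[OF _ sub(1)]) (use F in auto)
    then have 1: "norm (\<Sum>b\<in>F m - F n. a b *\<^sub>R b) \<le> (1/2)^n" by (rule power2_le_imp_le) simp
    have "(1/4)^m \<le> ((1/4)^n :: real)" using that by (intro power_decreasing) auto
    moreover have "(\<Sum>b\<in>F n - F m. (a b)\<^sup>2) \<le> (1/4)^m"
      by (rule tail[OF _ sub(2)]) (use F in auto)
    ultimately have "(norm (\<Sum>b\<in>F n - F m. a b *\<^sub>R b))\<^sup>2 \<le> ((1/2)^n)\<^sup>2"
      unfolding norm_sum_basis[OF finite_Diff[OF F(1)] sub(2)] quarter[symmetric] by linarith
    then have 2: "norm (\<Sum>b\<in>F n - F m. a b *\<^sub>R b) \<le> (1/2)^n" by (rule power2_le_imp_le) simp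
    show ?thesis unfolding d using norm_triangle_ineq4 1 2 by (smt (verit))
  qed
  have "Cauchy ?s"
  proof (rule metric_CauchyI)
    fix e :: real assume e: "e > 0"
    obtain N where N: "(1/2)^N < e / 4" using real_arch_pow_inv[of "e/4" "1/2"] e by auto
    have "dist (?s m) (?s n) < e" if "N \<le> m" "N \<le> n" for m n
      using half[OF that(1)] half[OF that(2)] N dist_triangle2[of "?s m" "?s n" "?s N"] by (simp add: dist_norm)
    then show "\<exists>M. \<forall>m\<ge>M. \<forall>n\<ge>M. dist (?s m) (?s n) < e" by blast
  qed
  then obtain v where v: "?s \<longlonglongrightarrow> v" using Cauchy_convergent convergent_def by blast
  have "v \<bullet> b = a b" if b: "b \<in> B" for b
  proof -
    have 1: "(\<lambda>n. ?s n \<bullet> b) \<longlonglongrightarrow> v \<bullet> b" by (intro tendsto_intros v)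
    have "(\<lambda>n. ?s n \<bullet> b - a b) \<longlonglongrightarrow> 0"
    proof (rule Lim_null_comparison[of _ "\<lambda>n. (1/2)^n"])
      show "\<forall>\<^sub>F n in sequentially. norm (?s n \<bullet> b - a b) \<le> (1 / 2) ^ n"
      proof (intro always_eventually allI)
        fix n
        show "norm (?s n \<bullet> b - a b) \<le> (1 / 2) ^ n"
        proof (cases "b \<in> F n")
          case False
          have "\<bar>a b\<bar>\<^sup>2 \<le> ((1/2)^n)\<^sup>2"
            using tail[of "{b}" n] b False unfolding quarter[symmetric] by simp
          then have "\<bar>a b\<bar> \<le> (1/2)^n" by (rule power2_le_imp_le) simp
          then show ?thesis using False inner_sum_basis[OF F(1,2) b, of a n] by simp
        qed (use inner_sum_basis[OF F(1,2) b, of a n] in simp)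
      qed
    qed (simp add: LIMSEQ_realpow_zero)
    then have "(\<lambda>n. ?s n \<bullet> b) \<longlonglongrightarrow> a b" by (simp add: LIM_zero_iff)
    then show ?thesis using 1 LIMSEQ_unique by blast
  qed
  then show ?thesis using F(1,2) v by blast
qed

text \<open>The vector that \<open>riesz_fischer\<close> builds from the coefficients of
  \<open>u\<close> has the same coefficients as \<open>u\<close>, hence equals \<open>u\<close> by
  totality.\<close>

lemma approx:
  assumes "e > 0"
  obtains F where "finite F" "F \<subseteq> B" "norm (u - (\<Sum>b\<in>F. (u \<bullet> b) *\<^sub>R b)) < e"
proof -
  obtain v F where F0: "(\<forall>n::nat. finite (F n) \<and> F n \<subseteq> B) \<and> (\<lambda>n. \<Sum>b\<in>F n. (u \<bullet> b) *\<^sub>R b) \<longlonglongrightarrow> v \<and>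
    (\<forall>b\<in>B. v \<bullet> b = u \<bullet> b)"
    using riesz_fischer[of "\<lambda>b. u \<bullet> b" "(norm u)\<^sup>2", OF bessel] by blast
  then have F: "\<And>n. finite (F n)" "\<And>n. F n \<subseteq> B" "(\<lambda>n. \<Sum>b\<in>F n. (u \<bullet> b) *\<^sub>R b) \<longlonglongrightarrow> v"
    "\<And>b. b \<in> B \<Longrightarrow> v \<bullet> b = u \<bullet> b" by auto
  have "v = u" by (rule eqI) (rule F(4))
  then obtain n where "dist (\<Sum>b\<in>F n. (u \<bullet> b) *\<^sub>R b) u < e"
    using F(3) assms unfolding lim_sequentially by blast
  then show ?thesis using F by (intro that[of "F n"]) (auto simp: dist_norm norm_minus_commute)
qed

lemma norm_le_coeff:
  assumes "\<And>F. finite F \<Longrightarrow> F \<subseteq> B \<Longrightarrow> (\<Sum>b\<in>F. (u \<bullet> b)\<^sup>2) \<le> C"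
  shows "(norm u)\<^sup>2 \<le> C"
proof (rule field_le_epsilon)
  fix e :: real assume e: "e > 0"
  obtain F where F: "finite F" "F \<subseteq> B" "norm (u - (\<Sum>b\<in>F. (u \<bullet> b) *\<^sub>R b)) < sqrt e"
    using approx[of "sqrt e" u] e by auto
  have "(norm (u - (\<Sum>b\<in>F. (u \<bullet> b) *\<^sub>R b)))\<^sup>2 < (sqrt e)\<^sup>2"
    using F(3) by (intro power_strict_mono) auto
  then show "(norm u)\<^sup>2 \<le> C + e"
    using norm_diff_partial[OF F(1,2), of u] assms[OF F(1,2)] e by simp
qed

lemma norm_le_multiplier:
  assumes "\<And>b. b \<in> B \<Longrightarrow> \<bar>v \<bullet> b\<bar> \<le> M * \<bar>u \<bullet> b\<bar>" "0 \<le> M"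
  shows "norm v \<le> M * norm u"
proof (rule power2_le_imp_le)
  show "(norm v)\<^sup>2 \<le> (M * norm u)\<^sup>2"
  proof (rule norm_le_coeff)
    fix F assume F: "finite F" "F \<subseteq> B"
    have "(\<Sum>b\<in>F. (v \<bullet> b)\<^sup>2) \<le> (\<Sum>b\<in>F. M\<^sup>2 * (u \<bullet> b)\<^sup>2)"
    proof (rule sum_mono)
      fix b assume "b \<in> F"
      then have "\<bar>v \<bullet> b\<bar>\<^sup>2 \<le> (M * \<bar>u \<bullet> b\<bar>)\<^sup>2" using assms F by (intro power_mono) auto
      then show "(v \<bullet> b)\<^sup>2 \<le> M\<^sup>2 * (u \<bullet> b)\<^sup>2" by (simp add: power_mult_distrib)
    qed
    also have "\<dots> \<le> M\<^sup>2 * (norm u)\<^sup>2"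
      unfolding sum_distrib_left[symmetric] using bessel[OF F] by (intro mult_left_mono) auto
    finally show "(\<Sum>b\<in>F. (v \<bullet> b)\<^sup>2) \<le> (M * norm u)\<^sup>2" by (simp add: power_mult_distrib)
  qed
qed (use assms in auto)

text \<open>The diagonal operator with symbol \<open>m\<close>. For a symbol bounded on
  \<open>B\<close> the vector exists by \<open>riesz_fischer\<close> and is unique by
  \<open>eqI\<close>.\<close>

definition mult :: "('a \<Rightarrow> real) \<Rightarrow> 'a \<Rightarrow> 'a" where
  "mult m u = (SOME v. \<forall>b\<in>B. v \<bullet> b = m b * (u \<bullet> b))"

lemma mult_inner:
  assumes m: "\<And>b. b \<in> B \<Longrightarrow> \<bar>m b\<bar> \<le> M" and b: "b \<in> B"
  shows "mult m u \<bullet> b = m b * (u \<bullet> b)"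
proof -
  have "(\<Sum>b\<in>F. (m b * (u \<bullet> b))\<^sup>2) \<le> M\<^sup>2 * (norm u)\<^sup>2" if F: "finite F" "F \<subseteq> B" for F
  proof -
    have "(\<Sum>b\<in>F. (m b * (u \<bullet> b))\<^sup>2) \<le> (\<Sum>b\<in>F. M\<^sup>2 * (u \<bullet> b)\<^sup>2)"
    proof (rule sum_mono)
      fix b assume "b \<in> F"
      then have "\<bar>m b\<bar>\<^sup>2 \<le> M\<^sup>2" using m F by (intro power_mono) auto
      then show "(m b * (u \<bullet> b))\<^sup>2 \<le> M\<^sup>2 * (u \<bullet> b)\<^sup>2" by (simp add: power_mult_distrib mult_right_mono)
    qed
    also have "\<dots> \<le> M\<^sup>2 * (norm u)\<^sup>2"
      unfolding sum_distrib_left[symmetric] using bessel[OF F] by (intro mult_left_mono) auto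
    finally show ?thesis .
  qed
  from riesz_fischer[of "\<lambda>b. m b * (u \<bullet> b)", OF this]
  have "\<exists>v. \<forall>b\<in>B. v \<bullet> b = m b * (u \<bullet> b)" by blast
  from someI_ex[OF this] b show ?thesis unfolding mult_def by blast
qed

lemma
  assumes m: "\<And>b. b \<in> B \<Longrightarrow> \<bar>m b\<bar> \<le> M" and M: "0 \<le> M"
  shows norm_mult_le: "norm (mult m u) \<le> M * norm u"
    and bounded_linear_mult: "bounded_linear (mult m)"
proof -
  note i = mult_inner[of m M, OF m]
  show n: "norm (mult m u) \<le> M * norm u" for u
    by (rule norm_le_multiplier) (use i m M in \<open>auto simp: abs_mult mult_right_mono\<close>)
  show "bounded_linear (mult m)"
  proof (rule bounded_linear_intro[of _ M])
    show "mult m (u + v) = mult m u + mult m v" for u v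
      by (rule eqI) (simp add: i inner_add_left algebra_simps)
    show "mult m (r *\<^sub>R u) = r *\<^sub>R mult m u" for r u
      by (rule eqI) (simp add: i algebra_simps)
    show "norm (mult m u) \<le> norm u * M" for u using n[of u] by (simp add: mult.commute)
  qed
qed

lemma mult_basis:
  assumes m: "\<And>b. b \<in> B \<Longrightarrow> \<bar>m b\<bar> \<le> M" and b: "b \<in> B"
  shows "mult m b = m b *\<^sub>R b"
  by (rule eqI) (use mult_inner[of m M, OF m] b in \<open>auto simp: inner_basis\<close>)

text \<open>A finite partial sum of \<open>u\<close> reduces the claim to finitely many
  coefficients; the uniform bound on the symbols controls the remainder. Strong continuity of the
  semigroup and the computation of its generator are both instances.\<close>

lemma tendsto_mult_strong:
  assumes lim: "\<And>b. b \<in> B \<Longrightarrow> ((\<lambda>h. m h b) \<longlongrightarrow> l b) G"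
    and bd: "\<forall>\<^sub>F h in G. \<forall>b\<in>B. \<bar>m h b\<bar> \<le> M" and bl: "\<And>b. b \<in> B \<Longrightarrow> \<bar>l b\<bar> \<le> M"
  shows "((\<lambda>h. mult (m h) u) \<longlongrightarrow> mult l u) G"
proof (rule tendstoI)
  fix e :: real assume e: "e > 0"
  define M' where "M' = max M 1"
  have M': "M' \<ge> 1" "M \<le> M'" by (auto simp: M'_def)
  obtain F where F: "finite F" "F \<subseteq> B" "norm (u - (\<Sum>b\<in>F. (u \<bullet> b) *\<^sub>R b)) < e / (4 * M')"
    using approx[of "e / (4 * M')" u] e M' by auto
  let ?f = "\<Sum>b\<in>F. (u \<bullet> b) *\<^sub>R b"
  have fin: "mult k ?f = (\<Sum>b\<in>F. ((u \<bullet> b) * k b) *\<^sub>R b)" if "\<And>b. b \<in> B \<Longrightarrow> \<bar>k b\<bar> \<le> M" for k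
  proof -
    have bl: "bounded_linear (mult k)" by (rule bounded_linear_mult[of k M']) (use that M' in force)+
    have "mult k ?f = (\<Sum>b\<in>F. (u \<bullet> b) *\<^sub>R mult k b)"
      using bounded_linear.linear[OF bl] by (simp add: linear_sum linear_scale)
    also have "\<dots> = (\<Sum>b\<in>F. ((u \<bullet> b) * k b) *\<^sub>R b)"
      by (rule sum.cong) (use F mult_basis[of k M] that in auto)
    finally show ?thesis .
  qed
  have small: "norm (mult k u - mult k ?f) \<le> e / 4" if "\<And>b. b \<in> B \<Longrightarrow> \<bar>k b\<bar> \<le> M" for k
  proof -
    have k: "\<bar>k b\<bar> \<le> M'" if "b \<in> B" for b using \<open>\<And>b. b \<in> B \<Longrightarrow> \<bar>k b\<bar> \<le> M\<close>[OF that] M' by simp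
    have bl: "bounded_linear (mult k)" by (rule bounded_linear_mult[of k M']) (use k M' in auto)
    have "norm (mult k (u - ?f)) \<le> M' * norm (u - ?f)" by (rule norm_mult_le) (use k M' in auto)
    also have "\<dots> \<le> M' * (e / (4 * M'))" using F(3) M' by (intro mult_left_mono) auto
    also have "\<dots> = e / 4" using M' by simp
    finally show ?thesis using bounded_linear.linear[OF bl] by (simp add: linear_diff)
  qed
  have "((\<lambda>h. \<Sum>b\<in>F. ((u \<bullet> b) * m h b) *\<^sub>R b) \<longlongrightarrow> (\<Sum>b\<in>F. ((u \<bullet> b) * l b) *\<^sub>R b)) G"
    by (intro tendsto_intros lim) (use F in auto)
  then have "\<forall>\<^sub>F h in G. dist (\<Sum>b\<in>F. ((u \<bullet> b) * m h b) *\<^sub>R b) (\<Sum>b\<in>F. ((u \<bullet> b) * l b) *\<^sub>R b) < e / 4"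
    using e by (intro tendstoD) auto
  then show "\<forall>\<^sub>F h in G. dist (mult (m h) u) (mult l u) < e"
    using bd
  proof eventually_elim
    case (elim h)
    have "norm (mult (m h) u - mult (m h) ?f) \<le> e / 4" by (rule small) (use elim in auto)
    moreover have "norm (mult l u - mult l ?f) \<le> e / 4" by (rule small) (rule bl)
    moreover have "norm (mult (m h) ?f - mult l ?f) < e / 4"
      using elim bl by (simp add: fin dist_norm)
    moreover have "norm (mult (m h) u - mult l u) = norm ((mult (m h) u - mult (m h) ?f) + (mult (m h) ?f - mult l ?f)
        - (mult l u - mult l ?f))" by (rule arg_cong[of _ _ norm]) simp
    ultimately show ?case
      unfolding dist_norm using e
        norm_triangle_ineq4[of "(mult (m h) u - mult (m h) ?f) + (mult (m h) ?f - mult l ?f)" "mult l u - mult l ?f"]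
        norm_triangle_ineq[of "mult (m h) u - mult (m h) ?f" "mult (m h) ?f - mult l ?f"]
      by linarith
  qed
qed

end

section \<open>Indefinite integrals of square integrable functions\<close>

lemma integrable_unit_iff: "integrable unit_leb (f :: real \<Rightarrow> real) \<longleftrightarrow> f absolutely_integrable_on {0<..<1}"
  unfolding set_integrable_def by (rule integrable_restrict_space) simp

lemma integral_unit:
  fixes f :: "real \<Rightarrow> real"
  assumes "integrable unit_leb f" shows "(\<integral>x. f x \<partial>unit_leb) = integral {0<..<1} f"
proof -
  have "(\<integral>x. f x \<partial>unit_leb) = (LINT x:{0<..<1}|lebesgue. f x)"
    unfolding set_lebesgue_integral_def by (rule integral_restrict_space) simp
  then show ?thesis
    using assms set_lebesgue_integral_eq_integral(2) unfolding integrable_unit_iff by metis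
qed

text \<open>\<open>S\<close> is any set that inside (0,1) is an interval with end points
  \<open>x\<close> and \<open>y\<close>, whichever of these belong to it, since end points are
  negligible. This passes between Lebesgue integrals over \<open>unit_leb\<close> and
  Henstock-Kurzweil integrals over [x,y].\<close>

lemma
  fixes h :: "real \<Rightarrow> real"
  assumes "{x<..<y} \<subseteq> S \<inter> {0<..<1}" "S \<inter> {0<..<1} \<subseteq> {x..y}"
  shows integrable_unit_indicator: "integrable unit_leb (\<lambda>s. indicator S s * h s) \<longleftrightarrow> h absolutely_integrable_on {x..y}"
    and integral_unit_indicator: "integrable unit_leb (\<lambda>s. indicator S s * h s) \<Longrightarrow>
      (\<integral>s. indicator S s * h s \<partial>unit_leb) = integral {x..y} h"
proof -
  have 1: "integrable unit_leb (\<lambda>s. indicator S s * h s) \<longleftrightarrow> h absolutely_integrable_on (S \<inter> {0<..<1})"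
    unfolding integrable_unit_iff set_integrable_def
    by (rule Bochner_Integration.integrable_cong) (auto simp: indicator_def)
  have n: "negligible {s \<in> S \<inter> {0<..<1} - {x..y}. h s \<noteq> 0}" "negligible {s \<in> {x..y} - S \<inter> {0<..<1}. h s \<noteq> 0}"
  proof -
    have "negligible {x, y}" by simp
    moreover have "{s \<in> {x..y} - S \<inter> {0<..<1}. h s \<noteq> 0} \<subseteq> {x, y}" using assms(1) by force
    ultimately show "negligible {s \<in> {x..y} - S \<inter> {0<..<1}. h s \<noteq> 0}" by (rule negligible_subset)
    have "{s \<in> S \<inter> {0<..<1} - {x..y}. h s \<noteq> 0} = {}" using assms(2) by auto
    then show "negligible {s \<in> S \<inter> {0<..<1} - {x..y}. h s \<noteq> 0}" by (metis negligible_empty)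
  qed
  show "integrable unit_leb (\<lambda>s. indicator S s * h s) \<longleftrightarrow> h absolutely_integrable_on {x..y}"
    unfolding 1 using absolutely_integrable_spike_set_eq[OF n] .
  assume i: "integrable unit_leb (\<lambda>s. indicator S s * h s)"
  have "(\<integral>s. indicator S s * h s \<partial>unit_leb) = integral {0<..<1} (\<lambda>s. indicator S s * h s)"
    by (rule integral_unit[OF i])
  also have "\<dots> = integral (S \<inter> {0<..<1}) h"
    unfolding integral_restrict_Int[of "{0<..<1}" S h, symmetric]
    by (rule arg_cong2[of _ _ _ _ integral]) (auto simp: indicator_def)
  also have "\<dots> = integral {x..y} h"
    by (rule integral_spike_set) (use n in \<open>auto elim!: negligible_subset\<close>)
  finally show "(\<integral>s. indicator S s * h s \<partial>unit_leb) = integral {x..y} h" .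
qed

lemma integrable_indicator_unit:
  fixes h :: "real \<Rightarrow> real"
  assumes "S \<in> sets lebesgue" "integrable unit_leb h"
  shows "integrable unit_leb (\<lambda>s. indicator S s * h s)"
proof -
  have [measurable]: "(indicator S :: real \<Rightarrow> real) \<in> borel_measurable unit_leb"
    using assms(1) by (intro measurable_restrict_space1 borel_measurable_indicator)
  have [measurable]: "h \<in> borel_measurable unit_leb" using assms(2) by simp
  show ?thesis
    by (rule Bochner_Integration.integrable_bound[OF assms(2)]) (measurable, auto simp: indicator_def)
qed

lemma
  assumes "r > -1"
  shows integrable_powr_unit: "integrable unit_leb (\<lambda>x. x powr r)"
    and integral_powr_unit: "(\<integral>x. x powr r \<partial>unit_leb) = 1 / (r + 1)"
proof -
  have I: "((\<lambda>x. x powr r) has_integral 1 / (r + 1)) {0..1}"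
    using has_integral_powr_from_0[OF assms, of 1] by simp
  have "(\<lambda>x. x powr r) absolutely_integrable_on {0..1}"
    by (rule nonnegative_absolutely_integrable_1) (use I in auto)
  then have i: "integrable unit_leb (\<lambda>s. indicator {0..1} s * s powr r)"
    by (subst integrable_unit_indicator[of 0 1]) auto
  have eq: "integrable unit_leb (\<lambda>s. indicator {0..1} s * s powr r) \<longleftrightarrow> integrable unit_leb (\<lambda>x. x powr r)"
    by (rule Bochner_Integration.integrable_cong) auto
  then show "integrable unit_leb (\<lambda>x. x powr r)" using i by simp
  have "(\<integral>x. x powr r \<partial>unit_leb) = (\<integral>s. indicator {0..1} s * s powr r \<partial>unit_leb)"
    by (rule Bochner_Integration.integral_cong) auto
  also have "\<dots> = integral {0..1} (\<lambda>x. x powr r)"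
    by (rule integral_unit_indicator[OF _ _ i]) auto
  finally show "(\<integral>x. x powr r \<partial>unit_leb) = 1 / (r + 1)" using I by (simp add: integral_unique)
qed

abbreviation nrm :: "(real \<Rightarrow> real) \<Rightarrow> real" where "nrm f \<equiv> norm (abs_L2 f)"

lemma cauchy_schwarz_unit:
  assumes "square_int f" "square_int g"
  shows "\<bar>\<integral>x. f x * g x \<partial>unit_leb\<bar> \<le> nrm f * nrm g"
  using Cauchy_Schwarz_ineq2[of "abs_L2 f" "abs_L2 g"] inner_abs_L2[OF assms] by simp

lemma nrm_indicator:
  assumes "0 \<le> x" "x \<le> y" "y \<le> 1" "{x<..<y} \<subseteq> S" "S \<subseteq> {x..y}" "S \<in> sets lebesgue"
  shows "square_int (indicator S)" "nrm (indicator S) = sqrt (y - x)"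
proof -
  show s: "square_int (indicator S)"
    using square_int_indicator_mult[OF assms(6), of "\<lambda>_. 1"] by (simp add: square_int_def)
  have i: "integrable unit_leb (\<lambda>s. indicator S s * 1 :: real)" using square_int_integrable[OF s] by simp
  have "(nrm (indicator S))\<^sup>2 = (\<integral>s. indicator S s * 1 \<partial>unit_leb)"
    unfolding norm_abs_L2_sq[OF s] by (rule Bochner_Integration.integral_cong) (auto simp: indicator_def)
  also have "\<dots> = integral {x..y} (\<lambda>_. 1)"
    by (rule integral_unit_indicator[OF _ _ i]) (use assms in auto)
  also have "\<dots> = y - x" using assms by simp
  finally show "nrm (indicator S) = sqrt (y - x)"
    by (metis norm_ge_zero real_sqrt_unique)
qed

section \<open>Primitives of square integrable functions\<close>

definition prim :: "(real \<Rightarrow> real) \<Rightarrow> real \<Rightarrow> real" where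
  "prim f s = (\<integral>x. indicator {..<s} x * f x \<partial>unit_leb)"

lemma integrable_indicator_square_int:
  assumes "square_int f" "S \<in> sets lebesgue"
  shows "integrable unit_leb (\<lambda>x. indicator S x * f x)"
  by (rule square_int_integrable[OF square_int_indicator_mult[OF assms(2,1)]])

lemma prim_diff:
  assumes f: "square_int f" and xy: "0 \<le> x" "x \<le> y" "y \<le> 1"
  shows "prim f y - prim f x = (\<integral>s. indicator {x..<y} s * f s \<partial>unit_leb)"
    and "prim f y - prim f x = integral {x..y} f"
proof -
  have "prim f y - prim f x = (\<integral>s. indicator {..<y} s * f s - indicator {..<x} s * f s \<partial>unit_leb)"
    unfolding prim_def by (rule Bochner_Integration.integral_diff[symmetric]) (auto intro!: integrable_indicator_square_int f)
  also have "\<dots> = (\<integral>s. indicator {x..<y} s * f s \<partial>unit_leb)"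
    by (rule Bochner_Integration.integral_cong) (use xy in \<open>auto simp: indicator_def\<close>)
  finally show 1: "prim f y - prim f x = (\<integral>s. indicator {x..<y} s * f s \<partial>unit_leb)" .
  also have "\<dots> = integral {x..y} f"
    by (rule integral_unit_indicator) (use xy in \<open>auto intro!: integrable_indicator_square_int f\<close>)
  finally show "prim f y - prim f x = integral {x..y} f" .
qed

lemma prim_0 [simp]: "prim f 0 = 0"
proof -
  have "prim f 0 = (\<integral>x. 0 \<partial>unit_leb)"
    unfolding prim_def by (rule Bochner_Integration.integral_cong) auto
  then show ?thesis by simp
qed

text \<open>Cauchy-Schwarz against an indicator function. At 0 the resulting factor sqrt y
  compensates the singular weight when \<alpha> \<ge> 1.\<close>

lemma prim_holder:
  assumes f: "square_int f" and xy: "0 \<le> x" "x \<le> y" "y \<le> 1"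
  shows "\<bar>prim f y - prim f x\<bar> \<le> sqrt (y - x) * nrm f"
proof -
  have sub: "{x<..<y} \<subseteq> {x..<y}" "{x..<y} \<subseteq> {x..y}" by auto
  show ?thesis
    unfolding prim_diff(1)[OF assms]
    using cauchy_schwarz_unit[OF nrm_indicator(1)[OF xy sub] f] nrm_indicator(2)[OF xy sub] by simp
qed

lemma prim_le: "square_int f \<Longrightarrow> 0 \<le> y \<Longrightarrow> y \<le> 1 \<Longrightarrow> \<bar>prim f y\<bar> \<le> sqrt y * nrm f"
  using prim_holder[of f 0 y] by simp

lemma continuous_on_prim: "square_int f \<Longrightarrow> continuous_on {0..1} (prim f)"
  unfolding continuous_on_iff
proof (intro ballI allI impI)
  fix x e :: real assume f: "square_int f" and x: "x \<in> {0..1}" and e: "e > 0"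
  define d where "d = (e / (nrm f + 1))\<^sup>2"
  have n: "nrm f + 1 > 0" by (simp add: add_nonneg_pos)
  have d: "d > 0" "sqrt d = e / (nrm f + 1)"
    using e n by (auto simp: d_def intro!: divide_pos_pos)
  have "\<bar>prim f y - prim f x\<bar> < e" if "y \<in> {0..1}" "\<bar>y - x\<bar> < d" for y
  proof -
    have "\<bar>prim f y - prim f x\<bar> \<le> sqrt \<bar>y - x\<bar> * nrm f"
      using prim_holder[OF f, of x y] prim_holder[OF f, of y x] x that
      by (cases "x \<le> y") (auto simp: abs_minus_commute)
    also have "\<dots> \<le> sqrt d * nrm f" using that(2) by (intro mult_right_mono) auto
    also have "\<dots> < e" unfolding d(2) using e n by (simp add: field_simps)
    finally show ?thesis .
  qed
  then show "\<exists>d>0. \<forall>y\<in>{0..1}. dist y x < d \<longrightarrow> dist (prim f y) (prim f x) < e"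
    using d(1) by (auto simp: dist_real_def)
qed

lemma prim_cong:
  assumes "square_int f" "square_int g" "AE x in unit_leb. f x = g x"
  shows "prim f = prim g"
proof
  fix s
  have [measurable]: "f \<in> borel_measurable unit_leb" "g \<in> borel_measurable unit_leb"
    using assms by (auto simp: square_int_def)
  have [measurable]: "(indicator {..<s} :: real \<Rightarrow> real) \<in> borel_measurable unit_leb"
    by (intro measurable_restrict_space1 borel_measurable_indicator) simp
  show "prim f s = prim g s"
    unfolding prim_def by (rule integral_cong_AE) (use assms(3) in auto)
qed

lemma prim_add: "square_int f \<Longrightarrow> square_int g \<Longrightarrow> prim (\<lambda>x. f x + g x) s = prim f s + prim g s"
  unfolding prim_def distrib_left
  by (rule Bochner_Integration.integral_add) (auto intro!: integrable_indicator_square_int)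

lemma prim_scale: "prim (\<lambda>x. c * f x) s = c * prim f s"
  unfolding prim_def by (simp add: mult.left_commute)

text \<open>Extension by zero makes \<open>f\<close> integrable over every interval, as
  \<open>lebesgue_differentiation\<close> requires.\<close>

lemma DERIV_prim:
  assumes f: "square_int f"
  obtains N where "negligible N" "\<And>x. 0 < x \<Longrightarrow> x < 1 \<Longrightarrow> x \<notin> N \<Longrightarrow> (prim f has_real_derivative f x) (at x)"
proof -
  define f0 where "f0 x = (if x \<in> {0<..<1} then f x else 0)" for x
  have "f absolutely_integrable_on {0<..<1}"
    using square_int_integrable[OF f] by (simp add: integrable_unit_iff)
  then have "f0 absolutely_integrable_on UNIV"
    unfolding f0_def by (simp only: absolutely_integrable_restrict_UNIV)
  then have "f0 absolutely_integrable_on {x..y}" for x y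
    by (rule absolutely_integrable_on_subinterval) auto
  then have "f0 integrable_on {x..y}" for x y by (rule set_lebesgue_integral_eq_integral(1))
  then obtain N where N: "negligible N"
    "\<And>x c. x \<notin> N \<Longrightarrow> c < x \<Longrightarrow> ((\<lambda>y. integral {c..y} f0) has_real_derivative f0 x) (at x)"
    using lebesgue_differentiation[of f0] by metis
  have eq: "integral {0..y} f0 = prim f y" if "0 < y" "y < 1" for y
  proof -
    have "integral {0..y} f0 = integral {0..y} f"
      by (rule integral_spike[of "{0}"]) (use that in \<open>auto simp: f0_def\<close>)
    then show ?thesis using prim_diff(2)[OF f, of 0 y] that by simp
  qed
  show ?thesis
  proof (rule that[OF N(1)])
    fix x :: real assume x: "0 < x" "x < 1" "x \<notin> N"
    show "(prim f has_real_derivative f x) (at x)"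
    proof (rule has_field_derivative_transform_within_open[of _ _ _ "{0<..<1}"])
      show "((\<lambda>y. integral {0..y} f0) has_real_derivative f x) (at x)"
        using N(2)[OF x(3,1)] x by (simp add: f0_def)
    qed (use x eq in auto)
  qed
qed

lemma AE_unit_negligible:
  assumes "negligible N" "\<And>x. 0 < x \<Longrightarrow> x < 1 \<Longrightarrow> x \<notin> N \<Longrightarrow> P x"
  shows "AE x in unit_leb. P x"
proof -
  have "N \<in> null_sets lebesgue" using assms(1) by (simp add: negligible_iff_null_sets)
  then have "AE x in lebesgue. x \<notin> N" by (rule AE_not_in)
  then have "AE x in lebesgue. x \<in> {0<..<1} \<longrightarrow> P x"
    by eventually_elim (use assms(2) in auto)
  then show ?thesis by (subst AE_restrict_space_iff) auto
qed

lemma AE_unit_obtain: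
  assumes "AE x in unit_leb. P x"
  obtains N where "negligible N" "\<And>x. 0 < x \<Longrightarrow> x < 1 \<Longrightarrow> x \<notin> N \<Longrightarrow> P x"
proof -
  have "AE x in lebesgue. x \<in> {0<..<1} \<longrightarrow> P x"
    using assms by (subst (asm) AE_restrict_space_iff) auto
  then obtain N where "\<And>x. x \<in> space lebesgue - N \<Longrightarrow> x \<in> {0<..<1} \<longrightarrow> P x" "N \<in> null_sets lebesgue"
    by (rule AE_E3) blast
  then show ?thesis by (intro that[of N]) (auto simp: negligible_iff_null_sets)
qed

text \<open>From |f| \<le> K + f^2 / K, an increment is at most K times the length plus the integral
  of f^2 over the interval divided by K; over disjoint intervals these integrals add up to at most
  the full one.\<close>

lemma prim_abs_cont:
  assumes f: "square_int f" and ab: "0 < a" "b < 1"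
  shows "abs_cont_on a b (prim f)"
  unfolding abs_cont_on_def
proof (intro allI impI)
  fix \<epsilon> :: real assume e: "\<epsilon> > 0"
  let ?S = "\<integral>x. (f x)\<^sup>2 \<partial>unit_leb"
  \<comment> \<open>Chosen so that the full integral of f^2 divided by \<open>K\<close> is at most
    \<epsilon>/2; the lengths get the other half through \<delta> = \<epsilon> / (2 K).\<close>
  define K where "K = 2 * (?S + 1) / \<epsilon>"
  have S0: "?S \<ge> 0" by simp
  have K: "K > 0" using e S0 by (auto simp: K_def intro!: divide_pos_pos add_nonneg_pos)
  have KS: "?S / K \<le> \<epsilon> / 2" using e S0 K by (simp add: K_def field_simps)
  have one: "\<bar>prim f v - prim f u\<bar> \<le> K * (v - u) + (\<integral>s. indicator {u<..<v} s * (f s)\<^sup>2 \<partial>unit_leb) / K"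
    if uv: "a \<le> u" "u \<le> v" "v \<le> b" for u v
  proof -
    let ?I = "{u<..<v}"
    have i0: "integrable unit_leb (\<lambda>s. indicator ?I s * f s)" by (rule integrable_indicator_square_int[OF f]) simp
    have i1: "integrable unit_leb (\<lambda>s. indicator ?I s * (f s)\<^sup>2)"
      by (rule integrable_indicator_unit) (use f in \<open>auto simp: square_int_def\<close>)
    have i2: "integrable unit_leb (\<lambda>s. indicator ?I s * 1 :: real)"
      by (rule integrable_indicator_square_int) (auto simp: square_int_def)
    have "prim f v - prim f u = integral {u..v} f" by (rule prim_diff(2)[OF f]) (use uv ab in auto)
    also have "\<dots> = (\<integral>s. indicator ?I s * f s \<partial>unit_leb)"
      by (rule integral_unit_indicator[symmetric, OF _ _ i0]) (use uv ab in auto)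
    finally have "\<bar>prim f v - prim f u\<bar> \<le> (\<integral>s. \<bar>indicator ?I s * f s\<bar> \<partial>unit_leb)"
      by simp
    also have "\<dots> \<le> (\<integral>s. K * (indicator ?I s * 1) + (indicator ?I s * (f s)\<^sup>2) / K \<partial>unit_leb)"
    proof (rule integral_mono)
      fix s :: real
      have "2 * (K * \<bar>f s\<bar>) \<le> K\<^sup>2 + \<bar>f s\<bar>\<^sup>2"
        using sum_squares_bound[of K "\<bar>f s\<bar>"] by (simp add: mult.assoc)
      moreover have "0 \<le> K * \<bar>f s\<bar>" using K by simp
      ultimately have "K * \<bar>f s\<bar> \<le> K\<^sup>2 + (f s)\<^sup>2" by simp
      then have "\<bar>f s\<bar> \<le> K + (f s)\<^sup>2 / K" using K by (simp add: field_simps power2_eq_square)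
      then show "\<bar>indicator ?I s * f s\<bar> \<le> K * (indicator ?I s * 1) + (indicator ?I s * (f s)\<^sup>2) / K"
        by (auto simp: indicator_def)
    qed (use i0 i1 i2 in auto)
    also have "\<dots> = K * (\<integral>s. indicator ?I s * 1 \<partial>unit_leb) + (\<integral>s. indicator ?I s * (f s)\<^sup>2 \<partial>unit_leb) / K"
      using i1 i2 by simp
    also have "(\<integral>s. indicator ?I s * 1 \<partial>unit_leb) = integral {u..v} (\<lambda>_. 1 :: real)"
      by (rule integral_unit_indicator[OF _ _ i2]) (use uv ab in auto)
    also have "\<dots> = v - u" using uv by simp
    finally show ?thesis .
  qed
  show "\<exists>\<delta>>0. \<forall>(n::nat) u v. (\<forall>i<n. a \<le> u i \<and> u i \<le> v i \<and> v i \<le> b) \<longrightarrow>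
      disjoint_family_on (\<lambda>i. {u i<..<v i}) {..<n} \<longrightarrow>
      (\<Sum>i<n. v i - u i) < \<delta> \<longrightarrow> (\<Sum>i<n. \<bar>prim f (v i) - prim f (u i)\<bar>) < \<epsilon>"
  proof (intro exI[of _ "\<epsilon> / (2 * K)"] conjI allI impI)
    show "0 < \<epsilon> / (2 * K)" using e K by simp
    fix n :: nat and u v
    assume uv: "\<forall>i<n. a \<le> u i \<and> u i \<le> v i \<and> v i \<le> b" and dis: "disjoint_family_on (\<lambda>i. {u i<..<v i}) {..<n}"
      and len: "(\<Sum>i<n. v i - u i) < \<epsilon> / (2 * K)"
    have i1: "integrable unit_leb (\<lambda>s. indicator {u i<..<v i} s * (f s)\<^sup>2)" for i
      by (rule integrable_indicator_unit) (use f in \<open>auto simp: square_int_def\<close>)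
    have "(\<Sum>i<n. \<bar>prim f (v i) - prim f (u i)\<bar>)
        \<le> (\<Sum>i<n. K * (v i - u i) + (\<integral>s. indicator {u i<..<v i} s * (f s)\<^sup>2 \<partial>unit_leb) / K)"
      by (rule sum_mono) (use one uv in auto)
    also have "\<dots> = K * (\<Sum>i<n. v i - u i) + (\<Sum>i<n. \<integral>s. indicator {u i<..<v i} s * (f s)\<^sup>2 \<partial>unit_leb) / K"
      by (simp add: sum.distrib sum_distrib_left sum_divide_distrib)
    also have "(\<Sum>i<n. \<integral>s. indicator {u i<..<v i} s * (f s)\<^sup>2 \<partial>unit_leb)
        = (\<integral>s. (\<Sum>i<n. indicator {u i<..<v i} s * (f s)\<^sup>2) \<partial>unit_leb)"
      using i1 by (subst Bochner_Integration.integral_sum) auto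
    also have "\<dots> \<le> ?S"
    proof (rule integral_mono)
      show "integrable unit_leb (\<lambda>s. \<Sum>i<n. indicator {u i<..<v i} s * (f s)\<^sup>2)"
        by (rule Bochner_Integration.integrable_sum) (rule i1)
      show "integrable unit_leb (\<lambda>s. (f s)\<^sup>2)" using f by (simp add: square_int_def)
      fix s
      have eq: "(\<Sum>i<n. indicator {u i<..<v i} s * (f s)\<^sup>2) = indicator (\<Union>i<n. {u i<..<v i}) s * (f s)\<^sup>2"
      proof -
        have "indicator (\<Union>i<n. {u i<..<v i}) s = (\<Sum>i<n. indicator {u i<..<v i} s :: real)"
          by (rule indicator_UN_disjoint[OF _ dis]) simp
        then show ?thesis by (simp only: sum_distrib_right[symmetric])
      qed
      show "(\<Sum>i<n. indicator {u i<..<v i} s * (f s)\<^sup>2) \<le> (f s)\<^sup>2"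
        unfolding eq by (simp add: indicator_def)
    qed
    finally have "(\<Sum>i<n. \<bar>prim f (v i) - prim f (u i)\<bar>) \<le> K * (\<Sum>i<n. v i - u i) + ?S / K"
      using K by (simp add: divide_right_mono)
    also have "\<dots> < K * (\<epsilon> / (2 * K)) + \<epsilon> / 2"
      using KS K len by (intro add_less_le_mono mult_strict_left_mono) auto
    also have "\<dots> = \<epsilon>" using K by simp
    finally show "(\<Sum>i<n. \<bar>prim f (v i) - prim f (u i)\<bar>) < \<epsilon>" .
  qed
qed

section \<open>The Green operator\<close>

locale degenerate =
  fixes \<alpha> :: real
  assumes \<alpha>: "0 < \<alpha>" "\<alpha> < 2"
begin

text \<open>Any \<open>p\<close> in \<open>(0, 1/2)\<close> with \<open>\<alpha> - 1/2 \<le> 1 + p\<close> serves for both boundary conditions: the solutions of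
  \<open>\<P>\<theta> = f\<close> are then bounded by a multiple of \<open>x powr - p\<close>, which is square integrable.\<close>

definition p :: real where "p = \<alpha> / 4"

lemma p: "0 < p" "p < 1/2" using \<alpha> by (auto simp: p_def)

lemma powr_sq: "(x powr - p)\<^sup>2 = x powr (- (2 * p))"
  by (simp add: power2_eq_square powr_add[symmetric])

lemma p0: "p \<noteq> 0" using p by simp

text \<open>Solving \<open>- (x\<^sup>\<alpha>\<theta>')' = f\<close>: \<open>flx f\<close> is the flux \<open>x\<^sup>\<alpha>\<theta>'\<close>, \<open>gr f\<close> the derivative \<open>\<theta>'\<close> and \<open>sol f\<close> the solution \<open>\<theta>\<close>
  vanishing at \<open>1\<close>. The constant \<open>cst f\<close> is the flux at \<open>0\<close> that the boundary condition at \<open>0\<close> forces.\<close>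

definition cst :: "(real \<Rightarrow> real) \<Rightarrow> real" where
  "cst f = (if \<alpha> < 1 then (1 - \<alpha>) * (\<integral>s. s powr - \<alpha> * prim f s \<partial>unit_leb) else 0)"

definition flx :: "(real \<Rightarrow> real) \<Rightarrow> real \<Rightarrow> real" where "flx f s = cst f - prim f s"

definition gr :: "(real \<Rightarrow> real) \<Rightarrow> real \<Rightarrow> real" where "gr f s = s powr - \<alpha> * flx f s"

definition sol :: "(real \<Rightarrow> real) \<Rightarrow> real \<Rightarrow> real" where
  "sol f x = - (\<integral>s. indicator {x<..} s * gr f s \<partial>unit_leb)"

lemma measurable_unit: "continuous_on {0<..<1} h \<Longrightarrow> h \<in> borel_measurable unit_leb"
  by (rule continuous_imp_measurable_on_sets_lebesgue) auto

lemma continuous_flx: "square_int f \<Longrightarrow> continuous_on {0..1} (flx f)"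
  unfolding flx_def by (intro continuous_intros continuous_on_prim)

lemma continuous_gr: "square_int f \<Longrightarrow> continuous_on {0<..1} (gr f)"
  unfolding gr_def by (intro continuous_intros continuous_on_subset[OF continuous_flx]) auto

lemma prim_le1: "square_int f \<Longrightarrow> 0 \<le> y \<Longrightarrow> y \<le> 1 \<Longrightarrow> \<bar>prim f y\<bar> \<le> nrm f"
  using prim_le[of f y] mult_right_mono[of "sqrt y" 1 "nrm f"] by simp

lemma integrable_powr_mult:
  assumes "r > -1" "continuous_on {0<..<1} h" "\<And>s. 0 < s \<Longrightarrow> s < 1 \<Longrightarrow> \<bar>h s\<bar> \<le> C * s powr r"
  shows "integrable unit_leb h"
proof (rule Bochner_Integration.integrable_bound)
  show "integrable unit_leb (\<lambda>s. C * s powr r)"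
    using integrable_powr_unit[OF assms(1)] by simp
  show "AE s in unit_leb. norm (h s) \<le> norm (C * s powr r)"
    using assms(3) by (intro AE_I2) (fastforce intro: order_trans[OF _ abs_ge_self])
qed (rule measurable_unit[OF assms(2)])

lemma integrable_cst:
  assumes "square_int f" "\<alpha> < 1"
  shows "integrable unit_leb (\<lambda>s. s powr - \<alpha> * prim f s)"
proof (rule integrable_powr_mult[of "- \<alpha>" _ "nrm f"])
  show "continuous_on {0<..<1} (\<lambda>s. s powr - \<alpha> * prim f s)"
    by (intro continuous_intros continuous_on_subset[OF continuous_on_prim[OF assms(1)]]) auto
  show "\<bar>s powr - \<alpha> * prim f s\<bar> \<le> nrm f * s powr - \<alpha>" if "0 < s" "s < 1" for s
    using prim_le1[OF assms(1), of s] that by (simp add: abs_mult mult.commute mult_left_mono)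
qed (use assms in auto)

text \<open>For \<alpha> < 1 the weight (1 - \<alpha>) s^(-\<alpha>) has total mass 1, so
  \<open>cst f\<close> is an average of \<open>prim f\<close>.\<close>

lemma cst_le: "square_int f \<Longrightarrow> \<bar>cst f\<bar> \<le> nrm f"
proof (cases "\<alpha> < 1")
  case True
  assume f: "square_int f"
  have "\<bar>\<integral>s. s powr - \<alpha> * prim f s \<partial>unit_leb\<bar> \<le> (\<integral>s. \<bar>s powr - \<alpha> * prim f s\<bar> \<partial>unit_leb)" by simp
  also have "\<dots> \<le> (\<integral>s. nrm f * s powr - \<alpha> \<partial>unit_leb)"
  proof (rule integral_mono)
    show "\<bar>s powr - \<alpha> * prim f s\<bar> \<le> nrm f * s powr - \<alpha>" if "s \<in> space unit_leb" for s
      using prim_le1[OF f, of s] that by (simp add: abs_mult mult.commute mult_left_mono)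
  qed (use integrable_cst[OF f True] integrable_powr_unit[of "- \<alpha>"] True in auto)
  also have "\<dots> = nrm f / (1 - \<alpha>)" using integral_powr_unit[of "- \<alpha>"] True by simp
  finally have "(1 - \<alpha>) * \<bar>\<integral>s. s powr - \<alpha> * prim f s \<partial>unit_leb\<bar> \<le> (1 - \<alpha>) * (nrm f / (1 - \<alpha>))"
    using True by (intro mult_left_mono) auto
  then show ?thesis using True by (simp add: cst_def abs_mult)
qed (simp add: cst_def)

lemma flx_le: "square_int f \<Longrightarrow> 0 \<le> s \<Longrightarrow> s \<le> 1 \<Longrightarrow> \<bar>flx f s\<bar> \<le> 2 * nrm f"
  using cst_le[of f] prim_le1[of f s] unfolding flx_def by linarith

lemma gr_le: "square_int f \<Longrightarrow> 0 \<le> s \<Longrightarrow> s \<le> 1 \<Longrightarrow> \<bar>gr f s\<bar> \<le> 2 * nrm f * s powr - \<alpha>"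
  using flx_le[of f s] by (simp add: gr_def abs_mult mult.commute mult_left_mono)

lemma gr_bound:
  assumes f: "square_int f" and s: "0 < s" "s \<le> 1"
  shows "\<bar>gr f s\<bar> \<le> 2 * nrm f * s powr (-1 - p)"
proof (cases "\<alpha> < 1")
  case True
  have "s powr - \<alpha> \<le> s powr (-1 - p)" using s True p by (intro powr_mono') auto
  then show ?thesis using gr_le[OF f, of s] s
    by (smt (verit) mult_left_mono norm_ge_zero)
next
  case False
  have "\<bar>gr f s\<bar> = s powr - \<alpha> * \<bar>prim f s\<bar>" using False by (simp add: gr_def flx_def cst_def abs_mult)
  also have "\<dots> \<le> s powr - \<alpha> * (sqrt s * nrm f)"
    using prim_le[OF f, of s] s by (intro mult_left_mono) auto
  also have "\<dots> = nrm f * s powr (1/2 - \<alpha>)"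
    using s by (simp add: powr_half_sqrt[symmetric] powr_add[symmetric] mult.assoc[symmetric])
  \<comment> \<open>With p = \<alpha>/4 the comparison of exponents amounts to \<alpha> \<le>
    2.\<close>
  also have "\<dots> \<le> nrm f * s powr (-1 - p)"
    using s \<alpha> by (intro mult_left_mono powr_mono') (auto simp: p_def)
  also have "\<dots> \<le> 2 * nrm f * s powr (-1 - p)" by (simp add: mult_right_mono)
  finally show ?thesis .
qed

lemma
  assumes x: "0 < x" "x < 1"
  shows integrable_tail: "integrable unit_leb (\<lambda>s. indicator {x<..} s * s powr (-1 - p))"
    and integral_tail: "(\<integral>s. indicator {x<..} s * s powr (-1 - p) \<partial>unit_leb) \<le> x powr - p / p"
proof -
  have I: "((\<lambda>s. s powr (-1 - p)) has_integral (- (1 powr - p / p) - - (x powr - p / p))) {x..1}"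
  proof (rule fundamental_theorem_of_calculus)
    fix s assume "s \<in> {x..1}"
    then have "((\<lambda>s. - (s powr - p / p)) has_real_derivative s powr (-1 - p)) (at s within {x..1})"
      using x p by (auto intro!: derivative_eq_intros simp: field_simps powr_diff powr_minus)
    then show "((\<lambda>s. - (s powr - p / p)) has_vector_derivative s powr (-1 - p)) (at s within {x..1})"
      by (simp add: has_real_derivative_iff_has_vector_derivative)
  qed (use x in auto)
  have "(\<lambda>s. s powr (-1 - p)) absolutely_integrable_on {x..1}"
    by (rule nonnegative_absolutely_integrable_1) (use I in auto)
  then show i: "integrable unit_leb (\<lambda>s. indicator {x<..} s * s powr (-1 - p))"
    by (subst integrable_unit_indicator[of x 1]) (use x in auto)
  have "(\<integral>s. indicator {x<..} s * s powr (-1 - p) \<partial>unit_leb) = integral {x..1} (\<lambda>s. s powr (-1 - p))"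
    by (rule integral_unit_indicator[OF _ _ i]) (use x in auto)
  also have "\<dots> = - (1 powr - p / p) - - (x powr - p / p)" using I by (rule integral_unique)
  also have "\<dots> \<le> x powr - p / p" using p by simp
  finally show "(\<integral>s. indicator {x<..} s * s powr (-1 - p) \<partial>unit_leb) \<le> x powr - p / p" .
qed

lemma integrable_gr:
  assumes f: "square_int f" and x: "0 < x" "x < 1"
  shows "integrable unit_leb (\<lambda>s. indicator {x<..} s * gr f s)"
proof (rule Bochner_Integration.integrable_bound)
  show "integrable unit_leb (\<lambda>s. 2 * nrm f * (indicator {x<..} s * s powr (-1 - p)))"
    by (intro integrable_mult_right integrable_tail x)
  have [measurable]: "gr f \<in> borel_measurable unit_leb"
    by (rule measurable_unit, rule continuous_on_subset[OF continuous_gr[OF f]]) auto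
  have [measurable]: "(indicator {x<..} :: real \<Rightarrow> real) \<in> borel_measurable unit_leb"
    by (intro measurable_restrict_space1 borel_measurable_indicator) simp
  show "(\<lambda>s. indicator {x<..} s * gr f s) \<in> borel_measurable unit_leb" by measurable
  show "AE s in unit_leb. norm (indicator {x<..} s * gr f s)
      \<le> norm (2 * nrm f * (indicator {x<..} s * s powr (-1 - p)))"
    by (intro AE_I2) (use gr_bound[OF f] in \<open>auto simp: indicator_def\<close>)
qed

lemma sol_bound:
  assumes f: "square_int f" and x: "0 < x" "x < 1"
  shows "\<bar>sol f x\<bar> \<le> 2 / p * nrm f * x powr - p"
proof -
  have "\<bar>sol f x\<bar> \<le> (\<integral>s. \<bar>indicator {x<..} s * gr f s\<bar> \<partial>unit_leb)"
    unfolding sol_def by simp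
  also have "\<dots> \<le> (\<integral>s. 2 * nrm f * (indicator {x<..} s * s powr (-1 - p)) \<partial>unit_leb)"
  proof (rule integral_mono)
    show "integrable unit_leb (\<lambda>s. \<bar>indicator {x<..} s * gr f s\<bar>)"
      using integrable_gr[OF assms] by simp
    show "integrable unit_leb (\<lambda>s. 2 * nrm f * (indicator {x<..} s * s powr (-1 - p)))"
      by (intro integrable_mult_right integrable_tail x)
    show "\<bar>indicator {x<..} s * gr f s\<bar> \<le> 2 * nrm f * (indicator {x<..} s * s powr (-1 - p))"
      if "s \<in> space unit_leb" for s
      using gr_bound[OF f, of s] that by (auto simp: indicator_def)
  qed
  also have "\<dots> = 2 * nrm f * (\<integral>s. indicator {x<..} s * s powr (-1 - p) \<partial>unit_leb)"
    by simp
  also have "\<dots> \<le> 2 * nrm f * (x powr - p / p)"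
    by (intro mult_left_mono integral_tail x) auto
  finally show ?thesis by simp
qed

lemma sol_1 [simp]: "sol f 1 = 0"
proof -
  have "(\<integral>s. indicator {1<..} s * gr f s \<partial>unit_leb) = (\<integral>s. 0 \<partial>unit_leb)"
    by (rule Bochner_Integration.integral_cong) auto
  then show ?thesis by (simp add: sol_def)
qed

lemma sol_diff:
  assumes f: "square_int f" and x: "0 < x" "x \<le> y" "y \<le> 1"
  shows "sol f y - sol f x = integral {x..y} (gr f)"
proof -
  have g: "integral {x..1} (gr f) = - sol f x" if "0 < x" "x \<le> 1" for x
  proof (cases "x = 1")
    case False
    then have "x < 1" using that by simp
    have "(\<integral>s. indicator {x<..} s * gr f s \<partial>unit_leb) = integral {x..1} (gr f)"
      by (rule integral_unit_indicator[OF _ _ integrable_gr[OF f]]) (use that \<open>x < 1\<close> in auto)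
    then show ?thesis by (simp add: sol_def)
  qed auto
  have "gr f integrable_on {x..1}"
    by (rule integrable_continuous_real, rule continuous_on_subset[OF continuous_gr[OF f]]) (use x in auto)
  then have "integral {x..y} (gr f) + integral {y..1} (gr f) = integral {x..1} (gr f)"
    by (intro Henstock_Kurzweil_Integration.integral_combine x)
  then show ?thesis using g[of x] g[of y] x by simp
qed

lemma DERIV_sol:
  assumes f: "square_int f" and x: "0 < x" "x < 1"
  shows "(sol f has_real_derivative gr f x) (at x)"
proof -
  have "((\<lambda>y. integral {x/2..y} (gr f)) has_real_derivative gr f x) (at x within {x/2..1})"
    by (rule integral_has_real_derivative, rule continuous_on_subset[OF continuous_gr[OF f]]) (use x in auto)
  then have "((\<lambda>y. integral {x/2..y} (gr f)) has_real_derivative gr f x) (at x)"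
    using x by (simp add: at_within_Icc_at)
  then have "((\<lambda>y. sol f (x/2) + integral {x/2..y} (gr f)) has_real_derivative gr f x) (at x)"
    by (auto intro!: derivative_eq_intros)
  then show ?thesis
  proof (rule has_field_derivative_transform_within_open[of _ _ _ "{x/2<..<1}"])
    show "sol f (x/2) + integral {x/2..y} (gr f) = sol f y" if "y \<in> {x/2<..<1}" for y
      using sol_diff[OF f, of "x/2" y] that x by simp
  qed (use x in auto)
qed

text \<open>Away from 0 the derivative is bounded by a multiple of \<open>nrm f\<close>. This serves
  local absolute continuity, the limit at 1 and the equicontinuity in
  \<open>Kop_compact\<close>.\<close>

lemma sol_lipschitz:
  assumes f: "square_int f" and x: "0 < a" "a \<le> x" "x \<le> y" "y \<le> 1"
  shows "\<bar>sol f y - sol f x\<bar> \<le> 2 * nrm f * a powr (-1 - p) * (y - x)"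
proof -
  have "norm (integral {x..y} (gr f)) \<le> 2 * nrm f * a powr (-1 - p) * (y - x)"
  proof (rule integral_bound[OF x(3)])
    show "continuous_on {x..y} (gr f)"
      by (rule continuous_on_subset[OF continuous_gr[OF f]]) (use x in auto)
    fix s assume s: "s \<in> {x..y}"
    have "s powr (-1 - p) \<le> a powr (-1 - p)"
      using s x p by (intro powr_mono2') auto
    then have "2 * nrm f * s powr (-1 - p) \<le> 2 * nrm f * a powr (-1 - p)" by (intro mult_left_mono) auto
    then show "norm (gr f s) \<le> 2 * nrm f * a powr (-1 - p)"
      using gr_bound[OF f, of s] s x by simp
  qed
  then show ?thesis using sol_diff[OF f, of x y] x by simp
qed

lemma continuous_sol: "square_int f \<Longrightarrow> continuous_on {0<..<1} (sol f)"
  by (rule continuous_at_imp_continuous_on) (metis DERIV_isCont DERIV_sol greaterThanLessThan_iff)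

lemma sol_at_1: "square_int f \<Longrightarrow> (sol f \<longlongrightarrow> 0) (at_left 1)"
proof (rule Lim_null_comparison[of _ "\<lambda>x. 2 * nrm f * (1/2) powr (-1 - p) * (1 - x)"])
  assume f: "square_int f"
  show "\<forall>\<^sub>F x in at_left 1. norm (sol f x) \<le> 2 * nrm f * (1/2) powr (-1 - p) * (1 - x)"
    using eventually_at_left_real[of "1/2" 1]
  proof (rule eventually_mono)
    show "norm (sol f x) \<le> 2 * nrm f * (1/2) powr (-1 - p) * (1 - x)" if "x \<in> {1/2<..<1}" for x
      using sol_lipschitz[OF f, of "1/2" x 1] that by simp
  qed simp
  have "((\<lambda>x. 2 * nrm f * (1/2) powr (-1 - p) * (1 - x)) \<longlongrightarrow> 2 * nrm f * (1/2) powr (-1 - p) * (1 - 1)) (at_left 1)"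
    by (intro tendsto_intros)
  then show "((\<lambda>x. 2 * nrm f * (1/2) powr (-1 - p) * (1 - x)) \<longlongrightarrow> 0) (at_left 1)" by simp
qed

lemma sol_abs_cont:
  assumes f: "square_int f" and ab: "0 < a" "b < 1"
  shows "abs_cont_on a b (sol f)"
  unfolding abs_cont_on_def
proof (intro allI impI)
  fix \<epsilon> :: real assume e: "\<epsilon> > 0"
  define L where "L = 2 * nrm f * a powr (-1 - p) + 1"
  have L: "L > 0" unfolding L_def by (intro add_nonneg_pos mult_nonneg_nonneg) auto
  show "\<exists>\<delta>>0. \<forall>(n::nat) u v. (\<forall>i<n. a \<le> u i \<and> u i \<le> v i \<and> v i \<le> b) \<longrightarrow>
      disjoint_family_on (\<lambda>i. {u i<..<v i}) {..<n} \<longrightarrow>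
      (\<Sum>i<n. v i - u i) < \<delta> \<longrightarrow> (\<Sum>i<n. \<bar>sol f (v i) - sol f (u i)\<bar>) < \<epsilon>"
  proof (intro exI[of _ "\<epsilon> / L"] conjI allI impI)
    show "0 < \<epsilon> / L" using e L by simp
    fix n :: nat and u v
    assume uv: "\<forall>i<n. a \<le> u i \<and> u i \<le> v i \<and> v i \<le> b" and len: "(\<Sum>i<n. v i - u i) < \<epsilon> / L"
    have "(\<Sum>i<n. \<bar>sol f (v i) - sol f (u i)\<bar>) \<le> (\<Sum>i<n. L * (v i - u i))"
    proof (rule sum_mono)
      fix i assume "i \<in> {..<n}"
      then have "a \<le> u i" "u i \<le> v i" "v i \<le> b" using uv by auto
      then have "\<bar>sol f (v i) - sol f (u i)\<bar> \<le> (L - 1) * (v i - u i)"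
        using sol_lipschitz[OF f ab(1), of "u i" "v i"] ab unfolding L_def by simp
      also have "\<dots> \<le> L * (v i - u i)" using \<open>u i \<le> v i\<close> by (intro mult_right_mono) auto
      finally show "\<bar>sol f (v i) - sol f (u i)\<bar> \<le> L * (v i - u i)" .
    qed
    also have "\<dots> = L * (\<Sum>i<n. v i - u i)" by (simp add: sum_distrib_left)
    also have "\<dots> < \<epsilon>" using len L by (simp add: field_simps)
    finally show "(\<Sum>i<n. \<bar>sol f (v i) - sol f (u i)\<bar>) < \<epsilon>" .
  qed
qed

lemma square_int_sol:
  assumes f: "square_int f"
  shows "square_int (sol f)" "nrm (sol f) \<le> 2 / p / sqrt (1 - 2 * p) * nrm f"
proof -
  let ?C = "(2 / p * nrm f)\<^sup>2"
  have bd: "\<bar>(sol f x)\<^sup>2\<bar> \<le> ?C * x powr (- (2 * p))" if "0 < x" "x < 1" for x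
  proof -
    have "\<bar>sol f x\<bar>\<^sup>2 \<le> (2 / p * nrm f * x powr - p)\<^sup>2"
      using sol_bound[OF f that] by (intro power_mono) auto
    also have "\<dots> = ?C * (x powr - p)\<^sup>2" by (simp add: power_mult_distrib power_divide)
    also note powr_sq
    finally show ?thesis by simp
  qed
  have i: "integrable unit_leb (\<lambda>x. (sol f x)\<^sup>2)"
    by (rule integrable_powr_mult[of "- (2 * p)", OF _ _ bd])
      (use p continuous_sol[OF f] in \<open>auto intro!: continuous_intros\<close>)
  show s: "square_int (sol f)"
    unfolding square_int_def using i measurable_unit[OF continuous_sol[OF f]] by simp
  have "(nrm (sol f))\<^sup>2 \<le> (\<integral>x. ?C * x powr (- (2 * p)) \<partial>unit_leb)"
    unfolding norm_abs_L2_sq[OF s]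
  proof (rule integral_mono[OF i])
    show "integrable unit_leb (\<lambda>x. ?C * x powr (- (2 * p)))"
      using p by (intro integrable_mult_right integrable_powr_unit) auto
  qed (use bd in force)
  also have "\<dots> = ?C * (1 / (1 - 2 * p))"
    using integral_powr_unit[of "- (2 * p)"] p by simp
  also have "\<dots> = (2 / p / sqrt (1 - 2 * p) * nrm f)\<^sup>2"
    using p by (simp add: power_mult_distrib power_divide)
  finally show "nrm (sol f) \<le> 2 / p / sqrt (1 - 2 * p) * nrm f"
    by (rule power2_le_imp_le) (use p in auto)
qed

lemma cst_lin:
  assumes "square_int f" "square_int g"
  shows "cst (\<lambda>x. f x + g x) = cst f + cst g" "cst (\<lambda>x. c * f x) = c * cst f"
proof -
  have "(\<integral>s. s powr - \<alpha> * prim (\<lambda>x. f x + g x) s \<partial>unit_leb)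
      = (\<integral>s. s powr - \<alpha> * prim f s \<partial>unit_leb) + (\<integral>s. s powr - \<alpha> * prim g s \<partial>unit_leb)" if "\<alpha> < 1"
    unfolding prim_add[OF assms] distrib_left
    by (rule Bochner_Integration.integral_add) (use that assms integrable_cst in auto)
  then show "cst (\<lambda>x. f x + g x) = cst f + cst g" by (simp add: cst_def distrib_left)
  have "(\<integral>s. s powr - \<alpha> * prim (\<lambda>x. c * f x) s \<partial>unit_leb) = c * (\<integral>s. s powr - \<alpha> * prim f s \<partial>unit_leb)"
    unfolding prim_scale by (simp add: mult.left_commute)
  then show "cst (\<lambda>x. c * f x) = c * cst f" by (simp add: cst_def)
qed

lemma flx_lin:
  assumes "square_int f" "square_int g"
  shows "flx (\<lambda>x. f x + g x) s = flx f s + flx g s" "flx (\<lambda>x. c * f x) s = c * flx f s"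
  unfolding flx_def cst_lin[OF assms] prim_add[OF assms] prim_scale by (auto simp: algebra_simps)

lemma sol_add:
  assumes "square_int f" "square_int g" "0 < x" "x < 1"
  shows "sol (\<lambda>x. f x + g x) x = sol f x + sol g x"
proof -
  have "(\<integral>s. indicator {x<..} s * gr (\<lambda>x. f x + g x) s \<partial>unit_leb)
      = (\<integral>s. indicator {x<..} s * gr f s + indicator {x<..} s * gr g s \<partial>unit_leb)"
    unfolding gr_def flx_lin[OF assms(1,2)] by (simp add: algebra_simps)
  also have "\<dots> = (\<integral>s. indicator {x<..} s * gr f s \<partial>unit_leb) + (\<integral>s. indicator {x<..} s * gr g s \<partial>unit_leb)"
    by (intro Bochner_Integration.integral_add integrable_gr assms)
  finally show ?thesis by (simp add: sol_def)
qed

lemma sol_scale: "square_int f \<Longrightarrow> sol (\<lambda>x. c * f x) x = c * sol f x"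
  unfolding sol_def gr_def using flx_lin(2)[of f f] by (simp add: mult.left_commute)

lemma sol_cong:
  assumes "square_int f" "square_int g" "AE x in unit_leb. f x = g x"
  shows "sol f = sol g" "flx f = flx g"
  using prim_cong[OF assms] by (simp_all add: sol_def[abs_def] gr_def flx_def[abs_def] cst_def)

section \<open>The inverse of P as an operator on L2\<close>

definition Kop :: "L2 \<Rightarrow> L2" where "Kop u = abs_L2 (sol (rep_L2 u))"

lemma Kop_abs: "square_int f \<Longrightarrow> Kop (abs_L2 f) = abs_L2 (sol f)"
  unfolding Kop_def using sol_cong(1)[OF square_int_rep _ rep_abs_L2] by metis

lemma bounded_linear_Kop: "bounded_linear Kop"
proof (rule bounded_linear_intro)
  note s = square_int_rep square_int_sol(1)[OF square_int_rep]
  show "Kop (u + v) = Kop u + Kop v" for u v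
  proof -
    have "Kop (abs_L2 (rep_L2 u) + abs_L2 (rep_L2 v)) = abs_L2 (sol (\<lambda>x. rep_L2 u x + rep_L2 v x))"
      unfolding abs_L2_add[OF s(1) s(1)] by (rule Kop_abs[OF square_int_add[OF s(1) s(1)]])
    also have "\<dots> = abs_L2 (\<lambda>x. sol (rep_L2 u) x + sol (rep_L2 v) x)"
      by (rule abs_L2_eqI) (auto intro!: square_int_sol square_int_add s AE_I2 sol_add)
    also have "\<dots> = Kop u + Kop v" unfolding Kop_def abs_L2_add[OF s(2) s(2)] ..
    finally show ?thesis by simp
  qed
  show "Kop (c *\<^sub>R u) = c *\<^sub>R Kop u" for c u
  proof -
    have "Kop (c *\<^sub>R abs_L2 (rep_L2 u)) = abs_L2 (sol (\<lambda>x. c * rep_L2 u x))"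
      unfolding abs_L2_scaleR[OF s(1)] by (rule Kop_abs[OF square_int_scale[OF s(1)]])
    also have "\<dots> = abs_L2 (\<lambda>x. c * sol (rep_L2 u) x)"
      by (rule arg_cong[of _ _ abs_L2]) (auto simp: sol_scale[OF s(1)])
    also have "\<dots> = c *\<^sub>R Kop u" unfolding Kop_def abs_L2_scaleR[OF s(2)] ..
    finally show ?thesis by simp
  qed
  show "norm (Kop u) \<le> norm u * (2 / p / sqrt (1 - 2 * p))" for u
    using square_int_sol(2)[OF square_int_rep, of u] by (simp add: Kop_def mult.commute)
qed

text \<open>The vanishing integral is the Dirichlet condition at 0: requiring s^(-\<alpha>) (c -
  prim f) to have integral zero determines c, and this is the formula for
  \<open>cst\<close>.\<close>

lemma integrable_gr_weak:
  assumes "square_int f" "\<alpha> < 1"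
  shows "integrable unit_leb (gr f)" "(\<integral>s. gr f s \<partial>unit_leb) = 0"
proof -
  have "continuous_on {0<..<1} (gr f)" by (rule continuous_on_subset[OF continuous_gr[OF assms(1)]]) auto
  then show "integrable unit_leb (gr f)"
    by (rule integrable_powr_mult[of "- \<alpha>" _ "2 * nrm f", rotated]) (use assms gr_le in auto)
  have "(\<integral>s. gr f s \<partial>unit_leb) = (\<integral>s. cst f * s powr - \<alpha> - s powr - \<alpha> * prim f s \<partial>unit_leb)"
    unfolding gr_def flx_def by (simp add: algebra_simps)
  also have "\<dots> = cst f * (\<integral>s. s powr - \<alpha> \<partial>unit_leb) - (\<integral>s. s powr - \<alpha> * prim f s \<partial>unit_leb)"
    using integrable_cst[OF assms] integrable_powr_unit[of "- \<alpha>"] assms(2) by simp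
  also have "\<dots> = 0"
    using integral_powr_unit[of "- \<alpha>"] assms(2) by (simp add: cst_def)
  finally show "(\<integral>s. gr f s \<partial>unit_leb) = 0" .
qed

text \<open>If \<alpha> < 1, both fluxes are bounded and s^(-\<alpha>) is integrable. Otherwise each
  flux is O(sqrt s), and s^(1 - \<alpha>) is integrable because \<alpha> < 2.\<close>

lemma integrable_energy:
  assumes f: "square_int f" and g: "square_int g"
  shows "integrable unit_leb (\<lambda>s. gr f s * flx g s)"
proof (cases "\<alpha> < 1")
  case True
  show ?thesis
  proof (rule integrable_powr_mult[of "- \<alpha>" _ "2 * nrm f * (2 * nrm g)"])
    show "\<bar>gr f s * flx g s\<bar> \<le> 2 * nrm f * (2 * nrm g) * s powr - \<alpha>" if "0 < s" "s < 1" for s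
    proof -
      have "\<bar>gr f s\<bar> * \<bar>flx g s\<bar> \<le> (2 * nrm f * s powr - \<alpha>) * (2 * nrm g)"
        using gr_le[OF f, of s] flx_le[OF g, of s] that by (intro mult_mono) auto
      then show ?thesis by (simp add: abs_mult mult_ac)
    qed
  qed (use True in \<open>auto intro!: continuous_intros continuous_on_subset[OF continuous_gr[OF f]] continuous_on_subset[OF continuous_flx[OF g]]\<close>)
next
  case False
  show ?thesis
  proof (rule integrable_powr_mult[of "1 - \<alpha>" _ "nrm f * nrm g"])
    show "\<bar>gr f s * flx g s\<bar> \<le> nrm f * nrm g * s powr (1 - \<alpha>)" if "0 < s" "s < 1" for s
    proof -
      have "\<bar>flx f s\<bar> * \<bar>flx g s\<bar> \<le> (sqrt s * nrm f) * (sqrt s * nrm g)"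
        using prim_le[OF f, of s] prim_le[OF g, of s] that False
        by (intro mult_mono) (auto simp: flx_def cst_def)
      also have "\<dots> = s * (nrm f * nrm g)" using that by (simp add: algebra_simps)
      finally have "s powr - \<alpha> * (\<bar>flx f s\<bar> * \<bar>flx g s\<bar>) \<le> s powr - \<alpha> * (s * (nrm f * nrm g))"
        by (rule mult_left_mono) simp
      also have "\<dots> = nrm f * nrm g * s powr (1 - \<alpha>)"
        using that by (simp add: powr_diff powr_minus field_simps)
      finally show ?thesis by (simp add: gr_def abs_mult mult_ac)
    qed
  qed (use \<alpha> in \<open>auto intro!: continuous_intros continuous_on_subset[OF continuous_gr[OF f]] continuous_on_subset[OF continuous_flx[OF g]]\<close>)
qed

text \<open>Integration by parts, done as an exchange of integrals over the triangle \<open>x < s\<close>; the boundary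
  term vanishes because \<open>cst\<close> encodes the boundary condition at \<open>0\<close>.\<close>

lemma energy_identity:
  assumes f: "square_int f" and g: "square_int g"
  shows "(\<integral>x. sol f x * g x \<partial>unit_leb) = (\<integral>s. gr f s * flx g s \<partial>unit_leb)"
proof -
  interpret pair_sigma_finite unit_leb unit_leb
    by (intro pair_sigma_finite.intro finite_measure.axioms(1) finite_measure_unit_leb)
  let ?h = "\<lambda>x s. indicator {x<..} s * gr f s * g x :: real"
  have gm [measurable]: "g \<in> borel_measurable unit_leb" using g by (simp add: square_int_def)
  have fm [measurable]: "gr f \<in> borel_measurable unit_leb"
    by (rule measurable_unit, rule continuous_on_subset[OF continuous_gr[OF f]]) auto
  have idm [measurable]: "(\<lambda>x. x) \<in> borel_measurable unit_leb" by (rule measurable_unit) (rule continuous_on_id)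
  have ind: "indicator {x<..} s = (if x < s then 1 else 0 :: real)" for x s :: real by (simp add: indicator_def)
  have m: "case_prod ?h \<in> borel_measurable (unit_leb \<Otimes>\<^sub>M unit_leb)"
    unfolding ind by measurable
  have int: "integrable (unit_leb \<Otimes>\<^sub>M unit_leb) (case_prod ?h)"
  proof (rule Fubini_integrable[OF m])
    \<comment> \<open>For Fubini, the inner integral is at most a constant times |g x| x^(-p), a
      product of two square integrable functions.\<close>
    have b: "\<bar>\<integral>s. norm (?h x s) \<partial>unit_leb\<bar> \<le> \<bar>g x * (2 / p * nrm f * x powr - p)\<bar>" if "x \<in> {0<..<1}" for x
    proof -
      have "(\<integral>s. norm (?h x s) \<partial>unit_leb) = (\<integral>s. \<bar>g x\<bar> * \<bar>indicator {x<..} s * gr f s\<bar> \<partial>unit_leb)"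
        by (rule Bochner_Integration.integral_cong) (auto simp: abs_mult)
      also have "\<dots> \<le> (\<integral>s. \<bar>g x\<bar> * (2 * nrm f * (indicator {x<..} s * s powr (-1 - p))) \<partial>unit_leb)"
      proof (rule integral_mono)
        show "integrable unit_leb (\<lambda>s. \<bar>g x\<bar> * \<bar>indicator {x<..} s * gr f s\<bar>)"
          using integrable_gr[OF f, of x] that by (auto simp: ind intro!: integrable_mult_right integrable_abs)
        show "integrable unit_leb (\<lambda>s. \<bar>g x\<bar> * (2 * nrm f * (indicator {x<..} s * s powr (-1 - p))))"
          using that by (intro integrable_mult_right integrable_tail) auto
        show "\<bar>g x\<bar> * \<bar>indicator {x<..} s * gr f s\<bar> \<le> \<bar>g x\<bar> * (2 * nrm f * (indicator {x<..} s * s powr (-1 - p)))"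
          if "s \<in> space unit_leb" for s
          using gr_bound[OF f, of s] that by (intro mult_left_mono) (auto simp: indicator_def)
      qed
      also have "\<dots> = \<bar>g x\<bar> * (2 * nrm f * (\<integral>s. indicator {x<..} s * s powr (-1 - p) \<partial>unit_leb))" by simp
      also have "\<dots> \<le> \<bar>g x\<bar> * (2 * nrm f * (x powr - p / p))"
        using that by (intro mult_left_mono integral_tail) auto
      also have "\<dots> = \<bar>g x * (2 / p * nrm f * x powr - p)\<bar>" using p by (simp add: abs_mult)
      finally show ?thesis by simp
    qed
    have sp: "square_int (\<lambda>x. 2 / p * nrm f * x powr - p)"
      unfolding square_int_def
    proof
      have "continuous_on {0<..<1} (\<lambda>x. 2 / p * nrm f * x powr - p)" by (auto intro!: continuous_intros simp: p0)
      then show "(\<lambda>x. 2 / p * nrm f * x powr - p) \<in> borel_measurable unit_leb" by (rule measurable_unit)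
      have "(2 / p * nrm f * x powr - p)\<^sup>2 = (2 / p * nrm f)\<^sup>2 * x powr (- (2 * p))" for x
        by (simp add: power_mult_distrib power_divide powr_sq)
      then show "integrable unit_leb (\<lambda>x. (2 / p * nrm f * x powr - p)\<^sup>2)"
        using integrable_powr_unit[of "- (2 * p)"] p by simp
    qed
    show "integrable unit_leb (\<lambda>x. \<integral>s. norm (case_prod ?h (x, s)) \<partial>unit_leb)"
    proof (rule Bochner_Integration.integrable_bound[OF square_int_prod[OF g sp]])
      show "(\<lambda>x. \<integral>s. norm (case_prod ?h (x, s)) \<partial>unit_leb) \<in> borel_measurable unit_leb"
        using m by measurable
      show "AE x in unit_leb. norm (\<integral>s. norm (case_prod ?h (x, s)) \<partial>unit_leb) \<le> norm (g x * (2 / p * nrm f * x powr - p))"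
        using b by (intro AE_I2) auto
    qed
    show "AE x in unit_leb. integrable unit_leb (\<lambda>s. case_prod ?h (x, s))"
      using integrable_gr[OF f] by (intro AE_I2) (auto intro!: integrable_mult_left)
  qed
  have "(\<integral>x. sol f x * g x \<partial>unit_leb) = - (\<integral>x. (\<integral>s. ?h x s \<partial>unit_leb) \<partial>unit_leb)"
    by (simp add: sol_def)
  also have "(\<integral>x. (\<integral>s. ?h x s \<partial>unit_leb) \<partial>unit_leb) = (\<integral>s. (\<integral>x. ?h x s \<partial>unit_leb) \<partial>unit_leb)"
    using Fubini_integral[OF int] by simp
  also have "\<dots> = (\<integral>s. gr f s * prim g s \<partial>unit_leb)"
  proof (rule Bochner_Integration.integral_cong[OF refl])
    fix s :: real
    have "(\<integral>x. ?h x s \<partial>unit_leb) = (\<integral>x. gr f s * (indicator {..<s} x * g x) \<partial>unit_leb)"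
      by (rule Bochner_Integration.integral_cong) (auto simp: indicator_def)
    then show "(\<integral>x. ?h x s \<partial>unit_leb) = gr f s * prim g s" by (simp add: prim_def)
  qed
  also have "- (\<integral>s. gr f s * prim g s \<partial>unit_leb) = (\<integral>s. gr f s * flx g s \<partial>unit_leb)"
  proof (cases "\<alpha> < 1")
    case True
    have "(\<integral>s. gr f s * prim g s \<partial>unit_leb) = (\<integral>s. cst g * gr f s - gr f s * flx g s \<partial>unit_leb)"
      by (simp add: flx_def algebra_simps)
    also have "\<dots> = cst g * (\<integral>s. gr f s \<partial>unit_leb) - (\<integral>s. gr f s * flx g s \<partial>unit_leb)"
      using integrable_gr_weak(1)[OF f True] integrable_energy[OF f g] by simp
    finally show ?thesis using integrable_gr_weak(2)[OF f True] by simp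
  next
    case False
    then show ?thesis by (simp add: flx_def cst_def)
  qed
  finally show ?thesis .
qed

lemma Kop_inner: "Kop u \<bullet> v = (\<integral>s. gr (rep_L2 u) s * flx (rep_L2 v) s \<partial>unit_leb)"
proof -
  have "Kop u \<bullet> abs_L2 (rep_L2 v) = (\<integral>x. sol (rep_L2 u) x * rep_L2 v x \<partial>unit_leb)"
    unfolding Kop_def by (rule inner_abs_L2[OF square_int_sol(1)[OF square_int_rep] square_int_rep])
  then show ?thesis using energy_identity[OF square_int_rep square_int_rep] by simp
qed

lemma Kop_sym: "Kop u \<bullet> v = u \<bullet> Kop v"
proof -
  have "Kop u \<bullet> v = Kop v \<bullet> u"
    unfolding Kop_inner by (rule Bochner_Integration.integral_cong) (auto simp: gr_def)
  then show ?thesis by (simp add: inner_commute)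
qed

lemma Kop_pos: "0 \<le> Kop u \<bullet> u"
  unfolding Kop_inner by (rule Bochner_Integration.integral_nonneg) (auto simp: gr_def mult.assoc)

text \<open>Zero energy makes the flux vanish almost everywhere, hence everywhere by continuity;
  then \<open>prim\<close> is constant and its derivative, the function itself, is zero almost
  everywhere.\<close>

lemma Kop_inj:
  assumes "Kop u = 0" shows "u = 0"
proof -
  let ?f = "rep_L2 u"
  note f = square_int_rep[of u]
  have "(\<integral>s. gr ?f s * flx ?f s \<partial>unit_leb) = 0"
    using assms Kop_inner[of u u] by simp
  then have "AE s in unit_leb. gr ?f s * flx ?f s = 0"
    using integrable_energy[OF f f]
    by (subst (asm) integral_nonneg_eq_0_iff_AE) (auto simp: gr_def mult.assoc)
  then obtain N where N: "negligible N" "\<And>s. 0 < s \<Longrightarrow> s < 1 \<Longrightarrow> s \<notin> N \<Longrightarrow> gr ?f s * flx ?f s = 0"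
    by (rule AE_unit_obtain) blast
  have z: "flx ?f s = 0" if s: "0 < s" "s < 1" for s
  proof (rule ccontr)
    assume "flx ?f s \<noteq> 0"
    define U where "U = {0<..<1} \<inter> flx ?f -` (- {0})"
    have "open U"
      unfolding U_def
      by (rule continuous_open_preimage) (auto intro!: continuous_on_subset[OF continuous_flx[OF f]])
    moreover have "U \<noteq> {}" using s \<open>flx ?f s \<noteq> 0\<close> by (auto simp: U_def)
    moreover have "U \<subseteq> N" using N(2) by (fastforce simp: U_def gr_def)
    ultimately show False
      using N(1) open_not_negligible negligible_subset by blast
  qed
  obtain N' where N': "negligible N'" "\<And>x. 0 < x \<Longrightarrow> x < 1 \<Longrightarrow> x \<notin> N' \<Longrightarrow> (prim ?f has_real_derivative ?f x) (at x)"
    using DERIV_prim[OF f] by blast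
  have "?f x = 0" if x: "0 < x" "x < 1" "x \<notin> N'" for x
  proof -
    have "((\<lambda>_. cst ?f) has_real_derivative ?f x) (at x)"
      using N'(2)[OF x]
    proof (rule has_field_derivative_transform_within_open[of _ _ _ "{0<..<1}"])
      show "prim ?f y = cst ?f" if "y \<in> {0<..<1}" for y
        using z[of y] that by (simp add: flx_def)
    qed (use x in auto)
    then show ?thesis by (rule DERIV_unique[OF _ DERIV_const])
  qed
  then have "AE x in unit_leb. ?f x = 0" by (rule AE_unit_negligible[OF N'(1)])
  then have "abs_L2 ?f = abs_L2 (\<lambda>x. 0)" by (intro abs_L2_eqI f square_int_zero)
  then show "u = 0" by (simp add: zero_L2.abs_eq[symmetric] zero_L2_def[symmetric])
qed

end

section \<open>The graph of \<open>\<P>\<close>\<close>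

lemma square_int_AE:
  assumes f: "square_int f" and N: "negligible N" "\<And>x. 0 < x \<Longrightarrow> x < 1 \<Longrightarrow> x \<notin> N \<Longrightarrow> g x = f x"
  shows "square_int g"
proof -
  have "g absolutely_integrable_on {0<..<1}"
    by (rule absolutely_integrable_spike[OF _ N(1)])
      (use square_int_integrable[OF f] N(2) in \<open>auto simp: integrable_unit_iff\<close>)
  then have "integrable unit_leb g" by (simp add: integrable_unit_iff)
  moreover have "(\<lambda>x. (g x)\<^sup>2) absolutely_integrable_on {0<..<1}"
    by (rule absolutely_integrable_spike[where f = "\<lambda>x. (f x)\<^sup>2", OF _ N(1)])
      (use f N(2) in \<open>auto simp: integrable_unit_iff square_int_def\<close>)
  ultimately show ?thesis unfolding square_int_def integrable_unit_iff[symmetric] by auto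
qed

lemma constant_on_unit:
  fixes E :: "real \<Rightarrow> real"
  assumes "\<And>x y. 0 < x \<Longrightarrow> x < y \<Longrightarrow> y < 1 \<Longrightarrow> E y = E x" "0 < x" "x < 1" "0 < y" "y < 1"
  shows "E x = E y"
  using assms(1)[of x y] assms(1)[of y x] assms(2-) by (cases x y rule: linorder_cases) auto

context degenerate
begin

text \<open>The images are Lipschitz on [a,1] uniformly in n and bounded by a multiple of x^(-p). A
  diagonal subsequence converges at the rationals, equicontinuity extends this to all of (0,1), and
  dominated convergence upgrades it to convergence in L2.\<close>

lemma Kop_compact:
  assumes u: "\<And>n. norm (u n) \<le> 1"
  shows "\<exists>r l. strict_mono (r :: nat \<Rightarrow> nat) \<and> (\<lambda>n. Kop (u (r n))) \<longlonglongrightarrow> l"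
proof -
  define \<theta> where "\<theta> n = sol (rep_L2 (u n))" for n
  have f: "square_int (rep_L2 (u n))" for n by (rule square_int_rep)
  have nf: "nrm (rep_L2 (u n)) \<le> 1" for n using u by simp
  have bd: "\<bar>\<theta> n x\<bar> \<le> 2 / p * x powr - p" if "0 < x" "x < 1" for n x
  proof -
    have "2 / p * nrm (rep_L2 (u n)) * x powr - p \<le> 2 / p * 1 * x powr - p"
      using nf p by (intro mult_right_mono mult_left_mono) auto
    then show ?thesis using sol_bound[OF f that, of n] unfolding \<theta>_def by simp
  qed
  have lip: "\<bar>\<theta> n y - \<theta> n x\<bar> \<le> 2 * a powr (-1 - p) * \<bar>y - x\<bar>"
    if "0 < a" "a \<le> x" "a \<le> y" "x \<le> 1" "y \<le> 1" for n a x y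
  proof -
    have *: "\<bar>\<theta> n y - \<theta> n x\<bar> \<le> 2 * a powr (-1 - p) * (y - x)" if "a \<le> x" "x \<le> y" "y \<le> 1" for x y
    proof -
      have "2 * nrm (rep_L2 (u n)) * a powr (-1 - p) * (y - x) \<le> 2 * 1 * a powr (-1 - p) * (y - x)"
        using nf that by (intro mult_right_mono mult_left_mono) auto
      then show ?thesis using sol_lipschitz[OF f \<open>0 < a\<close> that, of n] unfolding \<theta>_def by simp
    qed
    show ?thesis using *[of x y] *[of y x] that by (cases "x \<le> y") (auto simp: abs_minus_commute)
  qed
  \<comment> \<open>The factor x^p makes the values uniformly bounded, as the diagonal argument
    demands.\<close>
  obtain k where k: "strict_mono (k :: nat \<Rightarrow> nat)"
    and kc: "\<And>x. x \<in> {0<..<1} \<inter> \<rat> \<Longrightarrow> \<exists>l. (\<lambda>n. \<theta> (k n) x * x powr p) \<longlonglongrightarrow> l"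
  proof (rule function_convergent_subsequence[of "{0<..<1} \<inter> \<rat>" "\<lambda>n x. \<theta> n x * x powr p" "2 / p"])
    show "countable ({0<..<1} \<inter> \<rat> :: real set)" by (rule countable_subset[OF _ countable_rat]) auto
    show "norm (\<theta> n x * x powr p) \<le> 2 / p" if "x \<in> {0<..<1} \<inter> \<rat>" for n x
    proof -
      have "\<bar>\<theta> n x\<bar> * x powr p \<le> 2 / p * x powr - p * x powr p"
        using bd[of x n] that by (intro mult_right_mono) auto
      also have "\<dots> = 2 / p" using that by (simp add: powr_minus)
      finally show ?thesis by (simp add: abs_mult)
    qed
  qed blast
  have conv: "convergent (\<lambda>n. \<theta> (k n) x)" if x: "0 < x" "x < 1" for x
  proof (rule Cauchy_convergent, rule metric_CauchyI)
    fix e :: real assume e: "e > 0"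
    \<comment> \<open>A Lipschitz constant on [x/2, 1]; the rational \<open>r\<close> is taken so
      close to \<open>x\<close> that the values there differ by less than e/3.\<close>
    define M where "M = 2 * (x/2) powr (-1 - p)"
    have M: "M > 0" using x by (simp add: M_def)
    have "x < min 1 (x + e / (3 * M))" using x e M by simp
    then obtain r where r: "r \<in> \<rat>" "x < r" "r < min 1 (x + e / (3 * M))" using Rats_dense_in_real by blast
    obtain l where l: "(\<lambda>n. \<theta> (k n) r * r powr p) \<longlonglongrightarrow> l" using kc[of r] r x by auto
    have "(\<lambda>n. \<theta> (k n) r * r powr p * r powr - p) \<longlonglongrightarrow> l * r powr - p" by (intro tendsto_intros l)
    moreover have "\<theta> (k n) r * r powr p * r powr - p = \<theta> (k n) r" for n
      using r x by (simp add: powr_minus)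
    ultimately have "Cauchy (\<lambda>n. \<theta> (k n) r)" by (auto intro: LIMSEQ_imp_Cauchy)
    then obtain N where N: "\<And>m n. m \<ge> N \<Longrightarrow> n \<ge> N \<Longrightarrow> dist (\<theta> (k m) r) (\<theta> (k n) r) < e / 3"
      using e unfolding Cauchy_def by (metis divide_pos_pos zero_less_numeral)
    have near: "\<bar>\<theta> n r - \<theta> n x\<bar> < e / 3" for n
    proof -
      have "\<bar>\<theta> n r - \<theta> n x\<bar> \<le> M * \<bar>r - x\<bar>" unfolding M_def by (rule lip) (use r x in auto)
      also have "\<dots> < M * (e / (3 * M))" using r M by (intro mult_strict_left_mono) auto
      finally show ?thesis using M by simp
    qed
    have "dist (\<theta> (k m) x) (\<theta> (k n) x) < e" if "m \<ge> N" "n \<ge> N" for m n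
      using N[OF that] near[of "k m"] near[of "k n"] unfolding dist_real_def by linarith
    then show "\<exists>M. \<forall>m\<ge>M. \<forall>n\<ge>M. dist (\<theta> (k m) x) (\<theta> (k n) x) < e" by blast
  qed
  define L where "L x = lim (\<lambda>n. \<theta> (k n) x)" for x
  have L: "(\<lambda>n. \<theta> (k n) x) \<longlonglongrightarrow> L x" if "0 < x" "x < 1" for x
    unfolding L_def using conv[OF that] by (simp add: convergent_LIMSEQ_iff)
  have Lb: "\<bar>L x\<bar> \<le> 2 / p * x powr - p" if "0 < x" "x < 1" for x
    by (rule LIMSEQ_le_const2[OF tendsto_rabs[OF L[OF that]]]) (use bd[OF that] in auto)
  have s\<theta>: "square_int (\<theta> n)" for n unfolding \<theta>_def by (rule square_int_sol(1)[OF f])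
  then have [measurable]: "\<theta> n \<in> borel_measurable unit_leb" for n by (simp add: square_int_def)
  have [measurable]: "L \<in> borel_measurable unit_leb"
    unfolding L_def by (rule borel_measurable_lim_metric) measurable
  let ?w = "\<lambda>x. (4 / p)\<^sup>2 * x powr (- (2 * p))"
  have iw: "integrable unit_leb ?w" using p by (intro integrable_mult_right integrable_powr_unit) auto
  have sq: "(2 / p * x powr - p)\<^sup>2 \<le> ?w x" "(2 * (2 / p * x powr - p))\<^sup>2 \<le> ?w x" for x
    by (simp_all add: power_mult_distrib power_divide powr_sq divide_right_mono mult_right_mono)
  have L2: "(L x)\<^sup>2 \<le> ?w x" if "0 < x" "x < 1" for x
  proof -
    have "\<bar>L x\<bar>\<^sup>2 \<le> (2 / p * x powr - p)\<^sup>2" using Lb[OF that] by (intro power_mono) auto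
    then show ?thesis using sq(1)[of x] by simp
  qed
  have sL: "square_int L"
    unfolding square_int_def
    by (intro conjI Bochner_Integration.integrable_bound[OF iw]) (measurable, use L2 in \<open>auto intro!: AE_I2\<close>)
  have "(\<lambda>n. \<integral>x. (\<theta> (k n) x - L x)\<^sup>2 \<partial>unit_leb) \<longlonglongrightarrow> (\<integral>x. 0 \<partial>unit_leb)"
  proof (rule integral_dominated_convergence[OF _ _ iw])
    show "AE x in unit_leb. (\<lambda>n. (\<theta> (k n) x - L x)\<^sup>2) \<longlonglongrightarrow> 0"
    proof (rule AE_I2)
      fix x assume "x \<in> space unit_leb"
      then have "(\<lambda>n. (\<theta> (k n) x - L x)\<^sup>2) \<longlonglongrightarrow> (L x - L x)\<^sup>2" by (intro tendsto_intros L) auto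
      then show "(\<lambda>n. (\<theta> (k n) x - L x)\<^sup>2) \<longlonglongrightarrow> 0" by simp
    qed
    show "AE x in unit_leb. norm ((\<theta> (k n) x - L x)\<^sup>2) \<le> ?w x" for n
    proof (rule AE_I2)
      fix x assume "x \<in> space unit_leb"
      then have "\<bar>\<theta> (k n) x - L x\<bar> \<le> 2 * (2 / p * x powr - p)" using bd[of x "k n"] Lb[of x] by auto
      then have "\<bar>\<theta> (k n) x - L x\<bar>\<^sup>2 \<le> (2 * (2 / p * x powr - p))\<^sup>2" by (rule power_mono) simp
      then show "norm ((\<theta> (k n) x - L x)\<^sup>2) \<le> ?w x" using sq(2)[of x] by simp
    qed
  qed measurable
  then have "(\<lambda>n. (norm (Kop (u (k n)) - abs_L2 L))\<^sup>2) \<longlonglongrightarrow> 0"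
    unfolding Kop_def \<theta>_def[symmetric] abs_L2_diff[OF s\<theta> sL] norm_abs_L2_sq[OF square_int_diff[OF s\<theta> sL]] by simp
  from tendsto_real_sqrt[OF this] have "(\<lambda>n. norm (Kop (u (k n)) - abs_L2 L)) \<longlonglongrightarrow> 0" by simp
  then have "(\<lambda>n. Kop (u (k n))) \<longlonglongrightarrow> abs_L2 L" by (simp add: tendsto_norm_zero_iff LIM_zero_iff)
  then show ?thesis using k by blast
qed

section \<open>Boundary values and the description of the graph\<close>

lemma flx_at_0: "square_int f \<Longrightarrow> (flx f \<longlongrightarrow> cst f) (at_right 0)"
proof -
  assume f: "square_int f"
  have "(flx f \<longlongrightarrow> flx f 0) (at 0 within {0..1})"
    using continuous_flx[OF f] by (simp add: continuous_on_def)
  then show ?thesis by (simp add: flx_def at_within_Icc_at_right)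
qed

lemma powr_at_0:
  assumes "\<alpha> < 1" shows "((\<lambda>x. x powr (1 - \<alpha>)) \<longlongrightarrow> 0) (at_right 0)"
proof -
  have "((\<lambda>x. x powr (1 - \<alpha>)) \<longlongrightarrow> 0 powr (1 - \<alpha>)) (at_right 0)"
    by (rule tendsto_powr') (use assms in \<open>auto intro!: tendsto_intros eventually_at_right_less[THEN eventually_mono]\<close>)
  then show ?thesis by simp
qed

text \<open>As \<open>gr f\<close> has integral zero, its integral over (x,1) is minus the one over
  (0,x], which is of order x^(1 - \<alpha>).\<close>

lemma sol_at_0:
  assumes f: "square_int f" and "\<alpha> < 1"
  shows "(sol f \<longlongrightarrow> 0) (at_right 0)"
proof (rule Lim_null_comparison[of _ "\<lambda>x. 2 * nrm f * (x powr (1 - \<alpha>) / (1 - \<alpha>))"])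
  note g = integrable_gr_weak[OF assms]
  have le: "\<bar>sol f x\<bar> \<le> 2 * nrm f * (x powr (1 - \<alpha>) / (1 - \<alpha>))" if x: "0 < x" "x < 1" for x
  proof -
    have i: "integrable unit_leb (\<lambda>s. indicator {..x} s * gr f s)" by (rule integrable_indicator_unit[OF _ g(1)]) simp
    have iP: "integrable unit_leb (\<lambda>s. indicator {..x} s * s powr - \<alpha>)"
      by (rule integrable_indicator_unit) (use assms integrable_powr_unit[of "- \<alpha>"] in auto)
    have "(\<integral>s. indicator {x<..} s * gr f s \<partial>unit_leb) = (\<integral>s. gr f s - indicator {..x} s * gr f s \<partial>unit_leb)"
      by (rule Bochner_Integration.integral_cong) (auto simp: indicator_def)
    also have "\<dots> = - (\<integral>s. indicator {..x} s * gr f s \<partial>unit_leb)" using i g by simp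
    finally have "\<bar>sol f x\<bar> \<le> (\<integral>s. \<bar>indicator {..x} s * gr f s\<bar> \<partial>unit_leb)" by (simp add: sol_def)
    also have "\<dots> \<le> (\<integral>s. 2 * nrm f * (indicator {..x} s * s powr - \<alpha>) \<partial>unit_leb)"
      by (rule integral_mono) (use i iP gr_le[OF f] in \<open>auto simp: indicator_def\<close>)
    also have "\<dots> = 2 * nrm f * (\<integral>s. indicator {..x} s * s powr - \<alpha> \<partial>unit_leb)" by simp
    also have "(\<integral>s. indicator {..x} s * s powr - \<alpha> \<partial>unit_leb) = integral {0..x} (\<lambda>s. s powr - \<alpha>)"
      by (rule integral_unit_indicator[OF _ _ iP]) (use x in auto)
    also have "\<dots> = x powr (1 - \<alpha>) / (1 - \<alpha>)"
      using has_integral_powr_from_0[of "- \<alpha>" x] assms(2) x by (simp add: integral_unique)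
    finally show ?thesis .
  qed
  show "\<forall>\<^sub>F x in at_right 0. norm (sol f x) \<le> 2 * nrm f * (x powr (1 - \<alpha>) / (1 - \<alpha>))"
    using eventually_at_right_real[of 0 "1::real"] by (rule eventually_mono) (use le in auto)
  have "((\<lambda>x. 2 * nrm f * (x powr (1 - \<alpha>) / (1 - \<alpha>))) \<longlongrightarrow> 2 * nrm f * (0 / (1 - \<alpha>))) (at_right 0)"
    using assms(2) by (intro tendsto_intros powr_at_0) auto
  then show "((\<lambda>x. 2 * nrm f * (x powr (1 - \<alpha>) / (1 - \<alpha>))) \<longlongrightarrow> 0) (at_right 0)" by simp
qed

lemma P_graph_sol:
  assumes f: "square_int f" shows "(abs_L2 (sol f), abs_L2 f) \<in> P_graph \<alpha>"
proof -
  obtain N where N: "negligible N" "\<And>x. 0 < x \<Longrightarrow> x < 1 \<Longrightarrow> x \<notin> N \<Longrightarrow> (prim f has_real_derivative f x) (at x)"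
    using DERIV_prim[OF f] by blast
  have dq: "deriv (flx f) x = - f x" if "0 < x" "x < 1" "x \<notin> N" for x
  proof (rule DERIV_imp_deriv)
    show "(flx f has_real_derivative - f x) (at x)"
      unfolding flx_def[abs_def] using N(2)[OF that] by (auto intro!: derivative_eq_intros)
  qed
  have ds: "deriv (sol f) x = gr f x" if "0 < x" "x < 1" for x
    by (rule DERIV_imp_deriv[OF DERIV_sol[OF f that]])
  have sq: "square_int (deriv (flx f))"
    by (rule square_int_AE[OF square_int_uminus[OF f] N(1) dq])
  have "abs_L2 (\<lambda>x. - deriv (flx f) x) = abs_L2 f"
    by (rule abs_L2_eqI[OF square_int_uminus[OF sq] f AE_unit_negligible[OF N(1)]]) (simp add: dq)
  moreover have "sol f \<in> H_space \<alpha>"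
    unfolding H_space_def
  proof (intro CollectI conjI)
    show "square_int (sol f)" by (rule square_int_sol(1)[OF f])
    show "loc_abs_cont (sol f)" unfolding loc_abs_cont_def using sol_abs_cont[OF f] by blast
    show "(sol f \<longlongrightarrow> 0) (at_left 1)" by (rule sol_at_1[OF f])
    have "integrable unit_leb (\<lambda>x. x powr \<alpha> * \<bar>deriv (sol f) x\<bar>\<^sup>2) = integrable unit_leb (\<lambda>s. gr f s * flx f s)"
      by (rule Bochner_Integration.integrable_cong)
        (auto simp: ds gr_def power2_eq_square powr_minus field_simps)
    then show "integrable unit_leb (\<lambda>x. x powr \<alpha> * \<bar>deriv (sol f) x\<bar>\<^sup>2)" using integrable_energy[OF f f] by simp
  qed
  moreover have "is_flux \<alpha> (sol f) (flx f)"
    unfolding is_flux_def loc_abs_cont_def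
  proof (intro conjI allI impI)
    fix a b :: real assume ab: "0 < a" "a < b" "b < 1"
    show "abs_cont_on a b (flx f)"
      using prim_abs_cont[OF f ab(1,3)] unfolding abs_cont_on_def flx_def
      by (simp add: abs_minus_commute)
  next
    show "AE x in unit_leb. flx f x = x powr \<alpha> * deriv (sol f) x"
      by (rule AE_I2) (auto simp: ds gr_def powr_minus)
  qed
  moreover have "BC \<alpha> (sol f) (flx f)"
    unfolding BC_def using sol_at_0[OF f] flx_at_0[OF f] by (auto simp: cst_def)
  ultimately show ?thesis unfolding P_graph_def using sq by force
qed

text \<open>Both \<open>q\<close> and \<theta> are integrals of their derivatives, so q = c - prim f
  and the derivative of \<theta> - sol f is k s^(-\<alpha>) with k = c - cst f. The condition at 0,
  combined with the values at 1 if \<alpha> < 1, gives k = 0; the value at 1 then removes the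
  additive constant.\<close>

lemma P_graph_unique:
  assumes \<theta>: "\<theta> \<in> H_space \<alpha>" and fl: "is_flux \<alpha> \<theta> q" and sq: "square_int (deriv q)" and bc: "BC \<alpha> \<theta> q"
    and x: "0 < x" "x < 1"
  shows "\<theta> x = sol (\<lambda>x. - deriv q x) x"
proof -
  let ?f = "\<lambda>x. - deriv q x"
  note f = square_int_uminus[OF sq]
  have lac: "loc_abs_cont q" "loc_abs_cont \<theta>" using fl \<theta> by (auto simp: is_flux_def H_space_def)
  have repr: "F y - F x = integral {x..y} (deriv F)"
    if F: "loc_abs_cont F" and xy: "0 < x" "x < y" "y < 1" for F x y
  proof -
    have ac: "abs_cont_on x y F" using F xy unfolding loc_abs_cont_def by blast
    obtain h N where h: "\<And>x' y'. x \<le> x' \<Longrightarrow> x' \<le> y' \<Longrightarrow> y' \<le> y \<Longrightarrow> F y' - F x' = integral {x'..y'} h"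
      "negligible N" "\<And>s. x < s \<Longrightarrow> s < y \<Longrightarrow> s \<notin> N \<Longrightarrow> (F has_real_derivative h s) (at s)"
      using abs_cont_on_integral[OF ac xy(2)] by metis
    have "integral {x..y} h = integral {x..y} (deriv F)"
      by (rule integral_spike[of "N \<union> {x, y}"]) (use h in \<open>auto simp: DERIV_imp_deriv\<close>)
    then show ?thesis using h(1)[of x y] xy by auto
  qed
  define c where "c = q (1/2) + prim ?f (1/2)"
  have q: "q s = c - prim ?f s" if s: "0 < s" "s < 1" for s
  proof -
    have "q y + prim ?f y = q x + prim ?f x" if "0 < x" "x < y" "y < 1" for x y
      using repr[OF lac(1) that] prim_diff(2)[OF f, of x y] that by (auto simp: integral_neg)
    from constant_on_unit[of "\<lambda>s. q s + prim ?f s", OF this s, of "1/2"] show ?thesis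
      by (simp add: c_def)
  qed
  have "AE x in unit_leb. q x = x powr \<alpha> * deriv \<theta> x" using fl by (simp add: is_flux_def)
  then obtain N where N: "negligible N" "\<And>x. 0 < x \<Longrightarrow> x < 1 \<Longrightarrow> x \<notin> N \<Longrightarrow> q x = x powr \<alpha> * deriv \<theta> x"
    by (rule AE_unit_obtain) blast
  define k where "k = c - cst ?f"
  have gi: "gr ?f integrable_on {x..y}" if "0 < x" "y < 1" for x y
    by (rule integrable_continuous_real, rule continuous_on_subset[OF continuous_gr[OF f]]) (use that in auto)
  have pi: "(\<lambda>s. s powr - \<alpha>) integrable_on {x..y}" if "0 < x" for x y
    by (rule integrable_continuous_real) (use that in \<open>auto intro!: continuous_intros\<close>)
  have D: "(\<theta> y - sol ?f y) - (\<theta> x - sol ?f x) = k * integral {x..y} (\<lambda>s. s powr - \<alpha>)" if xy: "0 < x" "x < y" "y < 1" for x y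
  proof -
    have "\<theta> y - \<theta> x = integral {x..y} (deriv \<theta>)" by (rule repr[OF lac(2) xy])
    also have "\<dots> = integral {x..y} (\<lambda>s. k * s powr - \<alpha> + gr ?f s)"
    proof (rule integral_spike[OF N(1)])
      fix s assume s: "s \<in> {x..y} - N"
      then have "c - prim ?f s = s powr \<alpha> * deriv \<theta> s" using N(2)[of s] q[of s] xy by auto
      then show "k * s powr - \<alpha> + gr ?f s = deriv \<theta> s"
        using s xy by (simp add: k_def gr_def flx_def powr_minus field_simps)
    qed
    also have "\<dots> = k * integral {x..y} (\<lambda>s. s powr - \<alpha>) + integral {x..y} (gr ?f)"
      using gi[of x y] pi[of x y] xy by (subst integral_add) (auto intro: integrable_on_mult_right)
    finally show ?thesis using sol_diff[OF f, of x y] xy by simp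
  qed
  have k0: "k = 0"
  proof (cases "\<alpha> < 1")
    case False
    have "(q \<longlongrightarrow> 0) (at_right 0)" using bc False by (simp add: BC_def)
    moreover have "((\<lambda>s. k + flx ?f s) \<longlongrightarrow> k + cst ?f) (at_right 0)"
      by (intro tendsto_intros flx_at_0 f)
    then have "(q \<longlongrightarrow> k + cst ?f) (at_right 0)"
    proof (rule Lim_transform_eventually)
      show "\<forall>\<^sub>F s in at_right 0. k + flx ?f s = q s"
        using eventually_at_right_real[of 0 "1::real"] by (rule eventually_mono) (auto simp: q k_def flx_def)
    qed
    ultimately have "k + cst ?f = 0" using tendsto_unique trivial_limit_at_right_real by blast
    then show ?thesis using False by (simp add: cst_def)
  next
    case True
    \<comment> \<open>This constant function tends to 0 at 0 and to - k / (1 - \<alpha>) at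
      1.\<close>
    define E where "E x = \<theta> x - sol ?f x - k * (x powr (1 - \<alpha>) / (1 - \<alpha>))" for x
    have I: "integral {x..y} (\<lambda>s. s powr - \<alpha>) = y powr (1 - \<alpha>) / (1 - \<alpha>) - x powr (1 - \<alpha>) / (1 - \<alpha>)"
      if "0 < x" "x < y" for x y
    proof (rule integral_unique, rule fundamental_theorem_of_calculus)
      fix s assume "s \<in> {x..y}"
      then have "((\<lambda>s. s powr (1 - \<alpha>) / (1 - \<alpha>)) has_real_derivative s powr - \<alpha>) (at s within {x..y})"
        using that True by (auto intro!: derivative_eq_intros)
      then show "((\<lambda>s. s powr (1 - \<alpha>) / (1 - \<alpha>)) has_vector_derivative s powr - \<alpha>) (at s within {x..y})"
        by (simp add: has_real_derivative_iff_has_vector_derivative)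
    qed (use that in auto)
    have E1: "E y = E x" if "0 < x" "x < y" "y < 1" for x y
      using D[OF that] I[of x y] that unfolding E_def by (simp add: algebra_simps)
    have Ec: "E x = E (1/2)" if "0 < x" "x < 1" for x
      by (rule constant_on_unit[of E, OF E1 that]) auto
    have th0: "(\<theta> \<longlongrightarrow> 0) (at_right 0)" using bc True by (simp add: BC_def)
    have l1: "(E \<longlongrightarrow> 0 - 0 - k * (0 / (1 - \<alpha>))) (at_right 0)"
      unfolding E_def[abs_def]
      by (rule tendsto_diff[OF tendsto_diff[OF th0 sol_at_0[OF f True]]
            tendsto_mult[OF tendsto_const tendsto_divide[OF powr_at_0[OF True] tendsto_const]]]) (use True in simp)
    have l2: "(E \<longlongrightarrow> E (1/2)) (at_right 0)"
      by (rule tendsto_eventually, rule eventually_mono[OF eventually_at_right_real[of 0 "1::real"]]) (auto intro: Ec)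
    have a: "E (1/2) = 0" using tendsto_unique[OF _ l2 l1] by simp
    have th1: "(\<theta> \<longlongrightarrow> 0) (at_left 1)" using \<theta> by (simp add: H_space_def)
    have pw1: "((\<lambda>x. x powr (1 - \<alpha>)) \<longlongrightarrow> 1 powr (1 - \<alpha>)) (at_left 1)"
      by (intro tendsto_intros) simp
    have l3: "(E \<longlongrightarrow> 0 - 0 - k * (1 powr (1 - \<alpha>) / (1 - \<alpha>))) (at_left 1)"
      unfolding E_def[abs_def]
      by (rule tendsto_diff[OF tendsto_diff[OF th1 sol_at_1[OF f]]
            tendsto_mult[OF tendsto_const tendsto_divide[OF pw1 tendsto_const]]]) (use True in simp)
    have l4: "(E \<longlongrightarrow> E (1/2)) (at_left 1)"
      by (rule tendsto_eventually, rule eventually_mono[OF eventually_at_left_real[of 0 "1::real"]]) (auto intro: Ec)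
    have "E (1/2) = - (k / (1 - \<alpha>))" using tendsto_unique[OF _ l4 l3] by simp
    then show ?thesis using a True by simp
  qed
  define E where "E x = \<theta> x - sol ?f x" for x
  have E1: "E y = E x" if "0 < x" "x < y" "y < 1" for x y
    using D[OF that] k0 unfolding E_def by simp
  have Ec: "E y = E x" if "0 < y" "y < 1" for y
    by (rule constant_on_unit[of E, OF E1 that x])
  have th1: "(\<theta> \<longlongrightarrow> 0) (at_left 1)" using \<theta> by (simp add: H_space_def)
  have l1: "(E \<longlongrightarrow> 0 - 0) (at_left 1)"
    unfolding E_def[abs_def] by (rule tendsto_diff[OF th1 sol_at_1[OF f]])
  have l2: "(E \<longlongrightarrow> E x) (at_left 1)"
    by (rule tendsto_eventually, rule eventually_mono[OF eventually_at_left_real[of 0 "1::real"]]) (auto intro: Ec)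
  have "E x = 0" using tendsto_unique[OF _ l2 l1] by simp
  then show ?thesis by (simp add: E_def)
qed

lemma P_graph_eq: "P_graph \<alpha> = {(Kop u, u) |u. True}"
proof (intro equalityI subsetI)
  fix z assume "z \<in> P_graph \<alpha>"
  then obtain \<theta> q where z: "z = (abs_L2 \<theta>, abs_L2 (\<lambda>x. - deriv q x))"
    and *: "\<theta> \<in> H_space \<alpha>" "is_flux \<alpha> \<theta> q" "square_int (deriv q)" "BC \<alpha> \<theta> q"
    unfolding P_graph_def by blast
  note f = square_int_uminus[OF *(3)]
  have "square_int \<theta>" using *(1) by (simp add: H_space_def)
  then have "abs_L2 \<theta> = abs_L2 (sol (\<lambda>x. - deriv q x))"
    by (rule abs_L2_eqI[OF _ square_int_sol(1)[OF f]]) (auto intro!: AE_I2 P_graph_unique[OF *])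
  then have "z = (Kop (abs_L2 (\<lambda>x. - deriv q x)), abs_L2 (\<lambda>x. - deriv q x))"
    using z Kop_abs[OF f] by simp
  then show "z \<in> {(Kop u, u) |u. True}" by blast
next
  fix z assume "z \<in> {(Kop u, u) |u. True}"
  then obtain u where z: "z = (Kop u, u)" by blast
  show "z \<in> P_graph \<alpha>" using P_graph_sol[OF square_int_rep, of u] by (simp add: z Kop_def)
qed

end

section \<open>The semigroup\<close>

locale degenerate_basis = degenerate \<alpha> + orthobasis B for \<alpha> and B :: "L2 set" +
  assumes eigen: "\<And>b. b \<in> B \<Longrightarrow> \<exists>s>0. Kop b = s *\<^sub>R b"
begin

definition lam :: "L2 \<Rightarrow> real" where "lam b = 1 / (SOME s. s > 0 \<and> Kop b = s *\<^sub>R b)"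

lemma
  assumes "b \<in> B"
  shows lam_pos: "0 < lam b" and Kop_basis: "Kop b = (1 / lam b) *\<^sub>R b"
  using someI_ex[OF eigen[OF assms, unfolded Bex_def]] by (auto simp: lam_def)

lemma Kop_coeff: "b \<in> B \<Longrightarrow> Kop u \<bullet> b = (u \<bullet> b) / lam b"
  by (simp add: Kop_sym Kop_basis)

definition sg :: "real \<Rightarrow> L2 \<Rightarrow> L2" where "sg t = mult (\<lambda>b. exp (- lam b * t))"

lemma exp_decay_le_1: "b \<in> B \<Longrightarrow> 0 \<le> t \<Longrightarrow> \<bar>exp (- lam b * t)\<bar> \<le> 1"
  using lam_pos[of b] by simp

lemma sg_coeff: "0 \<le> t \<Longrightarrow> b \<in> B \<Longrightarrow> sg t u \<bullet> b = exp (- lam b * t) * (u \<bullet> b)"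
  unfolding sg_def by (rule mult_inner[OF exp_decay_le_1])

lemma bounded_linear_sg: "0 \<le> t \<Longrightarrow> bounded_linear (sg t)"
  unfolding sg_def by (rule bounded_linear_mult[OF exp_decay_le_1]) auto

lemma norm_sg_le: "0 \<le> t \<Longrightarrow> norm (sg t u) \<le> norm u"
  unfolding sg_def using norm_mult_le[of "\<lambda>b. exp (- lam b * t)" 1 u] exp_decay_le_1[of _ t] by simp

lemma sg_0: "sg 0 u = u"
  by (rule eqI) (simp add: sg_coeff)

lemma sg_add: "0 \<le> s \<Longrightarrow> 0 \<le> t \<Longrightarrow> sg (s + t) u = sg s (sg t u)"
  by (rule eqI) (simp add: sg_coeff exp_add[symmetric] algebra_simps)

lemma sg_tendsto:
  assumes "0 \<le> t" "\<forall>\<^sub>F s in G. 0 \<le> s" "((\<lambda>s. s) \<longlongrightarrow> t) G"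
  shows "((\<lambda>s. sg s u) \<longlongrightarrow> sg t u) G"
  unfolding sg_def
proof (rule tendsto_mult_strong)
  show "((\<lambda>s. exp (- lam b * s)) \<longlongrightarrow> exp (- lam b * t)) G" for b
    by (intro tendsto_intros assms)
  show "\<forall>\<^sub>F s in G. \<forall>b\<in>B. \<bar>exp (- lam b * s)\<bar> \<le> 1"
    using assms(2) by eventually_elim (use exp_decay_le_1 in blast)
  show "\<bar>exp (- lam b * t)\<bar> \<le> 1" if "b \<in> B" for b by (rule exp_decay_le_1[OF that assms(1)])
qed

lemma C0_sg: "C0_semigroup sg"
  unfolding C0_semigroup_def
proof (intro conjI allI impI)
  show "((\<lambda>h. sg h u) \<longlongrightarrow> u) (at_right 0)" for u
  proof -
    have "\<forall>\<^sub>F s in at_right (0::real). 0 \<le> s"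
      by (rule eventually_mono[OF eventually_at_right_less]) simp
    from sg_tendsto[OF order_refl this tendsto_ident_at] show ?thesis by (simp add: sg_0)
  qed
qed (auto simp: bounded_linear_sg sg_0 sg_add)

lemma exp_quotient_limit:
  fixes l :: real
  shows "((\<lambda>h. (exp (- l * h) - 1) / h) \<longlongrightarrow> - l) (at_right 0)"
proof -
  have "((\<lambda>h. exp (- l * h)) has_real_derivative - l) (at 0)"
    by (auto intro!: derivative_eq_intros)
  then have "((\<lambda>h. (exp (- l * h) - 1) / h) \<longlongrightarrow> - l) (at 0)"
    by (simp add: has_field_derivative_iff)
  then show ?thesis by (rule tendsto_within_subset) auto
qed

text \<open>For u = K w the symbol of the difference quotient, relative to w, is (exp (- \<lambda>
  h) - 1) / (\<lambda> h), bounded by 1 uniformly in \<lambda>, so the quotients converge to - w.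
  Conversely, testing a limit against the basis determines its coefficients.\<close>

lemma generator_sg: "generator_graph sg = {(u, - w) |u w. (u, w) \<in> P_graph \<alpha>}"
proof (intro equalityI subsetI)
  fix z assume "z \<in> {(u, - w) |u w. (u, w) \<in> P_graph \<alpha>}"
  then obtain w where z: "z = (Kop w, - w)" unfolding P_graph_eq by auto
  let ?m = "\<lambda>h b. (exp (- lam b * h) - 1) / h / lam b"
  have mb: "\<bar>?m h b\<bar> \<le> 1" if "h > 0" "b \<in> B" for h b
  proof -
    have x: "0 < lam b * h" using lam_pos[OF that(2)] that(1) by simp
    have "1 - exp (- (lam b * h)) \<le> lam b * h" using exp_ge_add_one_self[of "- (lam b * h)"] by linarith
    moreover have "exp (- (lam b * h)) \<le> 1" using x by simp
    ultimately have "\<bar>exp (- (lam b * h)) - 1\<bar> \<le> lam b * h" by linarith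
    then show ?thesis using x lam_pos[OF that(2)] that(1)
      by (simp add: abs_divide divide_le_eq mult.commute)
  qed
  have "((\<lambda>h. mult (?m h) w) \<longlongrightarrow> mult (\<lambda>_. - 1) w) (at_right 0)"
  proof (rule tendsto_mult_strong)
    show "((\<lambda>h. ?m h b) \<longlongrightarrow> - 1) (at_right 0)" if "b \<in> B" for b
      using tendsto_divide[OF exp_quotient_limit[of "lam b"] tendsto_const[of "lam b"]] lam_pos[OF that] by simp
    show "\<forall>\<^sub>F h in at_right 0. \<forall>b\<in>B. \<bar>?m h b\<bar> \<le> 1"
      using eventually_at_right_less[of "0::real"] by (rule eventually_mono) (use mb in blast)
  qed simp
  also have "mult (\<lambda>_. - 1) w = - w"
    by (rule eqI) (simp add: mult_inner[where M = 1])
  finally have "((\<lambda>h. (sg h (Kop w) - Kop w) /\<^sub>R h) \<longlongrightarrow> - w) (at_right 0)"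
  proof (rule Lim_transform_eventually)
    show "\<forall>\<^sub>F h in at_right 0. mult (?m h) w = (sg h (Kop w) - Kop w) /\<^sub>R h"
      using eventually_at_right_less[of "0::real"]
    proof (rule eventually_mono)
      fix h :: real assume h: "0 < h"
      show "mult (?m h) w = (sg h (Kop w) - Kop w) /\<^sub>R h"
      proof (rule eqI)
        fix b assume b: "b \<in> B"
        have "mult (?m h) w \<bullet> b = ?m h b * (w \<bullet> b)"
          by (rule mult_inner[OF mb[OF h] b])
        also have "\<dots> = ((sg h (Kop w) - Kop w) /\<^sub>R h) \<bullet> b"
          using h b lam_pos[OF b] by (simp add: inner_diff_left sg_coeff Kop_coeff field_simps)
        finally show "mult (?m h) w \<bullet> b = ((sg h (Kop w) - Kop w) /\<^sub>R h) \<bullet> b" .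
      qed
    qed
  qed
  then show "z \<in> generator_graph sg" by (simp add: z generator_graph_def)
next
  fix z assume "z \<in> generator_graph sg"
  then obtain u w where z: "z = (u, w)" and lim: "((\<lambda>h. (sg h u - u) /\<^sub>R h) \<longlongrightarrow> w) (at_right 0)"
    by (auto simp: generator_graph_def)
  have "w \<bullet> b = - lam b * (u \<bullet> b)" if b: "b \<in> B" for b
  proof -
    have "((\<lambda>h. ((sg h u - u) /\<^sub>R h) \<bullet> b) \<longlongrightarrow> w \<bullet> b) (at_right 0)" by (intro tendsto_intros lim)
    moreover have "((\<lambda>h. ((sg h u - u) /\<^sub>R h) \<bullet> b) \<longlongrightarrow> - lam b * (u \<bullet> b)) (at_right 0)"
    proof (rule Lim_transform_eventually)
      show "((\<lambda>h. (exp (- lam b * h) - 1) / h * (u \<bullet> b)) \<longlongrightarrow> - lam b * (u \<bullet> b)) (at_right 0)"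
        by (intro tendsto_intros exp_quotient_limit)
      show "\<forall>\<^sub>F h in at_right 0. (exp (- lam b * h) - 1) / h * (u \<bullet> b) = ((sg h u - u) /\<^sub>R h) \<bullet> b"
        using eventually_at_right_less[of "0::real"]
        by (rule eventually_mono) (use b in \<open>simp add: inner_diff_left sg_coeff field_simps\<close>)
    qed
    ultimately show ?thesis by (rule tendsto_unique[OF trivial_limit_at_right_real])
  qed
  then have "u = Kop (- w)"
    by (intro eqI) (simp add: Kop_coeff less_imp_neq[OF lam_pos, symmetric])
  then show "z \<in> {(u, - w) |u w. (u, w) \<in> P_graph \<alpha>}"
    unfolding P_graph_eq z by (auto intro!: exI[of _ "- w"])
qed

section \<open>The chosen semigroup is the diagonal one\<close>

lemma
  shows C0_heat: "C0_semigroup (heat_semigroup \<alpha>)"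
    and generator_heat: "generator_graph (heat_semigroup \<alpha>) = {(u, - w) |u w. (u, w) \<in> P_graph \<alpha>}"
proof -
  have "\<exists>S. C0_semigroup S \<and> generator_graph S = {(u, - w) |u w. (u, w) \<in> P_graph \<alpha>}"
    using C0_sg generator_sg by blast
  from someI_ex[OF this]
  show "C0_semigroup (heat_semigroup \<alpha>)"
    "generator_graph (heat_semigroup \<alpha>) = {(u, - w) |u w. (u, w) \<in> P_graph \<alpha>}"
    unfolding heat_semigroup_def by auto
qed

text \<open>The semigroup commutes with \<open>Kop = \<P>\<^sup>-\<^sup>1\<close>, so it acts by scalars on the simple eigenspaces;
  this determines it without any a priori bound on its operator norms.\<close>

lemma heat_commute:
  assumes "0 \<le> t" shows "heat_semigroup \<alpha> t (Kop w) = Kop (heat_semigroup \<alpha> t w)"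
proof -
  let ?S = "heat_semigroup \<alpha>"
  have bl: "bounded_linear (?S t)" and sm: "\<And>s t u. 0 \<le> s \<Longrightarrow> 0 \<le> t \<Longrightarrow> ?S (s + t) u = ?S s (?S t u)"
    using C0_heat assms unfolding C0_semigroup_def by auto
  interpret St: bounded_linear "?S t" by (rule bl)
  have "(Kop w, - w) \<in> generator_graph ?S" unfolding generator_heat P_graph_eq by blast
  then have "((\<lambda>h. (?S h (Kop w) - Kop w) /\<^sub>R h) \<longlongrightarrow> - w) (at_right 0)"
    by (simp add: generator_graph_def)
  then have "((\<lambda>h. ?S t ((?S h (Kop w) - Kop w) /\<^sub>R h)) \<longlongrightarrow> ?S t (- w)) (at_right 0)"
    by (rule St.tendsto)
  then have "((\<lambda>h. (?S h (?S t (Kop w)) - ?S t (Kop w)) /\<^sub>R h) \<longlongrightarrow> ?S t (- w)) (at_right 0)"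
  proof (rule Lim_transform_eventually)
    show "\<forall>\<^sub>F h in at_right 0. ?S t ((?S h (Kop w) - Kop w) /\<^sub>R h) = (?S h (?S t (Kop w)) - ?S t (Kop w)) /\<^sub>R h"
      using eventually_at_right_less[of "0::real"]
    proof (rule eventually_mono)
      fix h :: real assume "0 < h"
      then have "?S t (?S h (Kop w)) = ?S h (?S t (Kop w))"
        using sm[of t h] sm[of h t] assms by (simp add: add.commute)
      then show "?S t ((?S h (Kop w) - Kop w) /\<^sub>R h) = (?S h (?S t (Kop w)) - ?S t (Kop w)) /\<^sub>R h"
        by (simp add: St.scaleR St.diff)
    qed
  qed
  then have "(?S t (Kop w), ?S t (- w)) \<in> generator_graph ?S" by (simp add: generator_graph_def)
  then have "(?S t (Kop w), ?S t w) \<in> P_graph \<alpha>" unfolding generator_heat by (auto simp: St.neg)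
  then show ?thesis unfolding P_graph_eq by blast
qed

lemma abs_one_plus_power: "\<bar>(1 + x) ^ n - 1\<bar> \<le> (1 + \<bar>x\<bar>) ^ n - (1 :: real)"
proof (induction n)
  case (Suc n)
  have "(1 + x) ^ Suc n - 1 = (1 + x) * ((1 + x) ^ n - 1) + x" by (simp add: algebra_simps)
  also have "\<bar>\<dots>\<bar> \<le> \<bar>1 + x\<bar> * \<bar>(1 + x) ^ n - 1\<bar> + \<bar>x\<bar>"
    by (metis abs_mult abs_triangle_ineq)
  also have "\<dots> \<le> (1 + \<bar>x\<bar>) * ((1 + \<bar>x\<bar>) ^ n - 1) + \<bar>x\<bar>"
    using Suc by (intro add_right_mono mult_mono) auto
  also have "\<dots> = (1 + \<bar>x\<bar>) ^ Suc n - 1" by (simp add: algebra_simps)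
  finally show ?case .
qed simp

text \<open>Only the right derivative at 0 is at hand. After multiplication by exp (l t) it becomes
  0, and g t = (g (t/n))^n with g (t/n) = 1 + o(1/n) forces g t = 1.\<close>

lemma multiplicative_derivative_exp:
  fixes \<phi> :: "real \<Rightarrow> real"
  assumes mul: "\<And>s t. 0 \<le> s \<Longrightarrow> 0 \<le> t \<Longrightarrow> \<phi> (s + t) = \<phi> s * \<phi> t" and one: "\<phi> 0 = 1"
    and der: "((\<lambda>h. (\<phi> h - 1) / h) \<longlongrightarrow> - l) (at_right 0)" and t: "0 \<le> t"
  shows "\<phi> t = exp (- l * t)"
proof (cases "t = 0")
  case False
  then have t: "t > 0" using t by simp
  define g where "g s = exp (l * s) * \<phi> s" for s
  have gm: "g (s + t) = g s * g t" if "0 \<le> s" "0 \<le> t" for s t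
    using mul[OF that] by (simp add: g_def exp_add algebra_simps)
  have gd: "((\<lambda>h. (g h - 1) / h) \<longlongrightarrow> 0) (at_right 0)"
  proof (rule Lim_transform_eventually)
    have e: "((\<lambda>h. exp (l * h)) \<longlongrightarrow> exp (l * 0)) (at_right 0)" by (intro tendsto_intros)
    have "((\<lambda>h. exp (l * h) * ((\<phi> h - 1) / h) + (exp (- (- l) * h) - 1) / h) \<longlongrightarrow> exp (l * 0) * - l + - (- l)) (at_right 0)"
      by (intro tendsto_add tendsto_mult e der) (use exp_quotient_limit[of "- l"] in simp)
    then show "((\<lambda>h. exp (l * h) * ((\<phi> h - 1) / h) + (exp (l * h) - 1) / h) \<longlongrightarrow> 0) (at_right 0)" by simp
    show "\<forall>\<^sub>F h in at_right 0. exp (l * h) * ((\<phi> h - 1) / h) + (exp (l * h) - 1) / h = (g h - 1) / h"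
      using eventually_at_right_less[of "0::real"]
      by (rule eventually_mono) (simp add: g_def field_simps)
  qed
  have gp: "g (real n * s) = g s ^ n" if "0 \<le> s" for n s
    by (induction n) (use that in \<open>auto simp: g_def one distrib_right mul exp_add algebra_simps\<close>)
  define x where "x n = g (t / real (Suc n)) - 1" for n
  have fl: "filterlim (\<lambda>n. t / real (Suc n)) (at_right 0) sequentially"
    unfolding filterlim_at_right_to_top[of id] filterlim_at
    using t LIMSEQ_inverse_real_of_nat[THEN tendsto_mult_right_zero, of t]
    by (auto simp: divide_inverse)
  have "(\<lambda>n. t * ((g (t / real (Suc n)) - 1) / (t / real (Suc n)))) \<longlonglongrightarrow> t * 0"
    by (intro tendsto_intros filterlim_compose[OF gd fl])
  then have nx: "(\<lambda>n. real (Suc n) * x n) \<longlonglongrightarrow> 0"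
    using t by (simp add: x_def mult.commute)
  have "(\<lambda>n. exp \<bar>real (Suc n) * x n\<bar> - 1) \<longlonglongrightarrow> exp \<bar>0\<bar> - 1" by (intro tendsto_intros nx)
  then have lim: "(\<lambda>n. exp \<bar>real (Suc n) * x n\<bar> - 1) \<longlonglongrightarrow> 0" by simp
  have "\<bar>g t - 1\<bar> \<le> exp \<bar>real (Suc n) * x n\<bar> - 1" for n
  proof -
    have "g t = (1 + x n) ^ Suc n" using gp[of "t / real (Suc n)" "Suc n"] t by (simp add: x_def)
    then have "\<bar>g t - 1\<bar> \<le> (1 + \<bar>x n\<bar>) ^ Suc n - 1" using abs_one_plus_power[of "x n" "Suc n"] by simp
    also have "(1 + \<bar>x n\<bar>) ^ Suc n \<le> exp \<bar>x n\<bar> ^ Suc n"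
      by (intro power_mono) auto
    also have "exp \<bar>x n\<bar> ^ Suc n = exp \<bar>real (Suc n) * x n\<bar>"
      by (simp only: exp_of_nat_mult[symmetric] abs_mult abs_of_nat)
    finally show ?thesis by simp
  qed
  then have "\<bar>g t - 1\<bar> \<le> 0" by (intro LIMSEQ_le_const[OF lim]) auto
  then have "exp (l * t) * \<phi> t = 1" by (simp add: g_def)
  then show ?thesis by (simp add: exp_minus field_simps)
qed (use one in simp)

text \<open>The image of a basis vector stays in its one-dimensional eigenspace, so it is the vector
  times a scalar function of time, which \<open>multiplicative_derivative_exp\<close> identifies.
  Finite combinations are dense, and both operators are bounded at the fixed time
  \<open>t\<close>.\<close>

lemma heat_eq_sg:
  assumes simple: "\<And>b c. b \<in> B \<Longrightarrow> c \<in> B \<Longrightarrow> lam b = lam c \<Longrightarrow> b = c" and t: "0 \<le> t"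
  shows "heat_semigroup \<alpha> t u = sg t u"
proof -
  let ?S = "heat_semigroup \<alpha>"
  have bl: "\<And>t. 0 \<le> t \<Longrightarrow> bounded_linear (?S t)" and sm: "\<And>s t u. 0 \<le> s \<Longrightarrow> 0 \<le> t \<Longrightarrow> ?S (s + t) u = ?S s (?S t u)"
    and S0: "\<And>u. ?S 0 u = u"
    using C0_heat unfolding C0_semigroup_def by auto
  have Sb: "?S t b = exp (- lam b * t) *\<^sub>R b" if b: "b \<in> B" and t: "0 \<le> t" for b t
  proof -
    define \<phi> where "\<phi> t = ?S t b \<bullet> b" for t
    have lin: "linear (?S s)" if "0 \<le> s" for s using bl[OF that] by (rule bounded_linear.linear)
    have sc: "?S s b = \<phi> s *\<^sub>R b" if s: "0 \<le> s" for s
    proof (rule eqI)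
      fix c assume c: "c \<in> B"
      have "Kop (?S s b) = (1 / lam b) *\<^sub>R ?S s b"
        using heat_commute[OF s, of b] Kop_basis[OF b] lin[OF s] by (simp add: linear_scale)
      then have "(?S s b \<bullet> c) / lam c = (?S s b \<bullet> c) / lam b"
        using Kop_coeff[OF c, of "?S s b"] by auto
      then have "?S s b \<bullet> c = 0" if "c \<noteq> b"
        using simple[OF c b] that lam_pos[OF b] lam_pos[OF c] by (fastforce simp: field_simps)
      then show "?S s b \<bullet> c = (\<phi> s *\<^sub>R b) \<bullet> c"
        using inner_basis[OF b c] by (auto simp: \<phi>_def)
    qed
    have "\<phi> t = exp (- lam b * t)"
    proof (rule multiplicative_derivative_exp[OF _ _ _ t])
      show "\<phi> (s + t) = \<phi> s * \<phi> t" if "0 \<le> s" "0 \<le> t" for s t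
      proof -
        have "?S (s + t) b = (\<phi> t * \<phi> s) *\<^sub>R b"
          using sm[OF that, of b] sc[OF that(2)] sc[OF that(1)] lin[OF that(1)] by (simp add: linear_scale)
        then show ?thesis using inner_basis[OF b b] by (simp add: \<phi>_def)
      qed
      show "\<phi> 0 = 1" using S0 inner_basis[OF b b] by (simp add: \<phi>_def)
      have "(Kop (lam b *\<^sub>R b), - (lam b *\<^sub>R b)) \<in> generator_graph ?S" unfolding generator_heat P_graph_eq by blast
      moreover have "Kop (lam b *\<^sub>R b) = b"
        using Kop_basis[OF b] lam_pos[OF b] bounded_linear.linear[OF bounded_linear_Kop] by (simp add: linear_scale)
      ultimately have "((\<lambda>h. (?S h b - b) /\<^sub>R h) \<longlongrightarrow> - (lam b *\<^sub>R b)) (at_right 0)"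
        by (simp add: generator_graph_def)
      then have "((\<lambda>h. ((?S h b - b) /\<^sub>R h) \<bullet> b) \<longlongrightarrow> - (lam b *\<^sub>R b) \<bullet> b) (at_right 0)"
        by (intro tendsto_intros)
      then show "((\<lambda>h. (\<phi> h - 1) / h) \<longlongrightarrow> - lam b) (at_right 0)"
        using inner_basis[OF b b] by (simp add: \<phi>_def inner_diff_left divide_inverse mult.commute)
    qed
    then show ?thesis using sc[OF t] by simp
  qed
  have St: "bounded_linear (?S t)" by (rule bl[OF t])
  interpret S: bounded_linear "?S t" by (rule St)
  interpret G: bounded_linear "sg t" by (rule bounded_linear_sg[OF t])
  show ?thesis
  proof (rule ccontr)
    assume "?S t u \<noteq> sg t u"
    then have e: "norm (?S t u - sg t u) > 0" by simp
    obtain C where C: "C > 0" "\<And>x. norm (?S t x) \<le> norm x * C" using S.pos_bounded by blast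
    \<comment> \<open>The difference of the two operators has norm at most \<open>C + 1\<close>;
      this \<open>e'\<close> makes the truncation error smaller than the assumed
      discrepancy.\<close>
    define e' where "e' = norm (?S t u - sg t u) / (C + 1)"
    have e': "e' > 0" using e C by (auto simp: e'_def)
    obtain F where F: "finite F" "F \<subseteq> B" "norm (u - (\<Sum>b\<in>F. (u \<bullet> b) *\<^sub>R b)) < e'"
      using approx[OF e'] by blast
    let ?f = "\<Sum>b\<in>F. (u \<bullet> b) *\<^sub>R b"
    have "?S t ?f = sg t ?f"
      unfolding S.sum G.sum
    proof (rule sum.cong[OF refl])
      fix b assume "b \<in> F"
      then have b: "b \<in> B" using F by blast
      have "sg t b = exp (- lam b * t) *\<^sub>R b" unfolding sg_def by (rule mult_basis[OF exp_decay_le_1 b]) (use t in auto)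
      then show "?S t ((u \<bullet> b) *\<^sub>R b) = sg t ((u \<bullet> b) *\<^sub>R b)" by (simp add: S.scaleR G.scaleR Sb[OF b t])
    qed
    then have "?S t u - sg t u = ?S t (u - ?f) - sg t (u - ?f)" by (simp add: S.diff G.diff)
    then have "norm (?S t u - sg t u) \<le> norm (?S t (u - ?f)) + norm (sg t (u - ?f))"
      by (simp add: norm_triangle_ineq4)
    also have "\<dots> \<le> norm (u - ?f) * C + norm (u - ?f)"
      using C(2) norm_sg_le[OF t] by (intro add_mono)
    also have "\<dots> = (C + 1) * norm (u - ?f)" by (simp add: algebra_simps)
    also have "\<dots> < (C + 1) * e'" using F(3) C(1) by (intro mult_strict_left_mono) auto
    also have "\<dots> = norm (?S t u - sg t u)" using C(1) by (simp add: e'_def)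
    finally show False by simp
  qed
qed

end

lemma (in degenerate) ex_degenerate_basis: "\<exists>B. degenerate_basis \<alpha> B"
proof -
  obtain B where "\<And>b. b \<in> B \<Longrightarrow> norm b = 1" "\<And>b c. b \<in> B \<Longrightarrow> c \<in> B \<Longrightarrow> b \<noteq> c \<Longrightarrow> b \<bullet> c = 0"
    "\<And>b. b \<in> B \<Longrightarrow> \<exists>s>0. Kop b = s *\<^sub>R b" "\<And>u. (\<And>b. b \<in> B \<Longrightarrow> u \<bullet> b = 0) \<Longrightarrow> u = 0"
    using compact_symmetric_eigenbasis[OF bounded_linear_Kop Kop_sym Kop_pos Kop_inj Kop_compact] by metis
  then have "degenerate_basis \<alpha> B"
    by (intro degenerate_basis.intro orthobasis.intro degenerate_basis_axioms.intro degenerate_axioms) blast+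
  then show ?thesis ..
qed

section \<open>Eigenfunctions as power series\<close>

text \<open>Multiplying the coefficients by n is the Euler operator y d/dy.\<close>

lemma euler_power_series:
  fixes c :: "nat \<Rightarrow> real"
  assumes "\<And>y. summable (\<lambda>n. c n * y ^ n)"
  shows "(\<lambda>n. real n * c n * y ^ n) sums (y * (\<Sum>n. diffs c n * y ^ n))"
proof -
  have "(\<lambda>n. y * (real n * c n * y ^ (n - Suc 0))) sums (y * (\<Sum>n. diffs c n * y ^ n))"
    by (intro sums_mult diffs_equiv termdiff_converges_all assms)
  moreover have "y * (real n * c n * y ^ (n - Suc 0)) = real n * c n * y ^ n" for n
    by (cases n) auto
  ultimately show ?thesis by simp
qed

text \<open>Gronwall: with C = A + |c| the energy (D^2 + E^2) exp (- C t) is non-increasing and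
  starts at 0.\<close>

lemma linear_system_zero:
  fixes D E :: "real \<Rightarrow> real"
  assumes D: "\<And>x. x0 \<le> x \<Longrightarrow> x < 1 \<Longrightarrow> (D has_real_derivative a x * E x) (at x)"
    and E: "\<And>x. x0 \<le> x \<Longrightarrow> x < 1 \<Longrightarrow> (E has_real_derivative c * D x) (at x)"
    and a: "\<And>x. x0 \<le> x \<Longrightarrow> x < 1 \<Longrightarrow> \<bar>a x\<bar> \<le> A"
    and 0: "D x0 = 0" "E x0 = 0" and x: "x0 \<le> x" "x < 1"
  shows "D x = 0"
proof -
  define C where "C = A + \<bar>c\<bar>"
  define e where "e t = ((D t)\<^sup>2 + (E t)\<^sup>2) * exp (- C * t)" for t
  have "e x \<le> e x0"
  proof (rule DERIV_nonpos_imp_nonincreasing[OF x(1)])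
    fix t assume t: "x0 \<le> t" "t \<le> x"
    then have t1: "t < 1" using x by simp
    let ?d = "(2 * D t * (a t * E t) + 2 * E t * (c * D t)) * exp (- C * t) + ((D t)\<^sup>2 + (E t)\<^sup>2) * (exp (- C * t) * - C)"
    have "(e has_real_derivative ?d) (at t)"
      unfolding e_def[abs_def]
      by (rule derivative_eq_intros D[OF t(1) t1] E[OF t(1) t1] refl | simp)+
    moreover have "?d \<le> 0"
    proof -
      have "2 * \<bar>D t * E t\<bar> \<le> (D t)\<^sup>2 + (E t)\<^sup>2"
        using sum_squares_bound[of "\<bar>D t\<bar>" "\<bar>E t\<bar>"] by (simp add: abs_mult mult.assoc)
      then have m: "(\<bar>a t\<bar> + \<bar>c\<bar>) * (2 * \<bar>D t * E t\<bar>) \<le> C * ((D t)\<^sup>2 + (E t)\<^sup>2)"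
        using a[OF t(1) t1] by (intro mult_mono) (auto simp: C_def)
      have "2 * D t * (a t * E t) + 2 * E t * (c * D t) = (a t + c) * (2 * (D t * E t))" by (simp add: algebra_simps)
      also have "\<dots> \<le> \<bar>a t + c\<bar> * (2 * \<bar>D t * E t\<bar>)"
        by (metis abs_ge_self abs_mult abs_numeral)
      also have "\<dots> \<le> (\<bar>a t\<bar> + \<bar>c\<bar>) * (2 * \<bar>D t * E t\<bar>)" by (intro mult_right_mono abs_triangle_ineq) auto
      finally have "2 * D t * (a t * E t) + 2 * E t * (c * D t) \<le> C * ((D t)\<^sup>2 + (E t)\<^sup>2)" using m by linarith
      then have "(2 * D t * (a t * E t) + 2 * E t * (c * D t)) * exp (- C * t) \<le> C * ((D t)\<^sup>2 + (E t)\<^sup>2) * exp (- C * t)"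
        by (intro mult_right_mono) auto
      then show ?thesis by (simp add: mult_ac)
    qed
    ultimately show "\<exists>y. (e has_real_derivative y) (at t) \<and> y \<le> 0" by blast
  qed
  then have "e x \<le> 0" using 0 by (simp add: e_def)
  then have "(D x)\<^sup>2 + (E x)\<^sup>2 \<le> 0" by (simp add: e_def mult_le_0_iff)
  then show ?thesis by (simp add: sum_power2_le_zero_iff)
qed

context degenerate
begin

text \<open>Inserting \<open>x\<^sup>\<kappa> \<Sum>c\<^sub>k (- l)\<^sup>k x\<^sup>\<beta>\<^sup>k\<close> into \<open>- (x\<^sup>\<alpha>\<phi>')' = l \<phi>\<close> gives the recursion for the coefficients \<open>cc\<close>; the choice
  of the indicial exponent \<open>\<kappa>\<close> matches the boundary condition at \<open>0\<close>, and \<open>\<rho> l\<close> below is the flux of \<open>\<phi> l\<close>.\<close>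

definition \<beta> :: real where "\<beta> = 2 - \<alpha>"
definition \<kappa> :: real where "\<kappa> = (if \<alpha> < 1 then 1 - \<alpha> else 0)"
text \<open>With \<mu> = \<kappa> + \<beta> (k + 1), the factor \<mu> (\<mu> + \<alpha> - 1) that
  x^\<mu> acquires under differentiation equals \<beta> (k + 1) (\<nu> + \<beta> k) in both cases;
  this is the origin of the two values.\<close>

definition \<nu> :: real where "\<nu> = (if \<alpha> < 1 then 3 - 2 * \<alpha> else 1)"

lemma \<beta>: "0 < \<beta>" "\<beta> < 2" and \<kappa>: "0 \<le> \<kappa>" "\<kappa> < 1" and \<nu>: "\<beta> \<le> \<nu>"
  using \<alpha> by (auto simp: \<beta>_def \<kappa>_def \<nu>_def)

primrec cc :: "nat \<Rightarrow> real" where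
  "cc 0 = 1"
| "cc (Suc k) = cc k / (\<beta> * (real k + 1) * (\<nu> + \<beta> * real k))"

lemma nu_le: "\<beta> * (real k + 1) \<le> \<nu> + \<beta> * real k"
  using \<nu> by (simp add: algebra_simps)

lemma nu_pos: "0 < \<nu> + \<beta> * real k"
proof -
  have "0 < \<beta> * (real k + 1)" using \<beta> by simp
  then show ?thesis using nu_le[of k] by linarith
qed

lemma cc_pos: "0 < cc k"
  by (induction k) (use \<beta> nu_pos in \<open>auto intro!: divide_pos_pos mult_pos_pos\<close>)

text \<open>Since \<nu> \<ge> \<beta>, both factors in the denominator of the recursion are at least
  \<beta> (k + 1); hence the square of the factorial.\<close>

lemma cc_le: "cc k \<le> (1 / \<beta>\<^sup>2) ^ k / (fact k)\<^sup>2"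
proof (induction k)
  case (Suc k)
  have "(\<beta> * (real k + 1)) * (\<beta> * (real k + 1)) \<le> \<beta> * (real k + 1) * (\<nu> + \<beta> * real k)"
    using nu_le[of k] \<beta> by (intro mult_left_mono) auto
  moreover have "0 < (\<beta> * (real k + 1)) * (\<beta> * (real k + 1))" using \<beta> by (intro mult_pos_pos) auto
  ultimately have "cc (Suc k) \<le> ((1 / \<beta>\<^sup>2) ^ k / (fact k)\<^sup>2) / ((\<beta> * (real k + 1)) * (\<beta> * (real k + 1)))"
    unfolding cc.simps using Suc cc_pos[of k] by (intro frac_le) auto
  also have "\<dots> = (1 / \<beta>\<^sup>2) ^ Suc k / (fact (Suc k))\<^sup>2"
    by (simp add: power2_eq_square power_divide algebra_simps)
  finally show ?case .
qed simp

definition ps :: "real \<Rightarrow> nat \<Rightarrow> real" where "ps l k = cc k * (- l) ^ k"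

lemma ps_Suc: "\<beta> * (real k + 1) * (\<nu> + \<beta> * real k) * ps l (Suc k) = - l * ps l k"
proof -
  have *: "X * (c / X * (m * z)) = m * (c * z)" if "X \<noteq> 0" for X c m z :: real
    using that by simp
  show ?thesis
    unfolding ps_def cc.simps power_Suc by (rule *) (use \<beta> nu_pos[of k] in auto)
qed

lemma ps_bound: "\<bar>ps l k * y ^ k\<bar> \<le> (\<bar>l * y\<bar> / \<beta>\<^sup>2) ^ k / (fact k)\<^sup>2"
proof -
  have "\<bar>ps l k * y ^ k\<bar> = cc k * \<bar>l * y\<bar> ^ k"
    using cc_pos[of k] by (simp add: ps_def abs_mult power_abs power_mult_distrib)
  also have "\<dots> \<le> (1 / \<beta>\<^sup>2) ^ k / (fact k)\<^sup>2 * \<bar>l * y\<bar> ^ k" by (intro mult_right_mono cc_le) simp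
  also have "\<dots> = (\<bar>l * y\<bar> / \<beta>\<^sup>2) ^ k / (fact k)\<^sup>2" by (simp add: power_divide)
  finally show ?thesis .
qed

lemma ps_bound': "\<bar>ps l k * y ^ k\<bar> \<le> inverse (fact k) * (\<bar>l * y\<bar> / \<beta>\<^sup>2) ^ k"
proof -
  have "(\<bar>l * y\<bar> / \<beta>\<^sup>2) ^ k / (fact k)\<^sup>2 \<le> (\<bar>l * y\<bar> / \<beta>\<^sup>2) ^ k / (fact k * 1)"
    unfolding power2_eq_square by (intro divide_left_mono mult_left_mono mult_pos_pos zero_le_power) (auto simp: fact_ge_1)
  then show ?thesis using ps_bound[of l k y] by (simp add: divide_inverse mult.commute)
qed

lemma summable_ps: "summable (\<lambda>k. ps l k * y ^ k)"
  by (rule summable_comparison_test'[OF summable_exp]) (use ps_bound' in auto)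

definition G :: "real \<Rightarrow> real \<Rightarrow> real" where "G l y = (\<Sum>k. ps l k * y ^ k)"
definition G1 :: "real \<Rightarrow> real \<Rightarrow> real" where "G1 l y = (\<Sum>k. diffs (ps l) k * y ^ k)"

lemma DERIV_G: "(G l has_real_derivative G1 l y) (at y)"
  unfolding G_def[abs_def] G1_def by (rule termdiffs_strong_converges_everywhere[OF summable_ps])

text \<open>The flux equation in the variable y = x^\<beta>: up to a power of x, the derivative of
  x^\<kappa> G is the series with coefficients (\<kappa> + \<beta> n) \<open>ps l n\<close>, and
  \<open>ps_Suc\<close> evaluates the derivative of that series.\<close>

lemma DERIV_flux_weak:
  assumes "\<alpha> < 1"
  shows "((\<lambda>y. \<kappa> * G l y + \<beta> * y * G1 l y) has_real_derivative - l / \<beta> * G l y) (at y)"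
proof -
  have s: "(\<lambda>n. ((\<kappa> + \<beta> * real n) * ps l n) * y ^ n) sums (\<kappa> * G l y + \<beta> * y * G1 l y)" for y
  proof -
    have "(\<lambda>n. \<kappa> * (ps l n * y ^ n) + \<beta> * (real n * ps l n * y ^ n)) sums (\<kappa> * G l y + \<beta> * (y * G1 l y))"
      unfolding G_def G1_def by (intro sums_add sums_mult summable_sums summable_ps euler_power_series)
    then show ?thesis by (simp add: algebra_simps)
  qed
  have "diffs (\<lambda>n. (\<kappa> + \<beta> * real n) * ps l n) n = - l / \<beta> * ps l n" for n
  proof -
    have "\<kappa> + \<beta> * (real n + 1) = \<nu> + \<beta> * real n"
      using assms by (simp add: \<kappa>_def \<nu>_def \<beta>_def algebra_simps)
    moreover have "diffs (\<lambda>n. (\<kappa> + \<beta> * real n) * ps l n) n = (real n + 1) * ((\<kappa> + \<beta> * (real n + 1)) * ps l (Suc n))"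
      by (simp add: diffs_def add.commute)
    ultimately have "\<beta> * diffs (\<lambda>n. (\<kappa> + \<beta> * real n) * ps l n) n = \<beta> * (real n + 1) * (\<nu> + \<beta> * real n) * ps l (Suc n)"
      by (simp add: mult.assoc)
    then show ?thesis using \<beta> unfolding ps_Suc by (simp add: field_simps)
  qed
  then have "(\<Sum>n. diffs (\<lambda>n. (\<kappa> + \<beta> * real n) * ps l n) n * y ^ n) = - l / \<beta> * G l y"
    unfolding G_def using suminf_mult[OF summable_ps, of "- l / \<beta>" l y] by (simp add: mult.assoc)
  moreover have "((\<lambda>y. \<Sum>n. ((\<kappa> + \<beta> * real n) * ps l n) * y ^ n) has_real_derivative
      (\<Sum>n. diffs (\<lambda>n. (\<kappa> + \<beta> * real n) * ps l n) n * y ^ n)) (at y)"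
    by (rule termdiffs_strong_converges_everywhere) (rule sums_summable[OF s])
  ultimately show ?thesis unfolding sums_unique[OF s, symmetric] by simp
qed

text \<open>Here \<kappa> = 0 and the flux \<beta> x G1 contains the factor x, in general no power
  series in y = x^\<beta>; so the second order equation is stated for \<open>G1\<close>
  itself.\<close>

lemma DERIV_G1_strong:
  assumes "\<not> \<alpha> < 1"
  obtains G2 where "(G1 l has_real_derivative G2) (at y)" "\<beta> * (G1 l y + \<beta> * y * G2) = - l * G l y"
proof (rule that)
  let ?d = "diffs (ps l)"
  have sd: "summable (\<lambda>n. ?d n * y ^ n)" for y by (rule termdiff_converges_all[OF summable_ps])
  show "(G1 l has_real_derivative (\<Sum>n. diffs ?d n * y ^ n)) (at y)"
    unfolding G1_def[abs_def] by (rule termdiffs_strong_converges_everywhere[OF sd])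
  have "(\<lambda>n. \<beta> * (?d n * y ^ n + \<beta> * (real n * ?d n * y ^ n))) sums
      (\<beta> * (G1 l y + \<beta> * (y * (\<Sum>n. diffs ?d n * y ^ n))))"
    unfolding G1_def by (intro sums_add sums_mult summable_sums sd euler_power_series)
  moreover have "\<beta> * (?d n * y ^ n + \<beta> * (real n * ?d n * y ^ n)) = - l * (ps l n * y ^ n)" for n
  proof -
    have "\<beta> * (?d n * y ^ n + \<beta> * (real n * ?d n * y ^ n))
        = \<beta> * (real n + 1) * (\<nu> + \<beta> * real n) * ps l (Suc n) * y ^ n"
      using assms by (simp add: diffs_def \<nu>_def algebra_simps)
    then show ?thesis unfolding ps_Suc by simp
  qed
  ultimately have "(\<lambda>n. - l * (ps l n * y ^ n)) sums (\<beta> * (G1 l y + \<beta> * (y * (\<Sum>n. diffs ?d n * y ^ n))))" by simp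
  moreover have "(\<lambda>n. - l * (ps l n * y ^ n)) sums (- l * G l y)"
    unfolding G_def by (intro sums_mult summable_sums summable_ps)
  ultimately show "\<beta> * (G1 l y + \<beta> * y * (\<Sum>n. diffs ?d n * y ^ n)) = - l * G l y"
    using sums_unique2 by (metis mult.assoc)
qed

section \<open>Eigenfunctions and fluxes in the variable x\<close>

definition \<phi> :: "real \<Rightarrow> real \<Rightarrow> real" where "\<phi> l x = x powr \<kappa> * G l (x powr \<beta>)"

definition \<rho> :: "real \<Rightarrow> real \<Rightarrow> real" where
  "\<rho> l x = (if \<alpha> < 1 then \<kappa> * G l (x powr \<beta>) + \<beta> * x powr \<beta> * G1 l (x powr \<beta>)
    else \<beta> * x * G1 l (x powr \<beta>))"

lemma DERIV_phi:
  assumes x: "0 < x" shows "(\<phi> l has_real_derivative x powr - \<alpha> * \<rho> l x) (at x)"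
proof -
  let ?y = "x powr \<beta>"
  have d: "((\<lambda>x. G l (x powr \<beta>)) has_real_derivative G1 l ?y * (\<beta> * x powr (\<beta> - 1))) (at x)"
    by (rule DERIV_chain2[OF DERIV_G has_real_derivative_powr[OF x]])
  have "(\<phi> l has_real_derivative \<kappa> * x powr (\<kappa> - 1) * G l ?y + G1 l ?y * (\<beta> * x powr (\<beta> - 1)) * x powr \<kappa>) (at x)"
    unfolding \<phi>_def[abs_def] by (rule DERIV_mult[OF has_real_derivative_powr[OF x] d])
  moreover have "\<kappa> * x powr (\<kappa> - 1) * G l ?y + G1 l ?y * (\<beta> * x powr (\<beta> - 1)) * x powr \<kappa> = x powr - \<alpha> * \<rho> l x"
  proof (cases "\<alpha> < 1")
    case True
    have "x powr (\<beta> - 1) * x powr \<kappa> = x powr - \<alpha> * ?y" "x powr (\<kappa> - 1) = x powr - \<alpha>"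
      using True by (simp_all add: powr_add[symmetric] \<beta>_def \<kappa>_def)
    then show ?thesis using True by (simp add: \<rho>_def algebra_simps)
  next
    case False
    have "x powr (\<beta> - 1) * x powr \<kappa> = x powr - \<alpha> * x"
      using False x by (simp add: powr_mult_base' \<beta>_def \<kappa>_def powr_diff powr_minus field_simps)
    then show ?thesis using False by (simp add: \<rho>_def \<kappa>_def algebra_simps)
  qed
  ultimately show ?thesis by simp
qed

lemma DERIV_rho:
  assumes x: "0 < x" shows "(\<rho> l has_real_derivative - l * \<phi> l x) (at x)"
proof (cases "\<alpha> < 1")
  case True
  let ?y = "x powr \<beta>"
  have "((\<lambda>x. \<kappa> * G l (x powr \<beta>) + \<beta> * x powr \<beta> * G1 l (x powr \<beta>)) has_real_derivative
      - l / \<beta> * G l ?y * (\<beta> * x powr (\<beta> - 1))) (at x)"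
    by (rule DERIV_chain2[OF DERIV_flux_weak[OF True] has_real_derivative_powr[OF x]])
  moreover have "\<beta> - 1 = \<kappa>" using True by (simp add: \<beta>_def \<kappa>_def)
  ultimately show ?thesis using True \<beta> unfolding \<rho>_def[abs_def] \<phi>_def by (simp add: mult_ac)
next
  case False
  let ?y = "x powr \<beta>"
  obtain G2 where G2: "(G1 l has_real_derivative G2) (at ?y)" "\<beta> * (G1 l ?y + \<beta> * ?y * G2) = - l * G l ?y"
    using DERIV_G1_strong[OF False] .
  have "((\<lambda>x. G1 l (x powr \<beta>)) has_real_derivative G2 * (\<beta> * x powr (\<beta> - 1))) (at x)"
    by (rule DERIV_chain2[OF G2(1) has_real_derivative_powr[OF x]])
  then have "((\<lambda>x. (\<beta> * x) * G1 l (x powr \<beta>)) has_real_derivative \<beta> * G1 l ?y + G2 * (\<beta> * x powr (\<beta> - 1)) * (\<beta> * x)) (at x)"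
    by (intro DERIV_mult DERIV_cmult_Id)
  moreover have "\<beta> * G1 l ?y + G2 * (\<beta> * x powr (\<beta> - 1)) * (\<beta> * x) = - l * G l ?y"
    unfolding G2(2)[symmetric] using x by (simp add: powr_diff algebra_simps)
  ultimately show ?thesis using False x unfolding \<rho>_def[abs_def] \<phi>_def by (simp add: \<kappa>_def)
qed

lemma G_continuous: "isCont (G l) y" "isCont (G1 l) y"
proof -
  show "isCont (G l) y" by (rule DERIV_isCont[OF DERIV_G])
  have "summable (\<lambda>n. diffs (ps l) n * y ^ n)" for y by (rule termdiff_converges_all[OF summable_ps])
  then show "isCont (G1 l) y"
    unfolding G1_def[abs_def] by (rule DERIV_isCont[OF termdiffs_strong_converges_everywhere])
qed

lemma G_0: "G l 0 = 1"
  by (simp add: G_def ps_def)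

lemma powr_limit_0: "0 < r \<Longrightarrow> ((\<lambda>x. x powr r) \<longlongrightarrow> 0) (at_right (0::real))"
proof -
  assume "0 < r"
  then have "((\<lambda>x. x powr r) \<longlongrightarrow> 0 powr r) (at_right (0::real))"
    by (intro tendsto_powr') (auto intro!: tendsto_intros eventually_at_right_less[THEN eventually_mono])
  then show ?thesis by simp
qed

lemma G_limit: "((\<lambda>x. G l (x powr \<beta>)) \<longlongrightarrow> 1) (at_right 0)" "((\<lambda>x. G1 l (x powr \<beta>)) \<longlongrightarrow> G1 l 0) (at_right 0)"
  using isCont_tendsto_compose[OF G_continuous(1) powr_limit_0[OF \<beta>(1)], of l]
    isCont_tendsto_compose[OF G_continuous(2) powr_limit_0[OF \<beta>(1)], of l] by (simp_all add: G_0)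

lemma phi_limit:
  "\<alpha> < 1 \<Longrightarrow> (\<phi> l \<longlongrightarrow> 0) (at_right 0)" "\<not> \<alpha> < 1 \<Longrightarrow> (\<phi> l \<longlongrightarrow> 1) (at_right 0)"
proof -
  assume "\<alpha> < 1"
  then have "0 < \<kappa>" by (simp add: \<kappa>_def)
  from tendsto_mult[OF powr_limit_0[OF this] G_limit(1)[of l]]
  show "(\<phi> l \<longlongrightarrow> 0) (at_right 0)" unfolding \<phi>_def[abs_def] by simp
next
  assume "\<not> \<alpha> < 1"
  then have "\<kappa> = 0" by (simp add: \<kappa>_def)
  then show "(\<phi> l \<longlongrightarrow> 1) (at_right 0)"
    unfolding \<phi>_def[abs_def]
    by (intro Lim_transform_eventually[OF G_limit(1)] eventually_mono[OF eventually_at_right_less]) auto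
qed

lemma rho_limit: "\<alpha> < 1 \<Longrightarrow> (\<rho> l \<longlongrightarrow> \<kappa>) (at_right 0)"
proof -
  assume a: "\<alpha> < 1"
  have "((\<lambda>x. \<kappa> * G l (x powr \<beta>) + \<beta> * x powr \<beta> * G1 l (x powr \<beta>)) \<longlongrightarrow> \<kappa> * 1 + \<beta> * 0 * G1 l 0) (at_right 0)"
    by (intro tendsto_intros G_limit powr_limit_0 \<beta>)
  then show ?thesis using a by (simp add: \<rho>_def[abs_def])
qed

lemma DERIV_prim_continuous:
  assumes f: "square_int f" "continuous_on {0<..<1} f" and x: "0 < x" "x < 1"
  shows "(prim f has_real_derivative f x) (at x)"
proof -
  have "((\<lambda>y. integral {x/2..y} f) has_real_derivative f x) (at x within {x/2..(x+1)/2})"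
    by (rule integral_has_real_derivative, rule continuous_on_subset[OF f(2)]) (use x in auto)
  then have "((\<lambda>y. integral {x/2..y} f) has_real_derivative f x) (at x)"
    using x by (simp add: at_within_Icc_at)
  then have "((\<lambda>y. prim f (x/2) + integral {x/2..y} f) has_real_derivative f x) (at x)"
    by (auto intro!: derivative_eq_intros)
  then show ?thesis
  proof (rule has_field_derivative_transform_within_open[of _ _ _ "{x/2<..<(x+1)/2}"])
    show "prim f (x/2) + integral {x/2..y} f = prim f y" if "y \<in> {x/2<..<(x+1)/2}" for y
      using prim_diff(2)[OF f(1), of "x/2" y] that x by simp
  qed (use x in auto)
qed

text \<open>Both \<open>sol F\<close> and \<open>\<phi> l\<close> satisfy the boundary condition at \<open>0\<close>, so their Wronskian, which is constant, vanishes.\<close>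

lemma eigenfunction_proportional:
  assumes F: "square_int F" and eq: "\<And>x. 0 < x \<Longrightarrow> x < 1 \<Longrightarrow> F x = l * sol F x"
  obtains n where "\<And>x. 0 < x \<Longrightarrow> x < 1 \<Longrightarrow> sol F x = n * \<phi> l x"
proof -
  have cF: "continuous_on {0<..<1} F"
    by (rule continuous_on_cong[THEN iffD2, OF refl _ continuous_on_mult_left[OF continuous_sol[OF F], of l]])
      (use eq in auto)
  have d\<theta>: "(sol F has_real_derivative x powr - \<alpha> * flx F x) (at x)" if "0 < x" "x < 1" for x
    using DERIV_sol[OF F that] by (simp add: gr_def)
  have dq: "(flx F has_real_derivative - l * sol F x) (at x)" if "0 < x" "x < 1" for x
    unfolding flx_def[abs_def] using DERIV_prim_continuous[OF F cF that] eq[OF that]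
    by (auto intro!: derivative_eq_intros)
  define W where "W x = flx F x * \<phi> l x - sol F x * \<rho> l x" for x
  have dW: "(W has_real_derivative 0) (at x)" if "0 < x" "x < 1" for x
    unfolding W_def[abs_def]
    using DERIV_diff[OF DERIV_mult[OF dq[OF that] DERIV_phi[OF that(1), of l]]
        DERIV_mult[OF d\<theta>[OF that] DERIV_rho[OF that(1), of l]]]
    by (simp add: algebra_simps)
  have Wc: "W y = W x" if "0 < x" "x < y" "y < 1" for x y
  proof (rule DERIV_isconst_end[OF that(2)])
    show "continuous_on {x..y} W"
      by (intro continuous_at_imp_continuous_on ballI, rule DERIV_isCont[OF dW]) (use that in auto)
  qed (use that dW in auto)
  have Wlim: "(W \<longlongrightarrow> 0) (at_right 0)"
  proof (cases "\<alpha> < 1")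
    case True
    have "(W \<longlongrightarrow> cst F * 0 - 0 * \<kappa>) (at_right 0)"
      unfolding W_def[abs_def]
      by (intro tendsto_diff tendsto_mult flx_at_0 sol_at_0 phi_limit rho_limit F True)
    then show ?thesis by simp
  next
    case False
    \<comment> \<open>\<open>sol F\<close> may grow like x^(-p), but the flux \<rho> is of order
      x.\<close>
    have "((\<lambda>x. sol F x * \<rho> l x) \<longlongrightarrow> 0) (at_right 0)"
    proof (rule Lim_null_comparison)
      show "\<forall>\<^sub>F x in at_right 0. norm (sol F x * \<rho> l x) \<le> 2 / p * nrm F * x powr (1 - p) * \<bar>\<beta> * G1 l (x powr \<beta>)\<bar>"
        using eventually_at_right_real[of 0 "1::real"]
      proof (rule eventually_mono)
        fix x :: real assume x: "x \<in> {0<..<1}"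
        have "\<bar>sol F x\<bar> * \<bar>\<rho> l x\<bar> \<le> (2 / p * nrm F * x powr - p) * \<bar>\<rho> l x\<bar>"
          using sol_bound[OF F, of x] x by (intro mult_right_mono) auto
        also have "\<dots> = 2 / p * nrm F * (x powr - p * x) * \<bar>\<beta> * G1 l (x powr \<beta>)\<bar>"
          using False x by (simp add: \<rho>_def abs_mult)
        also have "x powr - p * x = x powr (1 - p)" using x by (simp add: powr_diff powr_minus field_simps)
        finally show "norm (sol F x * \<rho> l x) \<le> 2 / p * nrm F * x powr (1 - p) * \<bar>\<beta> * G1 l (x powr \<beta>)\<bar>"
          by (simp add: abs_mult)
      qed simp
      have "((\<lambda>x. 2 / p * nrm F * x powr (1 - p) * \<bar>\<beta> * G1 l (x powr \<beta>)\<bar>) \<longlongrightarrow> 2 / p * nrm F * 0 * \<bar>\<beta> * G1 l 0\<bar>) (at_right 0)"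
        by (intro tendsto_intros G_limit powr_limit_0) (use p in auto)
      then show "((\<lambda>x. 2 / p * nrm F * x powr (1 - p) * \<bar>\<beta> * G1 l (x powr \<beta>)\<bar>) \<longlongrightarrow> 0) (at_right 0)" by simp
    qed
    moreover have "((\<lambda>x. flx F x * \<phi> l x) \<longlongrightarrow> cst F * 1) (at_right 0)"
      by (intro tendsto_mult flx_at_0 phi_limit F False)
    ultimately have "(W \<longlongrightarrow> cst F * 1 - 0) (at_right 0)"
      unfolding W_def[abs_def] by (intro tendsto_diff)
    then show ?thesis using False by (simp add: cst_def)
  qed
  have W0: "W x = 0" if "0 < x" "x < 1" for x
  proof -
    have "(W \<longlongrightarrow> W x) (at_right 0)"
      by (rule tendsto_eventually, rule eventually_mono[OF eventually_at_right_real[OF that(1)]])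
        (use Wc that in auto)
    then show ?thesis using tendsto_unique[OF _ _ Wlim] by simp
  qed
  \<comment> \<open>Near 0 the factor \<open>G\<close> is close to 1, so \<phi> has no zero there
    and the quotient can be differentiated.\<close>
  have "\<forall>\<^sub>F x in at_right 0. 1/2 < G l (x powr \<beta>)"
    using order_tendstoD(1)[OF G_limit(1), of "1/2"] by simp
  then obtain d where d: "d > 0" "\<And>x. 0 < x \<Longrightarrow> x < d \<Longrightarrow> 1/2 < G l (x powr \<beta>)"
    by (auto simp: eventually_at_right_field)
  define x0 where "x0 = min d 1 / 2"
  have x0: "0 < x0" "x0 < d" "x0 < 1" using d(1) by (auto simp: x0_def)
  have pos: "0 < \<phi> l x" if "0 < x" "x \<le> x0" for x
    using d(2)[of x] that x0 by (simp add: \<phi>_def)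
  define n where "n = sol F x0 / \<phi> l x0"
  have dquot: "((\<lambda>x. sol F x / \<phi> l x) has_real_derivative 0) (at x)" if "0 < x" "x \<le> x0" for x
  proof -
    have x: "0 < x" "x < 1" "\<phi> l x \<noteq> 0" using that x0 pos[OF that] by auto
    have "((\<lambda>x. sol F x / \<phi> l x) has_real_derivative
        (x powr - \<alpha> * flx F x * \<phi> l x - sol F x * (x powr - \<alpha> * \<rho> l x)) / (\<phi> l x * \<phi> l x)) (at x)"
      by (rule DERIV_divide[OF d\<theta>[OF x(1,2)] DERIV_phi[OF x(1)] x(3)])
    moreover have "x powr - \<alpha> * flx F x * \<phi> l x - sol F x * (x powr - \<alpha> * \<rho> l x) = x powr - \<alpha> * W x"
      by (simp add: W_def algebra_simps)
    ultimately show ?thesis using W0[OF x(1,2)] by simp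
  qed
  have near: "sol F x = n * \<phi> l x" if "0 < x" "x \<le> x0" for x
  proof (cases "x = x0")
    case True
    then show ?thesis using pos[OF that] by (simp add: n_def)
  next
    case False
    have "sol F x0 / \<phi> l x0 = sol F x / \<phi> l x"
    proof (rule DERIV_isconst_end[of x x0])
      show "continuous_on {x..x0} (\<lambda>x. sol F x / \<phi> l x)"
        by (intro continuous_at_imp_continuous_on ballI, rule DERIV_isCont[OF dquot]) (use that in auto)
    qed (use that False dquot in auto)
    then show ?thesis using pos[OF that] by (simp add: n_def field_simps)
  qed
  have flx0: "flx F x0 = n * \<rho> l x0"
  proof -
    have "flx F x0 * \<phi> l x0 = (n * \<rho> l x0) * \<phi> l x0"
      using W0[OF x0(1,3)] near[OF x0(1)] by (simp add: W_def)
    then show ?thesis using pos[OF x0(1)] by simp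
  qed
  have "sol F x = n * \<phi> l x" if x: "0 < x" "x < 1" for x
  proof (cases "x \<le> x0")
    case False
    \<comment> \<open>Beyond \<open>x0\<close> the function \<phi> may vanish; the proportionality
      is continued by uniqueness for the first order system of value and flux.\<close>
    have "(\<lambda>x. sol F x - n * \<phi> l x) x = 0"
    proof (rule linear_system_zero[of x0 "\<lambda>x. sol F x - n * \<phi> l x" "\<lambda>x. x powr - \<alpha>" "\<lambda>x. flx F x - n * \<rho> l x" "- l" "x0 powr - \<alpha>"])
      fix t assume t: "x0 \<le> t" "t < 1"
      then have t0: "0 < t" using x0 by simp
      show "((\<lambda>x. sol F x - n * \<phi> l x) has_real_derivative t powr - \<alpha> * (flx F t - n * \<rho> l t)) (at t)"
        using DERIV_diff[OF d\<theta>[OF t0 t(2)] DERIV_cmult[OF DERIV_phi[OF t0, of l], of n]] by (simp add: algebra_simps)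
      show "((\<lambda>x. flx F x - n * \<rho> l x) has_real_derivative - l * (sol F t - n * \<phi> l t)) (at t)"
        using DERIV_diff[OF dq[OF t0 t(2)] DERIV_cmult[OF DERIV_rho[OF t0, of l], of n]] by (simp add: algebra_simps)
      show "\<bar>t powr - \<alpha>\<bar> \<le> x0 powr - \<alpha>" using t x0 \<alpha> by (simp add: powr_mono2')
    qed (use near[OF x0(1)] flx0 x False in auto)
    then show ?thesis by simp
  qed (use near that in auto)
  then show ?thesis using that by blast
qed

end

section \<open>Interpolation of entire functions\<close>

lemma prod_index_distance:
  assumes "i < N"
  shows "(\<Prod>j\<in>{..<N} - {i}. \<bar>real i - real j\<bar>) = fact i * fact (N - 1 - i)"
proof -
  have split: "{..<N} - {i} = {..<i} \<union> {Suc i..<N}" using assms by auto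
  have 1: "(\<Prod>j<i. \<bar>real i - real j\<bar>) = fact i"
  proof -
    have "(\<Prod>j<i. \<bar>real i - real j\<bar>) = (\<Prod>j<i. real (i - j))"
      by (rule prod.cong) (auto simp: of_nat_diff)
    then show ?thesis by (simp add: fact_prod_rev lessThan_atLeast0)
  qed
  have 2: "(\<Prod>j\<in>{Suc i..<N}. \<bar>real i - real j\<bar>) = fact (N - 1 - i)"
  proof -
    have "(\<Prod>j\<in>{Suc i..<N}. \<bar>real i - real j\<bar>) = (\<Prod>k\<in>{1..N - 1 - i}. real k)"
      by (rule prod.reindex_bij_witness[of _ "\<lambda>k. k + i" "\<lambda>j. j - i"]) (auto simp: of_nat_diff)
    then show ?thesis by (simp add: fact_prod)
  qed
  show ?thesis unfolding split using 1 2 by (subst prod.union_disjoint) auto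
qed

text \<open>The quotient of the factorials is a binomial coefficient, at most the sum of its row in
  Pascal's triangle.\<close>

lemma fact_div_le:
  assumes "i < N"
  shows "fact (N - 1) \<le> 2 ^ (N - 1) * (fact i * fact (N - 1 - i) :: real)"
proof -
  have "(N - 1 choose i) \<le> (\<Sum>k\<le>N - 1. N - 1 choose k)"
    by (rule member_le_sum) (use assms in auto)
  then have le: "real (N - 1 choose i) \<le> 2 ^ (N - 1)"
    unfolding choose_row_sum by (metis of_nat_le_iff of_nat_numeral of_nat_power)
  have "(fact (N - 1) :: real) = fact i * fact (N - 1 - i) * real (N - 1 choose i)"
    using binomial_fact_lemma[of i "N - 1"] assms by (metis Suc_pred' less_Suc_eq_le of_nat_fact of_nat_mult gr_implies_not0 gr_zeroI)
  also have "\<dots> \<le> fact i * fact (N - 1 - i) * 2 ^ (N - 1)" using le by (intro mult_left_mono) auto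
  finally show ?thesis by (simp add: mult_ac)
qed

text \<open>The denominators of the Lagrange basis are compared with those of equispaced nodes,
  h^(N-1) i! (N-1-i)!, and its numerators are at most 1 because all points lie in [0,1].\<close>

lemma lagrange_bound:
  fixes q :: "real poly" and y :: "nat \<Rightarrow> real"
  assumes deg: "degree q < N" and h: "0 < h"
    and sep: "\<And>i j. i < N \<Longrightarrow> j < N \<Longrightarrow> h * \<bar>real i - real j\<bar> \<le> \<bar>y i - y j\<bar>"
    and y: "\<And>i. i < N \<Longrightarrow> 0 \<le> y i \<and> y i \<le> 1"
    and E: "\<And>i. i < N \<Longrightarrow> \<bar>poly q (y i)\<bar> \<le> E" and t: "0 \<le> t" "t \<le> 1"
  shows "\<bar>poly q t\<bar> \<le> real N * E * ((2 / h) ^ (N - 1) / fact (N - 1))"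
proof -
  define w where "w i = (\<Prod>j\<in>{..<N} - {i}. y i - y j)" for i
  define r where "r i = (\<Prod>j\<in>{..<N} - {i}. [:- y j, 1:])" for i
  define L where "L = (\<Sum>i<N. smult (poly q (y i) / w i) (r i))"
  have ne: "y i \<noteq> y j" if "i < N" "j < N" "i \<noteq> j" for i j
  proof -
    have "0 < h * \<bar>real i - real j\<bar>" using h that by simp
    then show ?thesis using sep[OF that(1,2)] by auto
  qed
  have w0: "w i \<noteq> 0" if "i < N" for i using ne[OF that] by (auto simp: w_def)
  have rdeg: "degree (r i) < N" if "i < N" for i
  proof -
    have "degree (r i) \<le> (\<Sum>j\<in>{..<N} - {i}. degree [:- y j, 1:])"
      unfolding r_def by (rule order_trans[OF degree_prod_sum_le]) (auto simp: comp_def)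
    also have "\<dots> = N - 1" using that by simp
    finally show ?thesis using that by simp
  qed
  have Ldeg: "degree L < N"
    unfolding L_def using deg rdeg by (intro degree_sum_less) (auto intro: le_less_trans[OF degree_smult_le])
  have Ly: "poly L (y k) = poly q (y k)" if k: "k < N" for k
  proof -
    have "poly (r i) (y k) = (if i = k then w k else 0)" if "i < N" for i
      using k that by (auto simp: r_def w_def poly_prod)
    then have "poly L (y k) = (\<Sum>i<N. if i = k then poly q (y k) else 0)"
      unfolding L_def poly_sum using w0[OF k] by (intro sum.cong) auto
    then show ?thesis using k by simp
  qed
  have "q = L"
  proof (rule poly_eqI_degree[of "y ` {..<N}"])
    have "card (y ` {..<N}) = N" using ne by (subst card_image) (auto simp: inj_on_def)
    then show "degree q < card (y ` {..<N})" "degree L < card (y ` {..<N})" using deg Ldeg by auto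
  qed (use Ly in auto)
  then have "poly q t = poly L t" by (rule arg_cong)
  also have "\<dots> = (\<Sum>i<N. poly q (y i) / w i * poly (r i) t)" unfolding L_def by (simp add: poly_sum)
  finally have "\<bar>poly q t\<bar> = \<bar>\<Sum>i<N. poly q (y i) / w i * poly (r i) t\<bar>" by (rule arg_cong)
  also have "\<dots> \<le> (\<Sum>i<N. \<bar>poly q (y i) / w i * poly (r i) t\<bar>)" by (rule sum_abs)
  also have "\<dots> \<le> (\<Sum>i<N. E * ((2 / h) ^ (N - 1) / fact (N - 1)))"
  proof (rule sum_mono)
    fix i assume "i \<in> {..<N}"
    then have i: "i < N" by simp
    have c: "card ({..<N} - {i}) = N - 1" using i by simp
    have "\<bar>poly (r i) t\<bar> = (\<Prod>j\<in>{..<N} - {i}. \<bar>t - y j\<bar>)"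
      by (simp add: r_def poly_prod abs_prod)
    also have "\<dots> \<le> 1"
      by (rule prod_le_1) (use y t in \<open>force simp: abs_le_iff\<close>)
    finally have rt: "\<bar>poly (r i) t\<bar> \<le> 1" .
    have "(\<Prod>j\<in>{..<N} - {i}. h * \<bar>real i - real j\<bar>) \<le> (\<Prod>j\<in>{..<N} - {i}. \<bar>y i - y j\<bar>)"
      by (rule prod_mono) (use sep i h in auto)
    then have "h ^ (N - 1) * (fact i * fact (N - 1 - i)) \<le> \<bar>w i\<bar>"
      unfolding w_def abs_prod prod.distrib prod_constant c prod_index_distance[OF i] .
    moreover have "fact (N - 1) / 2 ^ (N - 1) \<le> (fact i * fact (N - 1 - i) :: real)"
      using fact_div_le[OF i] by (simp add: field_simps)
    then have "h ^ (N - 1) * (fact (N - 1) / 2 ^ (N - 1)) \<le> h ^ (N - 1) * (fact i * fact (N - 1 - i))"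
      using h by (intro mult_left_mono) auto
    ultimately have wl: "h ^ (N - 1) * (fact (N - 1) / 2 ^ (N - 1)) \<le> \<bar>w i\<bar>" by linarith
    have pl: "0 < h ^ (N - 1) * (fact (N - 1) / 2 ^ (N - 1))" using h by simp
    have "\<bar>poly q (y i) / w i * poly (r i) t\<bar> = \<bar>poly q (y i)\<bar> * \<bar>poly (r i) t\<bar> / \<bar>w i\<bar>"
      by (simp add: abs_mult)
    also have "\<dots> \<le> (E * 1) / (h ^ (N - 1) * (fact (N - 1) / 2 ^ (N - 1)))"
      using E[OF i] rt wl pl by (intro frac_le mult_mono) auto
    also have "\<dots> = E * ((2 / h) ^ (N - 1) / fact (N - 1))" by (simp add: power_divide field_simps)
    finally show "\<bar>poly q (y i) / w i * poly (r i) t\<bar> \<le> E * ((2 / h) ^ (N - 1) / fact (N - 1))" .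
  qed
  also have "\<dots> = real N * E * ((2 / h) ^ (N - 1) / fact (N - 1))" by simp
  finally show ?thesis .
qed

lemma power_le_exp_fact: "0 \<le> x \<Longrightarrow> x ^ n / fact n \<le> exp (x :: real)"
proof -
  assume x: "0 \<le> x"
  have s: "summable (\<lambda>k. x ^ k / fact k)" using summable_exp[of x] by (simp add: divide_inverse mult.commute)
  have "(\<Sum>k\<in>{n}. x ^ k / fact k) \<le> (\<Sum>k. x ^ k / fact k)"
    by (rule sum_le_suminf[OF s]) (use x in auto)
  then show ?thesis by (simp add: exp_def divide_inverse mult.commute)
qed

text \<open>Lagrange interpolation of the Taylor polynomial of degree \<open>N - 1\<close>; the factor \<open>exp 1 ^ N\<close>
  bounds \<open>N ^ (N - 1) / fact (N - 1)\<close>.\<close>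

lemma entire_interpolation_bound:
  fixes d :: "nat \<Rightarrow> real" and y :: "nat \<Rightarrow> real"
  assumes d: "\<And>k. \<bar>d k\<bar> \<le> M * Z ^ k / (fact k)\<^sup>2" and Z: "0 \<le> Z" and M: "0 \<le> M" and N: "1 \<le> N" and \<mu>: "0 < \<mu>"
    and sep: "\<And>i j. i < N \<Longrightarrow> j < N \<Longrightarrow> \<mu> / real N * \<bar>real i - real j\<bar> \<le> \<bar>y i - y j\<bar>"
    and y: "\<And>i. i < N \<Longrightarrow> 0 \<le> y i \<and> y i \<le> 1"
    and E: "\<And>i. i < N \<Longrightarrow> \<bar>\<Sum>k. d k * y i ^ k\<bar> \<le> E" and t: "0 \<le> t" "t \<le> 1"
    and r: "Z * (exp 1)\<^sup>2 / (real N)\<^sup>2 \<le> r" "0 \<le> r" "r \<le> 1/2"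
  shows "\<bar>\<Sum>k. d k * t ^ k\<bar> \<le> real N * (exp 1 * max 1 (2 / \<mu>)) ^ N * (E + 2 * M * r ^ N) + 2 * M * r ^ N"
proof -
  define D where "D = exp 1 * max 1 (2 / \<mu>)"
  \<comment> \<open>By k! \<ge> (k/e)^k the coefficient is at most M (Z e^2 / k^2)^k, so from k = N
    on the terms are dominated by a geometric series of ratio \<open>r\<close>.\<close>
  have tailk: "\<bar>d k * s ^ k\<bar> \<le> M * r ^ k" if k: "N \<le> k" and s: "0 \<le> s" "s \<le> 1" for k s
  proof -
    have k0: "0 < real k" using k N by simp
    have "real k ^ k \<le> fact k * exp (real k)" using power_le_exp_fact[of "real k" k] by (simp add: field_simps)
    also have "exp (real k) = exp 1 ^ k" by (simp add: exp_of_nat_mult[symmetric])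
    finally have f: "(real k ^ k)\<^sup>2 \<le> (fact k * exp 1 ^ k)\<^sup>2" by (intro power_mono) auto
    have "Z ^ k / (fact k)\<^sup>2 = Z ^ k * (exp 1 ^ k)\<^sup>2 / (fact k * exp 1 ^ k)\<^sup>2" by (simp add: power_mult_distrib)
    also have "\<dots> \<le> Z ^ k * (exp 1 ^ k)\<^sup>2 / (real k ^ k)\<^sup>2"
      using f k0 Z by (intro divide_left_mono mult_pos_pos mult_nonneg_nonneg) auto
    also have "\<dots> = (Z * (exp 1)\<^sup>2 / (real k)\<^sup>2) ^ k"
      by (simp add: power_divide power_mult_distrib power_mult[symmetric] mult.commute)
    also have "\<dots> \<le> r ^ k"
    proof (rule power_mono)
      have "Z * (exp 1)\<^sup>2 / (real k)\<^sup>2 \<le> Z * (exp 1)\<^sup>2 / (real N)\<^sup>2"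
        using k N Z by (intro divide_left_mono power_mono mult_pos_pos) auto
      then show "Z * (exp 1)\<^sup>2 / (real k)\<^sup>2 \<le> r" using r(1) by linarith
    qed (use Z in auto)
    finally have "M * (Z ^ k / (fact k)\<^sup>2) \<le> M * r ^ k" using M by (intro mult_left_mono)
    then have "\<bar>d k\<bar> \<le> M * r ^ k" using d[of k] by simp
    moreover have "\<bar>s ^ k\<bar> \<le> 1" using s by (simp add: power_le_one)
    ultimately have "\<bar>d k\<bar> * \<bar>s ^ k\<bar> \<le> M * r ^ k * 1" by (intro mult_mono) auto
    then show ?thesis by (simp add: abs_mult)
  qed
  have sr: "summable (\<lambda>k. M * r ^ (k + N))"
    unfolding power_add using r by (intro summable_mult summable_mult2 summable_geometric) auto
  have st: "summable (\<lambda>k. d (k + N) * s ^ (k + N))" if s: "0 \<le> s" "s \<le> 1" for s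
    by (rule summable_comparison_test'[OF sr]) (use tailk[OF _ s] in auto)
  have head: "(\<Sum>k. d k * s ^ k) = (\<Sum>k. d (k + N) * s ^ (k + N)) + (\<Sum>k<N. d k * s ^ k)"
    if s: "0 \<le> s" "s \<le> 1" for s
    by (rule suminf_split_initial_segment) (use st[OF s] summable_iff_shift in blast)
  have tail: "\<bar>\<Sum>k. d (k + N) * s ^ (k + N)\<bar> \<le> 2 * M * r ^ N" if s: "0 \<le> s" "s \<le> 1" for s
  proof -
    have "norm (\<Sum>k. d (k + N) * s ^ (k + N)) \<le> (\<Sum>k. M * r ^ (k + N))"
      by (rule norm_suminf_le[OF _ sr]) (use tailk[OF _ s] in auto)
    also have "\<dots> = M * r ^ N * (1 / (1 - r))"
    proof -
      have "(\<lambda>k. M * r ^ N * r ^ k) sums (M * r ^ N * (1 / (1 - r)))"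
        by (intro sums_mult geometric_sums) (use r in auto)
      then have "(\<lambda>k. M * r ^ (k + N)) sums (M * r ^ N * (1 / (1 - r)))"
        by (simp add: power_add mult_ac)
      then show ?thesis by (rule sums_unique[symmetric])
    qed
    also have "\<dots> \<le> M * r ^ N * 2" using r M by (intro mult_left_mono) (auto simp: field_simps)
    finally show ?thesis by simp
  qed
  define q where "q = (\<Sum>k<N. monom (d k) k)"
  have pq: "poly q s = (\<Sum>k<N. d k * s ^ k)" for s by (simp add: q_def poly_sum poly_monom)
  have "\<bar>poly q t\<bar> \<le> real N * (E + 2 * M * r ^ N) * ((2 / (\<mu> / real N)) ^ (N - 1) / fact (N - 1))"
  proof (rule lagrange_bound[OF _ _ sep y _ t])
    show "degree q < N"
      unfolding q_def using N by (intro degree_sum_less) (auto intro: le_less_trans[OF degree_monom_le])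
    show "0 < \<mu> / real N" using \<mu> N by simp
    show "\<bar>poly q (y i)\<bar> \<le> E + 2 * M * r ^ N" if i: "i < N" for i
      using head[of "y i"] tail[of "y i"] E[OF i] y[OF i] unfolding pq by linarith
  qed
  moreover have "(2 / (\<mu> / real N)) ^ (N - 1) / fact (N - 1) \<le> D ^ N"
  proof -
    have "(2 / \<mu>) ^ (N - 1) \<le> (max 1 (2 / \<mu>)) ^ (N - 1)" using \<mu> by (intro power_mono) auto
    also have "\<dots> \<le> (max 1 (2 / \<mu>)) ^ N" by (intro power_increasing) auto
    finally have 1: "(2 / \<mu>) ^ (N - 1) \<le> (max 1 (2 / \<mu>)) ^ N" .
    have "real N ^ (N - 1) / fact (N - 1) \<le> exp (real N)" by (rule power_le_exp_fact) simp
    then have 2: "real N ^ (N - 1) / fact (N - 1) \<le> exp 1 ^ N" by (simp add: exp_of_nat_mult[symmetric])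
    have "(2 / (\<mu> / real N)) ^ (N - 1) / fact (N - 1) = (2 / \<mu>) ^ (N - 1) * (real N ^ (N - 1) / fact (N - 1))"
      by (simp add: power_divide power_mult_distrib)
    also have "\<dots> \<le> (max 1 (2 / \<mu>)) ^ N * exp 1 ^ N" using 1 2 by (intro mult_mono) auto
    also have "\<dots> = D ^ N" by (simp add: D_def power_mult_distrib mult.commute)
    finally show ?thesis .
  qed
  moreover have "0 \<le> E + 2 * M * r ^ N"
  proof -
    have "0 \<le> E" using E[of 0] N by linarith
    then show ?thesis using M r by simp
  qed
  ultimately have "\<bar>poly q t\<bar> \<le> real N * (E + 2 * M * r ^ N) * D ^ N"
    by (meson mult_left_mono mult_nonneg_nonneg of_nat_0_le_iff order_trans)
  then show ?thesis
    using head[OF t] tail[OF t] unfolding pq D_def[symmetric] by (simp add: mult_ac)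
qed

section \<open>Eigenvalue counting\<close>

lemma square_int_sum:
  "finite F \<Longrightarrow> (\<And>b. b \<in> F \<Longrightarrow> square_int (f b)) \<Longrightarrow> square_int (\<lambda>x. \<Sum>b\<in>F. f b x)"
  by (induction F rule: finite_induct) (auto intro: square_int_zero square_int_add)

lemma abs_L2_sum:
  "finite F \<Longrightarrow> (\<And>b. b \<in> F \<Longrightarrow> square_int (f b)) \<Longrightarrow> (\<Sum>b\<in>F. abs_L2 (f b)) = abs_L2 (\<lambda>x. \<Sum>b\<in>F. f b x)"
proof (induction F rule: finite_induct)
  case empty
  then show ?case by (simp add: zero_L2.abs_eq[symmetric] zero_L2_def[symmetric])
next
  case (insert b F)
  then show ?case by (simp add: abs_L2_add square_int_sum)
qed

lemma cutoff_norm_abs: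
  assumes f: "square_int f" and \<omega>: "\<omega> \<in> sets lebesgue"
  shows "(norm (cutoff \<omega> (abs_L2 f)))\<^sup>2 = (\<integral>x. indicator \<omega> x * (f x)\<^sup>2 \<partial>unit_leb)"
proof -
  have [measurable]: "f \<in> borel_measurable unit_leb" "rep_L2 (abs_L2 f) \<in> borel_measurable unit_leb"
    using f square_int_rep by (auto simp: square_int_def)
  have [measurable]: "(indicator \<omega> :: real \<Rightarrow> real) \<in> borel_measurable unit_leb"
    using \<omega> by (intro measurable_restrict_space1 borel_measurable_indicator)
  show ?thesis
    unfolding norm_cutoff_eq[OF \<omega>]
    by (rule integral_cong_AE) (use rep_abs_L2[OF f] in \<open>auto elim: eventually_mono\<close>)
qed

text \<open>The minimum of v^2 over [a,b] is at most its mean value.\<close>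

lemma exists_small_value:
  fixes v :: "real \<Rightarrow> real"
  assumes v: "continuous_on {a..b} v" and ab: "0 < a" "a < b" "b < 1" and \<omega>: "{a..b} \<subseteq> \<omega>" "\<omega> \<in> sets lebesgue"
    and i: "integrable unit_leb (\<lambda>x. (v x)\<^sup>2)"
  obtains x where "a \<le> x" "x \<le> b" "(v x)\<^sup>2 * (b - a) \<le> (\<integral>x. indicator \<omega> x * (v x)\<^sup>2 \<partial>unit_leb)"
proof -
  have "continuous_on {a..b} (\<lambda>x. (v x)\<^sup>2)" by (intro continuous_intros v)
  then obtain x where x: "x \<in> {a..b}" "\<And>y. y \<in> {a..b} \<Longrightarrow> (v x)\<^sup>2 \<le> (v y)\<^sup>2"
    using continuous_attains_inf[of "{a..b}" "\<lambda>x. (v x)\<^sup>2"] ab by auto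
  have i1: "integrable unit_leb (\<lambda>s. indicator {a..b} s * (v x)\<^sup>2)"
    by (rule integrable_indicator_unit) auto
  have "(v x)\<^sup>2 * (b - a) = integral {a..b} (\<lambda>_. (v x)\<^sup>2)" using ab by simp
  also have "\<dots> = (\<integral>s. indicator {a..b} s * (v x)\<^sup>2 \<partial>unit_leb)"
    by (rule integral_unit_indicator[symmetric, OF _ _ i1]) (use ab in auto)
  also have "\<dots> \<le> (\<integral>s. indicator \<omega> s * (v s)\<^sup>2 \<partial>unit_leb)"
  proof (rule integral_mono[OF i1 integrable_indicator_unit[OF \<omega>(2) i]])
    show "indicator {a..b} s * (v x)\<^sup>2 \<le> indicator \<omega> s * (v s)\<^sup>2" for s
      using x(2)[of s] \<omega>(1) by (auto simp: indicator_def)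
  qed
  finally show ?thesis using that x(1) by auto
qed

context degenerate_basis
begin

text \<open>The representative of \<open>b\<close> that is continuous on (0,1), taken from b =
  \<lambda> K b; pointwise values of eigenfunctions refer to it.\<close>

definition eb :: "L2 \<Rightarrow> real \<Rightarrow> real" where "eb b x = lam b * sol (rep_L2 b) x"

lemma
  assumes b: "b \<in> B"
  shows square_int_eb: "square_int (eb b)" and abs_eb: "abs_L2 (eb b) = b"
    and sol_eb: "sol (eb b) = sol (rep_L2 b)"
proof -
  note s = square_int_sol(1)[OF square_int_rep, of b]
  show sq: "square_int (eb b)" unfolding eb_def[abs_def] by (rule square_int_scale[OF s])
  have "abs_L2 (eb b) = lam b *\<^sub>R Kop b"
    unfolding eb_def[abs_def] Kop_def abs_L2_scaleR[OF s] ..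
  then show abs: "abs_L2 (eb b) = b" using Kop_basis[OF b] lam_pos[OF b] by simp
  have "abs_L2 (eb b) = abs_L2 (rep_L2 b)" using abs by simp
  then show "sol (eb b) = sol (rep_L2 b)"
    using abs_L2_eq_iff[OF sq square_int_rep[of b]] by (intro sol_cong sq square_int_rep) blast
qed

definition nb :: "L2 \<Rightarrow> real" where
  "nb b = (SOME n. \<forall>x. 0 < x \<longrightarrow> x < 1 \<longrightarrow> eb b x = n * \<phi> (lam b) x)"

lemma eb_phi:
  assumes b: "b \<in> B" and x: "0 < x" "x < 1"
  shows "eb b x = nb b * \<phi> (lam b) x"
proof -
  obtain n where "\<And>x. 0 < x \<Longrightarrow> x < 1 \<Longrightarrow> sol (eb b) x = n * \<phi> (lam b) x"
    by (rule eigenfunction_proportional[OF square_int_eb[OF b], of "lam b"])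
      (simp add: sol_eb[OF b] eb_def, blast)
  then have "\<exists>n. \<forall>x. 0 < x \<longrightarrow> x < 1 \<longrightarrow> eb b x = n * \<phi> (lam b) x"
    by (intro exI[of _ "lam b * n"]) (simp add: eb_def sol_eb[OF b])
  from someI_ex[OF this] x show ?thesis unfolding nb_def by blast
qed

text \<open>Two eigenfunctions for the same eigenvalue are multiples of the same \<phi>, hence
  linearly dependent, which contradicts orthonormality.\<close>

lemma simple_spectrum:
  assumes b: "b \<in> B" and c: "c \<in> B" and eq: "lam b = lam c"
  shows "b = c"
proof (rule ccontr)
  assume ne: "b \<noteq> c"
  have "abs_L2 (\<lambda>x. nb c * eb b x) = abs_L2 (\<lambda>x. nb b * eb c x)"
    by (rule abs_L2_eqI) (use square_int_scale square_int_eb b c eb_phi eq in \<open>auto intro!: AE_I2\<close>)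
  then have e: "nb c *\<^sub>R b = nb b *\<^sub>R c"
    using abs_L2_scaleR[OF square_int_eb[OF b], of "nb c"] abs_L2_scaleR[OF square_int_eb[OF c], of "nb b"]
      abs_eb[OF b] abs_eb[OF c] by simp
  have "nb c = (nb c *\<^sub>R b) \<bullet> b" using inner_basis[OF b b] by simp
  also have "\<dots> = 0" unfolding e using inner_basis[OF c b] ne by simp
  finally have "nb c = 0" .
  then have "abs_L2 (eb c) = abs_L2 (\<lambda>x. 0)"
    by (intro abs_L2_eqI square_int_eb c square_int_zero AE_I2) (simp add: eb_phi[OF c])
  then have "c = 0" using abs_eb[OF c] by (simp add: zero_L2.abs_eq[symmetric] zero_L2_def[symmetric])
  then show False using norm1[OF c] by simp
qed

lemma heat_sg: "0 \<le> t \<Longrightarrow> heat_semigroup \<alpha> t u = sg t u"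
  by (rule heat_eq_sg[OF simple_spectrum])

lemma G_near_1:
  assumes "0 \<le> l" "0 \<le> y" "l * y / \<beta>\<^sup>2 \<le> 1/4"
  shows "1/2 \<le> G l y"
proof -
  let ?z = "l * y / \<beta>\<^sup>2"
  have z: "0 \<le> ?z" using assms by simp
  have sz: "summable (\<lambda>k. inverse (fact (Suc k)) * ?z ^ Suc k)"
    using summable_exp[of ?z] by (subst summable_Suc_iff)
  have "G l y - 1 = (\<Sum>k. ps l (Suc k) * y ^ Suc k)"
    unfolding G_def using suminf_split_head[OF summable_ps, of l y] by (simp add: ps_def)
  then have "\<bar>G l y - 1\<bar> \<le> (\<Sum>k. inverse (fact (Suc k)) * ?z ^ Suc k)"
    using norm_suminf_le[OF _ sz, of "\<lambda>k. ps l (Suc k) * y ^ Suc k"] ps_bound'[of l "Suc _" y] assms by simp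
  also have "\<dots> = exp ?z - 1"
    using suminf_split_head[OF summable_exp, of ?z] by (simp add: exp_def divide_inverse mult.commute)
  also have "\<dots> \<le> ?z + ?z\<^sup>2" using exp_bound[of ?z] z assms(3) by simp
  also have "\<dots> \<le> 1/4 + (1/4)\<^sup>2" using assms(3) z by (intro add_mono power_mono) auto
  finally have "\<bar>G l y - 1\<bar> \<le> 1/2" by (simp add: power2_eq_square)
  then show ?thesis by linarith
qed

definition r0 :: nat where "r0 = nat \<lceil>(p + \<kappa>) / \<beta>\<rceil>"

text \<open>The normalising factor is read off at a point so close to 0 that \<open>G\<close> is at
  least 1/2 there, where the eigenfunction is at most \<lambda> times the singular bound for
  \<open>sol\<close>.\<close>

lemma nb_bound:
  assumes b: "b \<in> B"
  shows "\<bar>nb b\<bar> \<le> 4 / p * (4 / \<beta>\<^sup>2) ^ r0 * (1 + lam b) ^ (r0 + 1)"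
proof -
  define l where "l = lam b"
  have l: "0 < l" using lam_pos[OF b] by (simp add: l_def)
  \<comment> \<open>Of order 1/\<lambda> for large \<lambda>, so that l y / \<beta>^2 \<le> 1/4; the
    summand 1 keeps y below 1 for small eigenvalues.\<close>
  define y where "y = \<beta>\<^sup>2 / (4 * (1 + l))"
  have b2: "0 < \<beta>\<^sup>2" "\<beta>\<^sup>2 < 4"
    using \<beta> power_strict_mono[of \<beta> 2 2] by auto
  have y: "0 < y" "y < 1" using b2 l by (auto simp: y_def field_simps)
  define x where "x = y powr (1 / \<beta>)"
  have x: "0 < x" "x < 1" using y \<beta> powr_less_mono2[of "1 / \<beta>" y 1] by (auto simp: x_def)
  have xb: "x powr \<beta> = y" using y \<beta> by (simp add: x_def powr_powr)
  have "l * y / \<beta>\<^sup>2 = l / (4 * (1 + l))" using b2 by (simp add: y_def)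
  also have "\<dots> \<le> 1/4" using l by (simp add: divide_le_eq)
  finally have "l * y / \<beta>\<^sup>2 \<le> 1/4" .
  then have G: "1/2 \<le> G l y" using l y by (intro G_near_1) auto
  have up: "\<bar>eb b x\<bar> \<le> l * (2 / p * x powr - p)"
  proof -
    have "l * \<bar>sol (rep_L2 b) x\<bar> \<le> l * (2 / p * nrm (rep_L2 b) * x powr - p)"
      using l by (intro mult_left_mono sol_bound[OF square_int_rep x]) auto
    then show ?thesis using norm1[OF b] l by (simp add: eb_def l_def[symmetric] abs_mult)
  qed
  have "\<bar>nb b\<bar> * (x powr \<kappa> * (1/2)) \<le> \<bar>nb b\<bar> * (x powr \<kappa> * G l y)"
    using G by (intro mult_left_mono) auto
  also have "\<dots> = \<bar>eb b x\<bar>" using G by (simp add: eb_phi[OF b x] \<phi>_def xb l_def[symmetric] abs_mult)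
  finally have "\<bar>nb b\<bar> * (x powr \<kappa> * (1/2)) \<le> l * (2 / p * x powr - p)" using up by linarith
  then have "\<bar>nb b\<bar> \<le> l * (2 / p * x powr - p) / (x powr \<kappa> * (1/2))"
    by (subst pos_le_divide_eq) (use x in auto)
  also have "\<dots> = 4 / p * l * x powr - (p + \<kappa>)"
  proof -
    have "x powr - (p + \<kappa>) = x powr - p / x powr \<kappa>" by (simp add: powr_diff[symmetric])
    then show ?thesis by simp
  qed
  also have "x powr - (p + \<kappa>) = (1 / y) powr ((p + \<kappa>) / \<beta>)"
  proof -
    have e: "1 / \<beta> * - (p + \<kappa>) = - ((p + \<kappa>) / \<beta>)"
      by (simp only: times_divide_eq_left mult_1 minus_divide_left)
    have "x powr - (p + \<kappa>) = y powr - ((p + \<kappa>) / \<beta>)" unfolding x_def powr_powr e ..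
    then show ?thesis using y by (simp only: powr_minus) (simp add: powr_divide inverse_eq_divide)
  qed
  also have "4 / p * l * (1 / y) powr ((p + \<kappa>) / \<beta>) \<le> 4 / p * (1 + l) * (1 / y) ^ r0"
  proof (intro mult_mono)
    have "(p + \<kappa>) / \<beta> \<le> real r0" by (simp add: r0_def) linarith
    then have "(1 / y) powr ((p + \<kappa>) / \<beta>) \<le> (1 / y) powr real r0" using y by (intro powr_mono) auto
    then show "(1 / y) powr ((p + \<kappa>) / \<beta>) \<le> (1 / y) ^ r0" using y by (simp add: powr_realpow)
  qed (use l p in auto)
  also have "1 / y = 4 / \<beta>\<^sup>2 * (1 + l)" by (simp add: y_def)
  also have "4 / p * (1 + l) * (4 / \<beta>\<^sup>2 * (1 + l)) ^ r0 = 4 / p * (4 / \<beta>\<^sup>2) ^ r0 * (1 + lam b) ^ (r0 + 1)"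
    by (simp only: power_mult_distrib power_add power_one_right l_def mult_ac)
  finally show ?thesis .
qed

text \<open>Bessel's inequality for the functional u \<mapsto> (K u)(x), whose norm
  \<open>sol_bound\<close> controls; the test vector is the combination with coefficients
  \<open>ev b\<close>.\<close>

lemma count_aux:
  assumes F: "finite F" "F \<subseteq> B" and x: "0 < x" "x < 1"
  shows "(\<Sum>b\<in>F. (sol (rep_L2 b) x)\<^sup>2) \<le> (2 / p * x powr - p)\<^sup>2"
proof -
  define ev where "ev u = sol (rep_L2 u) x" for u
  have "linear ev"
  proof (rule linearI)
    show "ev (u + v) = ev u + ev v" for u v
      unfolding ev_def sol_add[OF square_int_rep square_int_rep x, symmetric]
        sol_cong(1)[OF square_int_rep square_int_add[OF square_int_rep square_int_rep] rep_L2_add] ..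
    show "ev (c *\<^sub>R u) = c *\<^sub>R ev u" for c u
      unfolding ev_def sol_cong(1)[OF square_int_rep square_int_scale[OF square_int_rep] rep_L2_scaleR]
      by (simp add: sol_scale[OF square_int_rep])
  qed
  let ?S = "\<Sum>b\<in>F. (ev b)\<^sup>2" and ?u = "\<Sum>b\<in>F. ev b *\<^sub>R b"
  have "ev ?u = ?S" by (simp add: linear_sum[OF \<open>linear ev\<close>] linear_scale[OF \<open>linear ev\<close>] power2_eq_square)
  moreover have "\<bar>ev ?u\<bar> \<le> 2 / p * norm ?u * x powr - p"
    unfolding ev_def using sol_bound[OF square_int_rep x] by simp
  moreover have S0: "0 \<le> ?S" by (simp add: sum_nonneg)
  moreover have nu: "(norm ?u)\<^sup>2 = ?S" by (rule norm_sum_basis[OF F])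
  ultimately have "norm ?u * norm ?u \<le> (2 / p * x powr - p) * norm ?u"
    by (simp add: power2_eq_square mult_ac)
  then have "norm ?u \<le> 2 / p * x powr - p"
  proof (cases "norm ?u = 0")
    case True
    then show ?thesis using p by simp
  next
    case False
    then have "0 < norm ?u" by (metis norm_ge_zero less_eq_real_def)
    then show ?thesis using \<open>norm ?u * norm ?u \<le> (2 / p * x powr - p) * norm ?u\<close> by (rule mult_right_le_imp_le[rotated])
  qed
  then have "(norm ?u)\<^sup>2 \<le> (2 / p * x powr - p)\<^sup>2" by (intro power_mono) auto
  then show ?thesis unfolding nu by (simp add: ev_def)
qed

text \<open>Integrating \<open>count_aux\<close> over x bounds the sums of 1/\<lambda>^2, a
  Hilbert-Schmidt estimate for K, and each eigenvalue up to \<Lambda> contributes at least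
  1/\<Lambda>^2.\<close>

lemma count_bound:
  assumes F: "finite F" "F \<subseteq> B" and \<Lambda>: "\<And>b. b \<in> F \<Longrightarrow> lam b \<le> \<Lambda>"
  shows "real (card F) \<le> (2 / p)\<^sup>2 / (1 - 2 * p) * \<Lambda>\<^sup>2"
proof (cases "F = {}")
  case False
  then obtain b0 where "b0 \<in> F" by blast
  then have \<Lambda>0: "0 < \<Lambda>" using lam_pos[of b0] \<Lambda>[of b0] F(2) by auto
  note s = square_int_sol(1)[OF square_int_rep]
  have Kb: "(\<integral>x. (sol (rep_L2 b) x)\<^sup>2 \<partial>unit_leb) = (1 / lam b)\<^sup>2" if "b \<in> F" for b
  proof -
    have b: "b \<in> B" using that F by blast
    have "(\<integral>x. (sol (rep_L2 b) x)\<^sup>2 \<partial>unit_leb) = (norm (Kop b))\<^sup>2"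
      unfolding Kop_def norm_abs_L2_sq[OF s] ..
    then show ?thesis using Kop_basis[OF b] norm1[OF b] by (simp add: power_divide)
  qed
  have "real (card F) * (1 / \<Lambda>)\<^sup>2 = (\<Sum>b\<in>F. (1 / \<Lambda>)\<^sup>2)" by simp
  also have "\<dots> \<le> (\<Sum>b\<in>F. (1 / lam b)\<^sup>2)"
    by (intro sum_mono power_mono divide_left_mono) (use \<Lambda> \<Lambda>0 lam_pos F in auto)
  also have "\<dots> = (\<integral>x. (\<Sum>b\<in>F. (sol (rep_L2 b) x)\<^sup>2) \<partial>unit_leb)"
    using s by (subst Bochner_Integration.integral_sum) (auto simp: Kb square_int_def)
  also have "\<dots> \<le> (\<integral>x. (2 / p)\<^sup>2 * x powr (- (2 * p)) \<partial>unit_leb)"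
  proof (rule integral_mono)
    show "integrable unit_leb (\<lambda>x. \<Sum>b\<in>F. (sol (rep_L2 b) x)\<^sup>2)"
      using s by (intro Bochner_Integration.integrable_sum) (auto simp: square_int_def)
    show "integrable unit_leb (\<lambda>x. (2 / p)\<^sup>2 * x powr (- (2 * p)))"
      using p by (intro integrable_mult_right integrable_powr_unit) auto
    show "(\<Sum>b\<in>F. (sol (rep_L2 b) x)\<^sup>2) \<le> (2 / p)\<^sup>2 * x powr (- (2 * p))" if "x \<in> space unit_leb" for x
      using count_aux[OF F, of x] that by (simp add: power_mult_distrib power_divide powr_sq)
  qed
  also have "\<dots> = (2 / p)\<^sup>2 / (1 - 2 * p)" using integral_powr_unit[of "- (2 * p)"] p by simp
  finally show ?thesis using \<Lambda>0 by (simp add: power_divide field_simps)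
qed (use p in simp)

lemma finite_low:
  "finite {b \<in> B. lam b \<le> \<Lambda>}" (is "finite ?F")
  "real (card {b \<in> B. lam b \<le> \<Lambda>}) \<le> (2 / p)\<^sup>2 / (1 - 2 * p) * \<Lambda>\<^sup>2"
proof -
  show f: "finite ?F"
  proof (rule ccontr)
    assume inf: "infinite ?F"
    obtain n :: nat where n: "(2 / p)\<^sup>2 / (1 - 2 * p) * \<Lambda>\<^sup>2 < real n" using reals_Archimedean2 by blast
    obtain F where F: "F \<subseteq> ?F" "finite F" "card F = n" using infinite_arbitrarily_large[OF inf] by blast
    have "real (card F) \<le> (2 / p)\<^sup>2 / (1 - 2 * p) * \<Lambda>\<^sup>2"
      by (rule count_bound[OF F(2)]) (use F in auto)
    then show False using n F by simp
  qed
  show "real (card ?F) \<le> (2 / p)\<^sup>2 / (1 - 2 * p) * \<Lambda>\<^sup>2"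
    by (rule count_bound[OF f]) auto
qed

lemma low_expansion:
  assumes u: "\<And>b. b \<in> B \<Longrightarrow> \<Lambda> < lam b \<Longrightarrow> u \<bullet> b = 0"
  shows "u = (\<Sum>b\<in>{b \<in> B. lam b \<le> \<Lambda>}. (u \<bullet> b) *\<^sub>R b)"
  by (rule eqI) (use u inner_sum_basis[OF finite_low(1)] in force)

end

section \<open>The spectral inequality\<close>

context degenerate_basis
begin

text \<open>The coefficients \<open>d k\<close> collect those of the single eigenfunctions. In the
  power of s, the number of modes accounts for s^4 and their normalising factors for s^(2 r0 +
  2).\<close>

lemma low_frequency_expansion:
  fixes s :: nat
  assumes s: "1 \<le> s" and u: "\<And>b. b \<in> B \<Longrightarrow> (real s)\<^sup>2 < lam b \<Longrightarrow> u \<bullet> b = 0"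
  obtains v d where "square_int v" "abs_L2 v = u" "continuous_on {0<..<1} v"
    "\<And>x. 0 < x \<Longrightarrow> x < 1 \<Longrightarrow> v x = x powr \<kappa> * (\<Sum>k. d k * (x powr \<beta>) ^ k)"
    "\<And>k. \<bar>d k\<bar> \<le> ((2 / p)\<^sup>2 / (1 - 2 * p) * (4 / p * (4 / \<beta>\<^sup>2) ^ r0 * 2 ^ (r0 + 1)) * real s ^ (2 * r0 + 6) * norm u)
      * ((real s)\<^sup>2 / \<beta>\<^sup>2) ^ k / (fact k)\<^sup>2"
proof -
  define F where "F = {b \<in> B. lam b \<le> (real s)\<^sup>2}"
  have F: "finite F" "F \<subseteq> B" and cF: "real (card F) \<le> (2 / p)\<^sup>2 / (1 - 2 * p) * ((real s)\<^sup>2)\<^sup>2"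
    using finite_low[of "(real s)\<^sup>2"] by (auto simp: F_def)
  define v where "v x = (\<Sum>b\<in>F. (u \<bullet> b) * eb b x)" for x
  have sb: "square_int (\<lambda>x. (u \<bullet> b) * eb b x)" if "b \<in> F" for b
    using square_int_scale square_int_eb that F(2) by blast
  have sv: "square_int v" unfolding v_def[abs_def] by (rule square_int_sum[OF F(1) sb])
  have "abs_L2 v = (\<Sum>b\<in>F. abs_L2 (\<lambda>x. (u \<bullet> b) * eb b x))"
    unfolding v_def[abs_def] by (rule abs_L2_sum[OF F(1) sb, symmetric])
  also have "\<dots> = (\<Sum>b\<in>F. (u \<bullet> b) *\<^sub>R b)"
  proof (rule sum.cong[OF refl])
    fix b assume "b \<in> F"
    then have b: "b \<in> B" using F(2) by blast
    show "abs_L2 (\<lambda>x. (u \<bullet> b) * eb b x) = (u \<bullet> b) *\<^sub>R b"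
      using abs_L2_scaleR[OF square_int_eb[OF b], of "u \<bullet> b"] abs_eb[OF b] by simp
  qed
  also have "\<dots> = u" unfolding F_def by (rule low_expansion[symmetric]) (use u in auto)
  finally have av: "abs_L2 v = u" .
  have cv: "continuous_on {0<..<1} v"
    unfolding v_def[abs_def] eb_def by (intro continuous_intros continuous_sol square_int_rep)
  define a where "a b = (u \<bullet> b) * nb b" for b
  define d where "d k = (\<Sum>b\<in>F. a b * ps (lam b) k)" for k
  have vd: "v x = x powr \<kappa> * (\<Sum>k. d k * (x powr \<beta>) ^ k)" if x: "0 < x" "x < 1" for x
  proof -
    have "v x = (\<Sum>b\<in>F. a b * (x powr \<kappa> * G (lam b) (x powr \<beta>)))"
      unfolding v_def by (rule sum.cong) (use eb_phi x F in \<open>auto simp: a_def \<phi>_def\<close>)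
    also have "\<dots> = x powr \<kappa> * (\<Sum>b\<in>F. a b * G (lam b) (x powr \<beta>))"
      by (simp add: sum_distrib_left mult_ac)
    also have "(\<Sum>b\<in>F. a b * G (lam b) (x powr \<beta>)) = (\<Sum>b\<in>F. \<Sum>k. a b * (ps (lam b) k * (x powr \<beta>) ^ k))"
      unfolding G_def by (intro sum.cong refl suminf_mult[symmetric] summable_ps)
    also have "\<dots> = (\<Sum>k. \<Sum>b\<in>F. a b * (ps (lam b) k * (x powr \<beta>) ^ k))"
      by (rule suminf_sum[symmetric]) (intro summable_mult summable_ps)
    also have "\<dots> = (\<Sum>k. d k * (x powr \<beta>) ^ k)"
      by (simp add: d_def sum_distrib_right mult.assoc)
    finally show ?thesis .
  qed
  define N0 where "N0 = 4 / p * (4 / \<beta>\<^sup>2) ^ r0 * 2 ^ (r0 + 1)"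
  have N0: "0 \<le> N0" using p by (simp add: N0_def)
  have ab: "\<bar>a b\<bar> \<le> norm u * (N0 * real s ^ (2 * r0 + 2))" if "b \<in> F" for b
  proof -
    have b: "b \<in> B" and lb: "lam b \<le> (real s)\<^sup>2" using that by (auto simp: F_def)
    have "1 \<le> (real s)\<^sup>2" using s by simp
    then have "1 + lam b \<le> 2 * (real s)\<^sup>2" using lb by linarith
    then have "(1 + lam b) ^ (r0 + 1) \<le> (2 * (real s)\<^sup>2) ^ (r0 + 1)"
      using lam_pos[OF b] by (intro power_mono) auto
    also have "\<dots> = 2 ^ (r0 + 1) * real s ^ (2 * r0 + 2)"
      unfolding power_mult_distrib power_mult[symmetric] by simp
    finally have "4 / p * (4 / \<beta>\<^sup>2) ^ r0 * (1 + lam b) ^ (r0 + 1) \<le> 4 / p * (4 / \<beta>\<^sup>2) ^ r0 * (2 ^ (r0 + 1) * real s ^ (2 * r0 + 2))"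
      using p by (intro mult_left_mono) auto
    then have "\<bar>nb b\<bar> \<le> N0 * real s ^ (2 * r0 + 2)"
      using nb_bound[OF b] by (simp add: N0_def mult_ac)
    moreover have "\<bar>u \<bullet> b\<bar> \<le> norm u" using Cauchy_Schwarz_ineq2[of u b] norm1[OF b] by simp
    ultimately show ?thesis unfolding a_def abs_mult by (intro mult_mono) auto
  qed
  have "\<bar>d k\<bar> \<le> ((2 / p)\<^sup>2 / (1 - 2 * p) * N0 * real s ^ (2 * r0 + 6) * norm u) * ((real s)\<^sup>2 / \<beta>\<^sup>2) ^ k / (fact k)\<^sup>2" for k
  proof -
    let ?c = "((real s)\<^sup>2 / \<beta>\<^sup>2) ^ k / (fact k)\<^sup>2"
    have "\<bar>d k\<bar> \<le> (\<Sum>b\<in>F. \<bar>a b * ps (lam b) k\<bar>)" unfolding d_def by (rule sum_abs)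
    also have "\<dots> \<le> (\<Sum>b\<in>F. norm u * (N0 * real s ^ (2 * r0 + 2)) * ?c)"
    proof (rule sum_mono)
      fix b assume bF: "b \<in> F"
      then have b: "b \<in> B" and lb: "lam b \<le> (real s)\<^sup>2" by (auto simp: F_def)
      have "\<bar>ps (lam b) k\<bar> \<le> (lam b / \<beta>\<^sup>2) ^ k / (fact k)\<^sup>2"
        using ps_bound[of "lam b" k 1] lam_pos[OF b] by simp
      also have "\<dots> \<le> ?c"
        using lb lam_pos[OF b] by (intro divide_right_mono power_mono) auto
      finally show "\<bar>a b * ps (lam b) k\<bar> \<le> norm u * (N0 * real s ^ (2 * r0 + 2)) * ?c"
        unfolding abs_mult using ab[OF bF] N0 by (intro mult_mono) auto
    qed
    also have "\<dots> = real (card F) * (norm u * (N0 * real s ^ (2 * r0 + 2)) * ?c)" by simp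
    also have "\<dots> \<le> (2 / p)\<^sup>2 / (1 - 2 * p) * ((real s)\<^sup>2)\<^sup>2 * (norm u * (N0 * real s ^ (2 * r0 + 2)) * ?c)"
      using cF N0 by (intro mult_right_mono) auto
    also have "\<dots> = ((2 / p)\<^sup>2 / (1 - 2 * p) * N0 * real s ^ (2 * r0 + 6) * norm u) * ?c"
    proof -
      have e6: "((real s)\<^sup>2)\<^sup>2 * real s ^ (2 * r0 + 2) = real s ^ (2 * r0 + 6)"
      proof -
        have "2 * 2 + (2 * r0 + 2) = 2 * r0 + (6 :: nat)" by simp
        then show ?thesis by (simp only: power_mult[symmetric] power_add[symmetric])
      qed
      show ?thesis unfolding e6[symmetric] by (simp only: mult_ac)
    qed
    finally show ?thesis by simp
  qed
  then show ?thesis using that[OF sv av cv vd] unfolding N0_def by blast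
qed

text \<open>Mean value theorem: since \<beta> < 2 and \<xi> < 1, \<xi>^(\<beta> - 1) \<ge> \<xi>
  \<ge> x1.\<close>

lemma powr_separation:
  assumes x: "0 < x1" "x1 \<le> x" "x \<le> z" "z < 1"
  shows "\<beta> * x1 * (z - x) \<le> z powr \<beta> - x powr \<beta>"
proof (cases "x = z")
  case False
  have "\<exists>\<xi>. \<xi> > x \<and> \<xi> < z \<and> z powr \<beta> - x powr \<beta> = (z - x) * (\<beta> * \<xi> powr (\<beta> - 1))"
    by (rule MVT2) (use x False in \<open>auto intro!: has_real_derivative_powr\<close>)
  then obtain \<xi> where \<xi>: "x < \<xi>" "\<xi> < z" "z powr \<beta> - x powr \<beta> = (z - x) * (\<beta> * \<xi> powr (\<beta> - 1))" by blast
  have "\<xi> powr 1 \<le> \<xi> powr (\<beta> - 1)" using \<xi> x \<beta> by (intro powr_mono') auto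
  then have "x1 \<le> \<xi> powr (\<beta> - 1)" using \<xi> x by simp
  then have "(z - x) * (\<beta> * x1) \<le> (z - x) * (\<beta> * \<xi> powr (\<beta> - 1))"
    using x \<beta> by (intro mult_left_mono) auto
  then show ?thesis unfolding \<xi>(3) by (simp add: mult_ac)
qed simp

text \<open>[x1,x2] is cut into 2 N cells and only every second one receives a node, so neighbouring
  nodes are at least one cell apart and distances grow linearly in |i - j|.\<close>

lemma nodes_separated:
  assumes x1: "0 < x1" "x1 < x2" "x2 < 1" and N: "1 \<le> N"
    and x: "\<And>i. i < N \<Longrightarrow> x1 + 2 * real i * ((x2 - x1) / (2 * real N)) \<le> x i \<and>
      x i \<le> x1 + (2 * real i + 1) * ((x2 - x1) / (2 * real N))"
    and ij: "i < N" "j < N"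
  shows "\<beta> * x1 * (x2 - x1) / 2 / real N * \<bar>real i - real j\<bar> \<le> \<bar>x i powr \<beta> - x j powr \<beta>\<bar>"
proof -
  define h where "h = (x2 - x1) / (2 * real N)"
  have h: "0 < h" using x1 N by (simp add: h_def)
  have Nh: "2 * real N * h = x2 - x1" using N by (simp add: h_def)
  have in12: "x1 \<le> x i \<and> x i < 1" if "i < N" for i
  proof -
    have "(2 * real i + 1) * h \<le> 2 * real N * h" using that h by (intro mult_right_mono) auto
    moreover have "0 \<le> 2 * real i * h" using h by simp
    ultimately show ?thesis using x[OF that] Nh x1 unfolding h_def[symmetric] by linarith
  qed
  have *: "\<beta> * x1 * h * (real j - real i) \<le> x j powr \<beta> - x i powr \<beta>" if "i < j" "i < N" "j < N" for i j
  proof -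
    have "1 * h \<le> (real j - real i) * h" using that h by (intro mult_right_mono) auto
    then have "(real j - real i) * h \<le> x j - x i"
      using x[OF that(2)] x[OF that(3)] unfolding h_def[symmetric] by (simp add: algebra_simps)
    then have "\<beta> * x1 * ((real j - real i) * h) \<le> \<beta> * x1 * (x j - x i)"
      using \<beta> x1 by (intro mult_left_mono) auto
    also have "\<dots> \<le> x j powr \<beta> - x i powr \<beta>"
    proof (rule powr_separation)
      have "0 \<le> (real j - real i) * h" using that h by simp
      then show "x i \<le> x j" using \<open>(real j - real i) * h \<le> x j - x i\<close> by linarith
    qed (use in12 that x1 in auto)
    finally show ?thesis by (simp add: mult_ac)
  qed
  have e: "\<beta> * x1 * (x2 - x1) / 2 / real N = \<beta> * x1 * h" by (simp add: h_def)
  show ?thesis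
    unfolding e using *[of i j] *[of j i] ij by (cases i j rule: linorder_cases) (auto simp: algebra_simps)
qed

text \<open>Interpolation leaves a truncation error proportional to \<open>norm u\<close> itself,
  with a factor decreasing geometrically in the number N = L s of nodes. For L large enough it is at
  most norm u / 2 and is absorbed on the left.\<close>

theorem spectral_inequality:
  assumes \<omega>: "open \<omega>" "\<omega> \<noteq> {}" "\<omega> \<subseteq> {0<..<1}"
  obtains C where "0 < C" "\<And>(s::nat) u. 1 \<le> s \<Longrightarrow> (\<And>b. b \<in> B \<Longrightarrow> (real s)\<^sup>2 < lam b \<Longrightarrow> u \<bullet> b = 0) \<Longrightarrow>
    norm u \<le> exp (C * real s) * norm (cutoff \<omega> u)"
proof -
  obtain x0 where x0: "x0 \<in> \<omega>" using \<omega>(2) by blast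
  then obtain e where e: "e > 0" "cball x0 e \<subseteq> \<omega>" using \<omega>(1) open_contains_cball by blast
  define x1 where "x1 = x0 - e"
  define x2 where "x2 = x0 + e"
  have sub: "{x1..x2} \<subseteq> \<omega>" using e by (auto simp: x1_def x2_def cball_def dist_real_def subset_iff)
  have x12: "0 < x1" "x1 < x2" "x2 < 1"
  proof -
    have "x1 \<in> {x1..x2}" "x2 \<in> {x1..x2}" using e by (auto simp: x1_def x2_def)
    then have "x1 \<in> {0<..<1}" "x2 \<in> {0<..<1}" using sub \<omega>(3) by blast+
    then show "0 < x1" "x1 < x2" "x2 < 1" using e by (auto simp: x1_def x2_def)
  qed
  define w where "w = x2 - x1"
  have w: "0 < w" using x12 by (simp add: w_def)
  have \<omega>m: "\<omega> \<in> sets lebesgue" using \<omega>(1) by (simp add: borel_open sets_completionI_sets)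
  define \<mu> where "\<mu> = \<beta> * x1 * w / 2"
  have \<mu>: "0 < \<mu>" using \<beta> x12 w by (simp add: \<mu>_def)
  define D where "D = exp 1 * max 1 (2 / \<mu>)"
  have D: "1 \<le> D"
  proof -
    have "1 * 1 \<le> exp 1 * max 1 (2 / \<mu>)" by (intro mult_mono) auto
    then show ?thesis by (simp add: D_def)
  qed
  define C1 where "C1 = (2 / p)\<^sup>2 / (1 - 2 * p) * (4 / p * (4 / \<beta>\<^sup>2) ^ r0 * 2 ^ (r0 + 1))"
  have C1: "0 \<le> C1" using p by (simp add: C1_def)
  define q where "q = 2 * r0 + 6"
  define A where "A = (exp 1)\<^sup>2 / \<beta>\<^sup>2"
  have A: "0 \<le> A" by (simp add: A_def)
  obtain l :: nat where l: "8 * C1 + 4 * D * A + 2 * A + 1 < real l" using reals_Archimedean2 by blast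
  \<comment> \<open>The share \<open>q\<close> of the nodes beats the polynomial factor, by s^q
    \<le> 2^(q s); the share \<open>l\<close> beats the constant \<open>C1\<close> and makes D r
    \<le> 1/4.\<close>
  define L where "L = q + l"
  have DA: "0 \<le> D * A" using D A by simp
  have L1: "1 \<le> real L"
  proof -
    have "1 \<le> real l" using l C1 A DA by linarith
    then show ?thesis by (simp add: L_def)
  qed
  have LA: "4 * D * A + 2 * A \<le> (real L)\<^sup>2"
  proof -
    have "4 * D * A + 2 * A \<le> real L" using l C1 by (simp add: L_def)
    also have "\<dots> * 1 \<le> real L * real L" using L1 by (intro mult_left_mono) auto
    finally show ?thesis by (simp add: power2_eq_square)
  qed
  \<comment> \<open>The ratio Z e^2 / N^2 for Z = s^2 / \<beta>^2 and N = L s: the frequency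
    cancels.\<close>
  define r where "r = A / (real L)\<^sup>2"
  have L2: "0 < (real L)\<^sup>2" using L1 by simp
  have r: "0 \<le> r" "r \<le> 1/2" "D * r \<le> 1/4"
    using A LA L2 DA by (auto simp: r_def divide_le_eq)
  \<comment> \<open>One summand for each of the factors N, D^N, sqrt (1/h) and 2 x1^(-\<kappa>)
    estimated at the end.\<close>
  define C where "C = real L + real L * ln D + 2 * real L / w + 2 * x1 powr - \<kappa>"
  have C: "0 < C"
    unfolding C_def using L1 D w x12 by (intro add_pos_pos add_pos_nonneg) auto
  show ?thesis
  proof (rule that[OF C])
    fix s :: nat and u assume s: "1 \<le> s" and u: "\<And>b. b \<in> B \<Longrightarrow> (real s)\<^sup>2 < lam b \<Longrightarrow> u \<bullet> b = 0"
    obtain v d where sv: "square_int v" and av: "abs_L2 v = u" and cv: "continuous_on {0<..<1} v"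
      and vd: "\<And>x. 0 < x \<Longrightarrow> x < 1 \<Longrightarrow> v x = x powr \<kappa> * (\<Sum>k. d k * (x powr \<beta>) ^ k)"
      and d: "\<And>k. \<bar>d k\<bar> \<le> (C1 * real s ^ q * norm u) * ((real s)\<^sup>2 / \<beta>\<^sup>2) ^ k / (fact k)\<^sup>2"
      using low_frequency_expansion[OF s u] unfolding C1_def q_def by blast
    define M where "M = C1 * real s ^ q * norm u"
    define N where "N = L * s"
    have N: "1 \<le> N" "real N = real L * real s" using L1 s by (auto simp: N_def)
    define S where "S = norm (cutoff \<omega> u)"
    have S0: "0 \<le> S" by (simp add: S_def)
    have S2: "S\<^sup>2 = (\<integral>x. indicator \<omega> x * (v x)\<^sup>2 \<partial>unit_leb)"
      unfolding S_def av[symmetric] by (rule cutoff_norm_abs[OF sv \<omega>m])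
    define h where "h = w / (2 * real N)"
    have h: "0 < h" "2 * real N * h = w" using w N(1) by (auto simp: h_def)
    \<comment> \<open>In each cell with even number some point has v^2 at most its mean over the
      cell, hence at most S^2 / h.\<close>
    have "\<exists>x. x1 + 2 * real i * h \<le> x \<and> x \<le> x1 + (2 * real i + 1) * h \<and> (v x)\<^sup>2 * h \<le> S\<^sup>2" if i: "i < N" for i
    proof -
      have "(2 * real i + 1) * h \<le> 2 * real N * h" using i h by (intro mult_right_mono) auto
      moreover have "0 \<le> 2 * real i * h" using h by simp
      ultimately have c: "x1 \<le> x1 + 2 * real i * h" "x1 + (2 * real i + 1) * h \<le> x2" using h(2) w_def by auto
      obtain x where "x1 + 2 * real i * h \<le> x" "x \<le> x1 + (2 * real i + 1) * h"
        "(v x)\<^sup>2 * (x1 + (2 * real i + 1) * h - (x1 + 2 * real i * h)) \<le> S\<^sup>2"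
        unfolding S2
      proof (rule exists_small_value[of "x1 + 2 * real i * h" "x1 + (2 * real i + 1) * h" v \<omega>])
        show "continuous_on {x1 + 2 * real i * h..x1 + (2 * real i + 1) * h} v"
        proof (rule continuous_on_subset[OF cv], rule subsetI)
          fix t assume "t \<in> {x1 + 2 * real i * h..x1 + (2 * real i + 1) * h}"
          then have "x1 + 2 * real i * h \<le> t" "t \<le> x1 + (2 * real i + 1) * h" by (simp_all only: atLeastAtMost_iff)
          then have "0 < t" "t < 1" using c x12 by linarith+
          then show "t \<in> {0<..<1}" by simp
        qed
        show "{x1 + 2 * real i * h..x1 + (2 * real i + 1) * h} \<subseteq> \<omega>"
          using sub c atLeastatMost_subset_iff[of "x1 + 2 * real i * h" "x1 + (2 * real i + 1) * h" x1 x2] by blast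
        show "integrable unit_leb (\<lambda>x. (v x)\<^sup>2)" using sv by (simp add: square_int_def)
        show "0 < x1 + 2 * real i * h" "x1 + (2 * real i + 1) * h < 1" using c x12 by linarith+
        show "x1 + 2 * real i * h < x1 + (2 * real i + 1) * h" using h by (simp add: algebra_simps)
      qed (rule \<omega>m, blast)
      then show ?thesis by (auto simp: algebra_simps)
    qed
    then obtain x where x: "\<And>i. i < N \<Longrightarrow> x1 + 2 * real i * h \<le> x i \<and> x i \<le> x1 + (2 * real i + 1) * h \<and> (v (x i))\<^sup>2 * h \<le> S\<^sup>2"
      by metis
    have in01: "x1 \<le> x i \<and> 0 < x i \<and> x i < 1" if "i < N" for i
    proof -
      have "(2 * real i + 1) * h \<le> 2 * real N * h" using that h by (intro mult_right_mono) auto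
      moreover have "0 \<le> 2 * real i * h" using h by simp
      ultimately show ?thesis using x[OF that] h(2) x12 w_def by linarith
    qed
    define E where "E = x1 powr - \<kappa> * (S * sqrt (1 / h))"
    have E: "\<bar>\<Sum>k. d k * (x i powr \<beta>) ^ k\<bar> \<le> E" if i: "i < N" for i
    proof -
      have xi: "x1 \<le> x i" "0 < x i" "x i < 1" using in01[OF i] by auto
      have "(v (x i))\<^sup>2 \<le> S\<^sup>2 * (1 / h)" using x[OF i] h by (simp add: field_simps)
      then have "\<bar>v (x i)\<bar> \<le> sqrt (S\<^sup>2 * (1 / h))" by (metis real_sqrt_abs real_sqrt_le_mono)
      also have "\<dots> = S * sqrt (1 / h)" using S0 by (simp only: real_sqrt_mult real_sqrt_abs abs_of_nonneg)
      finally have vs: "\<bar>v (x i)\<bar> \<le> S * sqrt (1 / h)" .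
      have "\<bar>\<Sum>k. d k * (x i powr \<beta>) ^ k\<bar> = x i powr - \<kappa> * \<bar>v (x i)\<bar>"
        using vd[OF xi(2,3)] xi(2) by (simp add: abs_mult powr_minus)
      also have "\<dots> \<le> x1 powr - \<kappa> * (S * sqrt (1 / h))"
        using vs xi x12 \<kappa> by (intro mult_mono powr_mono2') auto
      finally show ?thesis by (simp add: E_def)
    qed
    have M: "0 \<le> M" using C1 by (simp add: M_def)
    have U: "\<bar>\<Sum>k. d k * t ^ k\<bar> \<le> real N * D ^ N * (E + 2 * M * r ^ N) + 2 * M * r ^ N" if t: "0 \<le> t" "t \<le> 1" for t
      unfolding D_def
    proof (rule entire_interpolation_bound[OF d[folded M_def] _ M N(1) \<mu> _ _ E t _ r(1,2)])
      show "\<mu> / real N * \<bar>real i - real j\<bar> \<le> \<bar>x i powr \<beta> - x j powr \<beta>\<bar>" if "i < N" "j < N" for i j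
        unfolding \<mu>_def w_def
        by (rule nodes_separated[OF x12 N(1) _ that]) (use x in \<open>auto simp: h_def w_def\<close>)
      show "0 \<le> x i powr \<beta> \<and> x i powr \<beta> \<le> 1" if "i < N" for i
        using in01[OF that] \<beta> powr_mono2[of \<beta> "x i" 1] by auto
      show "(real s)\<^sup>2 / \<beta>\<^sup>2 * (exp 1)\<^sup>2 / (real N)\<^sup>2 \<le> r"
        using s L1 by (simp add: r_def A_def N(2) power_mult_distrib)
    qed simp
    define K where "K = real N * D ^ N * (E + 2 * M * r ^ N) + 2 * M * r ^ N"
    have vK: "\<bar>v t\<bar> \<le> K" if t: "0 < t" "t < 1" for t
    proof -
      have tb: "0 \<le> t powr \<beta>" "t powr \<beta> \<le> 1" using t \<beta> powr_mono2[of \<beta> t 1] by auto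
      have "\<bar>v t\<bar> = t powr \<kappa> * \<bar>\<Sum>k. d k * (t powr \<beta>) ^ k\<bar>" using vd[OF t] by (simp add: abs_mult)
      also have "\<dots> \<le> 1 * \<bar>\<Sum>k. d k * (t powr \<beta>) ^ k\<bar>"
        using t \<kappa> powr_mono2[of \<kappa> t 1] by (intro mult_right_mono) auto
      finally show ?thesis using U[OF tb] by (simp add: K_def)
    qed
    have K0: "0 \<le> K" using vK[of "1/2"] by simp
    have "(norm u)\<^sup>2 \<le> (\<integral>x. K\<^sup>2 \<partial>unit_leb)"
      unfolding av[symmetric] norm_abs_L2_sq[OF sv]
    proof (rule integral_mono)
      show "(v t)\<^sup>2 \<le> K\<^sup>2" if "t \<in> space unit_leb" for t
        using power_mono[OF vK[of t], of 2] that by simp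
    qed (use sv in \<open>auto simp: square_int_def\<close>)
    also have "\<dots> = K\<^sup>2" using measure_unit_leb by simp
    finally have uK: "norm u \<le> K" using K0 by (rule power2_le_imp_le)
    have DN: "1 \<le> D ^ N" using D by simp
    have ND: "1 \<le> real N * D ^ N" using mult_mono[of 1 "real N" 1 "D ^ N"] N(1) DN by simp
    \<comment> \<open>D r \<le> 1/4 and N \<le> 2^N give N (D r)^N \<le> 2^-N, of which 2^(- q s)
      cancels s^q and 2^(- l s) makes the constant small.\<close>
    have small: "4 * (real N * D ^ N * r ^ N) * M \<le> norm u / 2"
    proof -
      have "D ^ N * r ^ N \<le> (1/4) ^ N" unfolding power_mult_distrib[symmetric] using r D by (intro power_mono) auto
      moreover have "real N \<le> 2 ^ N" using of_nat_mono[OF less_imp_le[OF less_exp[of N]]] by simp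
      ultimately have "real N * (D ^ N * r ^ N) \<le> 2 ^ N * (1/4) ^ N" using r D by (intro mult_mono) auto
      also have "\<dots> = (1/2) ^ N" by (simp add: power_mult_distrib[symmetric])
      finally have 1: "real N * D ^ N * r ^ N \<le> (1/2) ^ N" by (simp add: mult.assoc)
      have "real s \<le> 2 ^ s" using of_nat_mono[OF less_imp_le[OF less_exp[of s]]] by simp
      then have "real s ^ q \<le> (2 ^ s) ^ q" by (intro power_mono) auto
      then have sq: "real s ^ q \<le> 2 ^ (q * s)" by (simp add: power_mult[symmetric] mult.commute)
      have Nq: "(1/2 :: real) ^ N = (1/2) ^ (q * s) * (1/2) ^ (l * s)"
        by (simp add: N_def L_def power_add[symmetric] algebra_simps)
      have "(1/2 :: real) ^ (l * s) \<le> (1/2) ^ l" using s by (intro power_decreasing) auto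
      moreover have "8 * C1 \<le> 2 ^ l"
      proof -
        have "real l \<le> 2 ^ l" using of_nat_mono[OF less_imp_le[OF less_exp[of l]]] by simp
        then show ?thesis using l A DA by linarith
      qed
      then have "C1 * (1/2) ^ l \<le> 1/8" by (simp add: power_divide field_simps)
      ultimately have cl: "C1 * (1/2) ^ (l * s) \<le> 1/8" using C1 by (meson mult_left_mono order_trans)
      have "4 * (real N * D ^ N * r ^ N) * M \<le> 4 * (1/2) ^ N * M" using 1 M by (intro mult_right_mono) auto
      also have "\<dots> = 4 * (C1 * (1/2) ^ (l * s)) * ((1/2) ^ (q * s) * real s ^ q) * norm u"
        unfolding M_def Nq by simp
      also have "\<dots> \<le> 4 * (1/8) * ((1/2) ^ (q * s) * 2 ^ (q * s)) * norm u"
        using cl sq C1 by (intro mult_right_mono mult_mono) auto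
      also have "\<dots> = norm u / 2" by (simp add: power_mult_distrib[symmetric])
      finally show ?thesis .
    qed
    have "K \<le> real N * D ^ N * E + 4 * (real N * D ^ N * r ^ N) * M"
    proof -
      have "1 * (2 * M * r ^ N) \<le> real N * D ^ N * (2 * M * r ^ N)" using ND M r by (intro mult_right_mono) auto
      then show ?thesis by (simp add: K_def algebra_simps)
    qed
    then have "norm u \<le> real N * D ^ N * E + norm u / 2" using uK small by linarith
    then have uE: "norm u \<le> 2 * (real N * D ^ N * E)" by simp
    have "2 * (real N * D ^ N * E) = real N * D ^ N * sqrt (1 / h) * (2 * x1 powr - \<kappa>) * S"
      by (simp add: E_def)
    also have "\<dots> \<le> exp (real L * real s) * exp (real L * ln D * real s) * exp (2 * real L / w * real s)
        * exp (2 * x1 powr - \<kappa> * real s) * S"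
    proof (intro mult_right_mono[OF _ S0] mult_mono)
      show "real N \<le> exp (real L * real s)"
        unfolding N(2)[symmetric] by (rule order_trans[OF _ exp_ge_add_one_self]) simp
      have "D ^ N = exp (ln D) ^ N" using D by simp
      also have "\<dots> = exp (real N * ln D)" by (rule exp_of_nat_mult[symmetric])
      finally show "D ^ N \<le> exp (real L * ln D * real s)" using N(2) by (simp add: mult_ac)
      have "sqrt (1 / h) \<le> 1 + 1 / h"
      proof (rule real_le_lsqrt)
        have "(1 + 1 / h)\<^sup>2 = 1 + 2 * (1 / h) + (1 / h)\<^sup>2" by (simp add: power2_sum)
        moreover have "0 \<le> 1 / h" using h(1) by simp
        ultimately show "1 / h \<le> (1 + 1 / h)\<^sup>2" using zero_le_power2[of "1 / h"] by linarith
      qed (use h in auto)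
      also have "1 + 1 / h \<le> exp (1 / h)" by (rule exp_ge_add_one_self)
      finally have "sqrt (1 / h) \<le> exp (1 / h)" .
      moreover have "2 * real L / w * real s = 1 / h" by (simp add: h_def N(2))
      ultimately show "sqrt (1 / h) \<le> exp (2 * real L / w * real s)" by (simp only:)
      have "2 * x1 powr - \<kappa> * 1 \<le> 2 * x1 powr - \<kappa> * real s" using s by (intro mult_left_mono) auto
      then show "2 * x1 powr - \<kappa> \<le> exp (2 * x1 powr - \<kappa> * real s)"
        using exp_ge_add_one_self[of "2 * x1 powr - \<kappa> * real s"] by linarith
    qed (use D h in auto)
    also have "\<dots> = exp (C * real s) * S"
      by (simp add: C_def exp_add[symmetric] algebra_simps)
    finally show "norm u \<le> exp (C * real s) * norm (cutoff \<omega> u)" using uE by (simp add: S_def)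
  qed
qed

end

section \<open>Impulse control\<close>

context degenerate_basis
begin

text \<open>The Hilbert uniqueness method on the low modes, with projection \<open>P\<close>. The
  hypothesis \<open>obs\<close> makes the compression of the cutoff coercive on the range of
  \<open>P\<close>; adding the identity on the complement gives an operator \<open>H\<close>
  coercive on the whole space, which \<open>coercive_right_inverse\<close> inverts.\<close>

lemma impulse_control:
  assumes \<omega>: "open \<omega>" and c: "0 < c" "c \<le> 1"
    and obs: "\<And>u. (\<And>b. b \<in> B \<Longrightarrow> \<Lambda> < lam b \<Longrightarrow> u \<bullet> b = 0) \<Longrightarrow> c * (norm u)\<^sup>2 \<le> (norm (cutoff \<omega> u))\<^sup>2"
  obtains F where "bounded_linear F" "\<And>z. norm (F z) \<le> norm z / c"
    "\<And>z b. b \<in> B \<Longrightarrow> lam b \<le> \<Lambda> \<Longrightarrow> (z + cutoff \<omega> (F z)) \<bullet> b = 0"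
proof -
  have \<omega>m: "\<omega> \<in> sets lebesgue" using \<omega> by (simp add: borel_open sets_completionI_sets)
  interpret cut: bounded_linear "cutoff \<omega>" by (rule bounded_linear_cutoff[OF \<omega>m])
  define k where "k b = (if lam b \<le> \<Lambda> then 1 else 0 :: real)" for b
  define P where "P = mult k"
  have k: "\<bar>k b\<bar> \<le> 1" for b by (simp add: k_def)
  have Pi: "P u \<bullet> b = k b * (u \<bullet> b)" if "b \<in> B" for u b
    unfolding P_def by (rule mult_inner[OF k that])
  have Pbl: "bounded_linear P" unfolding P_def by (rule bounded_linear_mult[OF k]) simp
  interpret P: bounded_linear P by (rule Pbl)
  have nP: "norm (P u) \<le> norm u" for u unfolding P_def using norm_mult_le[of k 1 u, OF k] by simp
  have PP: "P (P u) = P u" for u by (rule eqI) (simp add: Pi k_def)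
  let ?L = "{b \<in> B. lam b \<le> \<Lambda>}"
  have Pe: "P u = (\<Sum>b\<in>?L. (u \<bullet> b) *\<^sub>R b)" for u
    by (rule eqI) (simp add: Pi inner_sum_basis[OF finite_low(1)] k_def)
  have Psym: "P u \<bullet> v = P u \<bullet> P v" for u v
  proof -
    have "b \<bullet> P v = b \<bullet> v" if "b \<in> ?L" for b
      using Pi[of b v] that by (simp add: k_def inner_commute)
    then show ?thesis unfolding Pe[of u] inner_sum_left by (intro sum.cong) auto
  qed
  define H where "H u = P (cutoff \<omega> (P u)) + (u - P u)" for u
  have Hbl: "bounded_linear H"
    unfolding H_def[abs_def]
    by (intro bounded_linear_add bounded_linear_sub bounded_linear_ident Pbl
        bounded_linear_compose[OF Pbl bounded_linear_compose[OF bounded_linear_cutoff[OF \<omega>m] Pbl]])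
  have Hco: "c * (norm u)\<^sup>2 \<le> H u \<bullet> u" for u
  proof -
    have 1: "P (cutoff \<omega> (P u)) \<bullet> u = (norm (cutoff \<omega> (P u)))\<^sup>2"
      using Psym[of "cutoff \<omega> (P u)" u] Psym[of u "cutoff \<omega> (P u)"] norm_cutoff_sq[OF \<omega>m, of "P u"]
      by (simp add: inner_commute)
    have 2: "(u - P u) \<bullet> u = (norm u)\<^sup>2 - (norm (P u))\<^sup>2"
      using Psym[of u u] by (simp add: inner_diff_left power2_norm_eq_inner)
    have 3: "c * (norm (P u))\<^sup>2 \<le> (norm (cutoff \<omega> (P u)))\<^sup>2"
      by (rule obs) (simp add: Pi k_def)
    have "(norm (P u))\<^sup>2 \<le> (norm u)\<^sup>2" using nP[of u] by (intro power_mono) auto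
    \<comment> \<open>By c \<le> 1 the identity on the high modes is coercive with constant c as
      well.\<close>
    then have "c * ((norm u)\<^sup>2 - (norm (P u))\<^sup>2) \<le> 1 * ((norm u)\<^sup>2 - (norm (P u))\<^sup>2)"
      using c by (intro mult_right_mono) auto
    then show ?thesis using 1 2 3 by (simp add: H_def inner_add_left algebra_simps)
  qed
  obtain R where R: "bounded_linear R" "\<And>w. H (R w) = w" "\<And>w. norm (R w) \<le> norm w / c"
    using coercive_right_inverse[OF Hbl c(1) Hco] by blast
  define F where "F z = - R (P z)" for z
  show ?thesis
  proof (rule that)
    show "bounded_linear F"
      unfolding F_def[abs_def] by (intro bounded_linear_minus bounded_linear_compose[OF R(1) Pbl])
    show "norm (F z) \<le> norm z / c" for z
      using R(3)[of "P z"] nP[of z] c by (simp add: F_def field_simps)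
    fix z b assume b: "b \<in> B" "lam b \<le> \<Lambda>"
    define v where "v = R (P z)"
    have Hv: "P (cutoff \<omega> (P v)) + (v - P v) = P z" using R(2)[of "P z"] by (simp add: H_def v_def)
    \<comment> \<open>Applying \<open>P\<close> to \<open>Hv\<close> removes v - P v; comparison
      with \<open>Hv\<close> itself then gives v = P v, so the control is a combination of low
      modes.\<close>
    have Pv: "P (cutoff \<omega> (P v)) = P z"
      using arg_cong[OF Hv, of P] by (simp add: P.add P.diff PP)
    then have "v = P v" using Hv by simp
    then have "P (cutoff \<omega> v) = P z" using Pv by simp
    then have "P (z + cutoff \<omega> (F z)) = 0"
      by (simp add: F_def v_def[symmetric] cut.neg P.add P.diff P.neg)
    then have "P (z + cutoff \<omega> (F z)) \<bullet> b = 0" by simp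
    then show "(z + cutoff \<omega> (F z)) \<bullet> b = 0" using Pi[OF b(1)] b(2) by (simp add: k_def)
  qed
qed

lemma high_frequency_decay:
  assumes "0 \<le> t" "\<And>b. b \<in> B \<Longrightarrow> lam b \<le> \<Lambda> \<Longrightarrow> u \<bullet> b = 0"
  shows "norm (sg t u) \<le> exp (- \<Lambda> * t) * norm u"
proof (rule norm_le_multiplier)
  fix b assume b: "b \<in> B"
  show "\<bar>sg t u \<bullet> b\<bar> \<le> exp (- \<Lambda> * t) * \<bar>u \<bullet> b\<bar>"
  proof (cases "lam b \<le> \<Lambda>")
    case True
    then show ?thesis using assms(2)[OF b] sg_coeff[OF assms(1) b, of u] by simp
  next
    case False
    then have "exp (- lam b * t) \<le> exp (- \<Lambda> * t)" using assms(1) by (simp add: mult_right_mono)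
    then show ?thesis by (simp add: sg_coeff[OF assms(1) b] abs_mult mult_right_mono)
  qed
qed simp

section \<open>Trajectories of the impulsive system\<close>

context
  fixes t :: "nat \<Rightarrow> real" and F :: "nat \<Rightarrow> L2 \<Rightarrow> L2" and \<omega> :: "real set"
begin

text \<open>\<open>jt\<close> puts the initial time \<open>0\<close> in front of the jump times; \<open>state z0 m\<close> is the value at \<open>jt m\<close>, after the jump.\<close>

definition jt :: "nat \<Rightarrow> real" where "jt m = (case m of 0 \<Rightarrow> 0 | Suc k \<Rightarrow> jump_time t k)"

primrec state :: "L2 \<Rightarrow> nat \<Rightarrow> L2" where
  "state z0 0 = z0"
| "state z0 (Suc m) = sg (jt (Suc m) - jt m) (state z0 m) + cutoff \<omega> (F m (sg (t m - jt m) (state z0 m)))"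

definition trajectory :: "L2 \<Rightarrow> real \<Rightarrow> L2" where
  "trajectory z0 s = (let m = (THE m. jt m \<le> s \<and> s < jt (Suc m)) in sg (s - jt m) (state z0 m))"

context
  fixes T :: real
  assumes t: "strict_mono t" "\<And>m. 0 < t m" "t \<longlonglongrightarrow> T"
begin

lemma jt_simps: "jt 0 = 0" "jt (Suc m) = jump_time t m"
  by (simp_all add: jt_def)

lemma jt_t: "jt m < t m" "t m < jt (Suc m)"
proof -
  have lt: "t m < t (Suc m)" for m using t(1) by (simp add: strict_mono_def)
  show "t m < jt (Suc m)" using lt[of m] by (simp add: jt_simps jump_time_def)
  show "jt m < t m"
  proof (cases m)
    case (Suc k)
    then show ?thesis using lt[of k] by (simp add: jt_simps jump_time_def)
  qed (use t(2) in \<open>simp add: jt_simps\<close>)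
qed

lemma jt_mono: "strict_mono jt"
  by (rule strict_monoI_Suc) (use jt_t in \<open>blast intro: less_trans\<close>)

lemma jt_nonneg: "0 \<le> jt m"
  using strict_mono_less_eq[OF jt_mono, of 0 m] by (simp add: jt_simps)

lemma jt_less: "jt m < T"
proof -
  have "t (Suc m) \<le> T" by (rule LIMSEQ_le_const[OF t(3)]) (use strict_mono_less_eq[OF t(1)] in blast)
  moreover have "t m < t (Suc m)" using t(1) by (simp add: strict_mono_def)
  ultimately show ?thesis using jt_t(1)[of m] by simp
qed

lemma jt_index: "0 \<le> s \<Longrightarrow> s < T \<Longrightarrow> \<exists>m. jt m \<le> s \<and> s < jt (Suc m)"
proof -
  assume s: "0 \<le> s" "s < T"
  have "\<exists>m. s < t m" using order_tendstoD(1)[OF t(3) s(2)] by (auto simp: eventually_sequentially)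
  then have ex: "\<exists>m. s < jt (Suc m)" using jt_t(2) less_trans by blast
  define m where "m = (LEAST m. s < jt (Suc m))"
  have m: "s < jt (Suc m)" unfolding m_def by (rule LeastI_ex[OF ex])
  have "jt m \<le> s"
  proof (cases m)
    case (Suc k)
    then have "\<not> s < jt (Suc k)" using not_less_Least[of k "\<lambda>m. s < jt (Suc m)"] unfolding m_def by auto
    then show ?thesis using Suc by simp
  qed (use s in \<open>simp add: jt_simps\<close>)
  then show ?thesis using m by blast
qed

lemma jt_unique: "jt m \<le> s \<Longrightarrow> s < jt (Suc m) \<Longrightarrow> jt n \<le> s \<Longrightarrow> s < jt (Suc n) \<Longrightarrow> m = n"
  using strict_mono_less[OF jt_mono] by (metis le_less_trans less_Suc_eq_le nat_less_le not_less_eq)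

lemma trajectory_eq:
  assumes "jt m \<le> s" "s < jt (Suc m)" shows "trajectory z0 s = sg (s - jt m) (state z0 m)"
proof -
  have "(THE m. jt m \<le> s \<and> s < jt (Suc m)) = m"
    by (rule the_equality) (use assms jt_unique in blast)+
  then show ?thesis by (simp add: trajectory_def)
qed

lemma trajectory_jt: "trajectory z0 (jt m) = state z0 m"
  using trajectory_eq[of m "jt m"] jt_t[of m] by (simp add: sg_0)

text \<open>Continuity of the semigroup at positive times. It identifies the left limit
  \<open>l\<close> in \<open>impulse_solution\<close>, for existence as well as for
  uniqueness.\<close>

lemma sg_left_limit:
  assumes "\<And>s. jt m \<le> s \<Longrightarrow> s < jt (Suc m) \<Longrightarrow> y s = sg (s - jt m) u"
  shows "(y \<longlongrightarrow> sg (jt (Suc m) - jt m) u) (at_left (jt (Suc m)))"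
proof -
  have lt: "jt m < jt (Suc m)" using jt_t less_trans by blast
  have ev: "\<forall>\<^sub>F s in at_left (jt (Suc m)). s \<in> {jt m<..<jt (Suc m)}" by (rule eventually_at_left_real[OF lt])
  have "((\<lambda>s. sg s u) \<longlongrightarrow> sg (jt (Suc m) - jt m) u) (filtermap (\<lambda>s. s - jt m) (at_left (jt (Suc m))))"
  proof (rule sg_tendsto)
    show "\<forall>\<^sub>F s in filtermap (\<lambda>s. s - jt m) (at_left (jt (Suc m))). 0 \<le> s"
      unfolding eventually_filtermap using ev by eventually_elim simp
    show "((\<lambda>s. s) \<longlongrightarrow> jt (Suc m) - jt m) (filtermap (\<lambda>s. s - jt m) (at_left (jt (Suc m))))"
      unfolding filterlim_filtermap by (intro tendsto_intros)
  qed (use lt in simp)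
  then have "((\<lambda>s. sg (s - jt m) u) \<longlongrightarrow> sg (jt (Suc m) - jt m) u) (at_left (jt (Suc m)))"
    by (simp add: filterlim_filtermap)
  then show ?thesis
    by (rule Lim_transform_eventually) (use ev in eventually_elim, use assms in auto)
qed

lemma impulse_solution_trajectory: "impulse_solution \<alpha> \<omega> t F z0 (trajectory z0)"
  unfolding impulse_solution_def
proof (intro conjI allI impI)
  show z0: "trajectory z0 0 = z0" using trajectory_jt[of z0 0] by (simp add: jt_simps)
  show "trajectory z0 s = heat_semigroup \<alpha> s (trajectory z0 0)" if "0 \<le> s \<and> s < jump_time t 0" for s
    unfolding z0 using trajectory_eq[of 0 s z0] that by (simp add: jt_simps heat_sg)
  show "trajectory z0 s = heat_semigroup \<alpha> (s - jump_time t m) (trajectory z0 (jump_time t m))"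
    if "jump_time t m \<le> s \<and> s < jump_time t (Suc m)" for m s
    using trajectory_eq[of "Suc m" s z0] trajectory_jt[of z0 "Suc m"] that
    by (simp add: jt_simps(2) heat_sg del: state.simps)
  show "\<exists>l. (trajectory z0 \<longlongrightarrow> l) (at_left (jump_time t m)) \<and>
      trajectory z0 (jump_time t m) = l + cutoff \<omega> (F m (trajectory z0 (t m)))" for m
    using sg_left_limit[of m "trajectory z0", OF trajectory_eq] trajectory_jt[of z0 "Suc m"]
      trajectory_eq[of m "t m" z0] jt_t[of m]
    by (intro exI[of _ "sg (jt (Suc m) - jt m) (state z0 m)"]) (auto simp: jt_simps(2))
qed

text \<open>Induction over the jump times: the value after a jump is determined by the left limit,
  which is unique, and by the value at the earlier time \<open>t m\<close>.\<close>

lemma impulse_solution_unique: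
  assumes y: "impulse_solution \<alpha> \<omega> t F z0 y" and s: "s \<in> {0..<T}"
  shows "y s = trajectory z0 s"
proof -
  have st: "y (jt m) = state z0 m \<Longrightarrow> jt m \<le> s \<Longrightarrow> s < jt (Suc m) \<Longrightarrow> y s = sg (s - jt m) (state z0 m)" for m s
    using y unfolding impulse_solution_def by (cases m) (auto simp: jt_simps heat_sg)
  have "y (jt m) = state z0 m" for m
  proof (induction m)
    case 0
    then show ?case using y by (simp add: impulse_solution_def jt_simps)
  next
    case (Suc m)
    note yeq = st[OF Suc]
    obtain l where l: "(y \<longlongrightarrow> l) (at_left (jt (Suc m)))" "y (jt (Suc m)) = l + cutoff \<omega> (F m (y (t m)))"
      using y unfolding impulse_solution_def jt_simps by blast
    have "l = sg (jt (Suc m) - jt m) (state z0 m)"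
      by (rule tendsto_unique[OF trivial_limit_at_left_real l(1) sg_left_limit[OF yeq]])
    then show ?case using l(2) yeq[of "t m"] jt_t[of m] by simp
  qed
  moreover obtain m where "jt m \<le> s" "s < jt (Suc m)" using jt_index[of s] s by auto
  ultimately show ?thesis using st trajectory_eq by metis
qed

end

end

end

theorem theorem1p3:
  fixes \<alpha> T :: real and \<omega> :: "real set"
  assumes "0 < \<alpha>" and "\<alpha> < 2"
    and "open \<omega>" and "\<omega> \<noteq> {}" and "\<omega> \<subseteq> {0<..<1}"
    and "0 < T"
  shows "\<exists>(t :: nat \<Rightarrow> real) (F :: nat \<Rightarrow> L2 \<Rightarrow> L2).
    strict_mono t \<and> (\<forall>m. 0 < t m) \<and> t \<longlonglongrightarrow> T \<and>
    (\<forall>m. bounded_linear (F m)) \<and>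
    (\<forall>z0. \<exists>z. impulse_solution \<alpha> \<omega> t F z0 z \<and>
       (\<forall>y. impulse_solution \<alpha> \<omega> t F z0 y \<longrightarrow> (\<forall>s\<in>{0..<T}. y s = z s)) \<and>
       ((\<lambda>s. norm (z s)) \<longlongrightarrow> 0) (at_left T))"
proof -
  interpret degenerate \<alpha> by unfold_locales (use assms in auto)
  obtain B where "degenerate_basis \<alpha> B" using ex_degenerate_basis by blast
  then interpret degenerate_basis \<alpha> B .
  have \<omega>m: "\<omega> \<in> sets lebesgue" using assms(3) by (simp add: borel_open sets_completionI_sets)
  obtain C where C: "0 < C" and spec: "\<And>(s::nat) u. 1 \<le> s \<Longrightarrow>
      (\<And>b. b \<in> B \<Longrightarrow> (real s)\<^sup>2 < lam b \<Longrightarrow> u \<bullet> b = 0) \<Longrightarrow> norm u \<le> exp (C * real s) * norm (cutoff \<omega> u)"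
    using spectral_inequality[OF assms(3,4,5)] by metis
  define t where "t m = T - T / 2 ^ (m + 1)" for m
  have t1: "strict_mono t"
    by (rule strict_monoI_Suc) (use assms(6) in \<open>simp add: t_def field_simps\<close>)
  have t2: "0 < t m" for m
  proof -
    have "(1::real) < 2 ^ (m + 1)" by (rule one_less_power) auto
    then show ?thesis using assms(6) by (simp add: t_def field_simps)
  qed
  have t3: "t \<longlonglongrightarrow> T"
  proof -
    have "(\<lambda>m. T - T / 2 * (1 / 2) ^ m) \<longlonglongrightarrow> T - T / 2 * 0"
      by (intro tendsto_intros LIMSEQ_realpow_zero) auto
    moreover have "T - T / 2 * (1 / 2) ^ m = t m" for m by (simp add: t_def power_divide)
    ultimately show ?thesis by simp
  qed
  \<comment> \<open>The distance of the jump time from both neighbours \<open>t m\<close> and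
    \<open>t (Suc m)\<close>.\<close>
  define h where "h m = T / 2 ^ (m + 3)" for m :: nat
  have h0: "0 < h m" for m using assms(6) by (simp add: h_def)
  have jt1: "jt t (Suc m) - t m = h m" and jt2: "t (Suc m) - jt t (Suc m) = h m" for m
    by (simp_all add: jt_def jump_time_def t_def h_def field_simps power_add)
  \<comment> \<open>2 C is the exponent in the cost of an impulse; the extra 1 absorbs the
    uncontrolled part of the state, as 1 + exp x \<le> 2 exp x for x \<ge> 0 and 2 \<le> exp (s
    m).\<close>
  define C' where "C' = 2 * C + 1"
  have C': "0 < C'" using C by (simp add: C'_def)
  \<comment> \<open>Makes s^2 h at least 10 C' s: one C' s pays for the impulse, and 9 C' s remain
    in \<open>a_step\<close>.\<close>
  obtain R :: nat where R: "80 * C' / T < real R" using reals_Archimedean2 by blast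
  then have RT: "10 * C' < real R * T / 8" using assms(6) by (simp add: field_simps)
  have R1: "1 \<le> R"
  proof -
    have "0 < 80 * C' / T" using C' assms(6) by simp
    then show ?thesis using R by (cases R) auto
  qed
  define s where "s m = R * 4 ^ m" for m :: nat
  have s1: "1 \<le> s m" for m using R1 by (simp add: s_def)
  have "\<exists>Fc. bounded_linear Fc \<and> (\<forall>z. norm (Fc z) \<le> exp (2 * C * real (s m)) * norm z) \<and>
      (\<forall>z. \<forall>b\<in>B. lam b \<le> (real (s m))\<^sup>2 \<longrightarrow> (z + cutoff \<omega> (Fc z)) \<bullet> b = 0)" for m
  proof -
    define c where "c = exp (- (2 * C * real (s m)))"
    have c: "0 < c" "c \<le> 1" using C by (auto simp: c_def)
    have obs: "c * (norm u)\<^sup>2 \<le> (norm (cutoff \<omega> u))\<^sup>2"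
      if "\<And>b. b \<in> B \<Longrightarrow> (real (s m))\<^sup>2 < lam b \<Longrightarrow> u \<bullet> b = 0" for u
    proof -
      have "(norm u)\<^sup>2 \<le> (exp (C * real (s m)) * norm (cutoff \<omega> u))\<^sup>2"
        using spec[OF s1 that] by (intro power_mono) auto
      also have "\<dots> = exp (2 * C * real (s m)) * (norm (cutoff \<omega> u))\<^sup>2"
        by (simp add: power_mult_distrib exp_double[symmetric] mult.assoc)
      finally have "c * (norm u)\<^sup>2 \<le> c * (exp (2 * C * real (s m)) * (norm (cutoff \<omega> u))\<^sup>2)"
        using c by (intro mult_left_mono) auto
      also have "\<dots> = (norm (cutoff \<omega> u))\<^sup>2"
        by (simp add: c_def exp_minus)
      finally show ?thesis .
    qed
    obtain Fc where "bounded_linear Fc" "\<And>z. norm (Fc z) \<le> norm z / c"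
      "\<And>z b. b \<in> B \<Longrightarrow> lam b \<le> (real (s m))\<^sup>2 \<Longrightarrow> (z + cutoff \<omega> (Fc z)) \<bullet> b = 0"
      using impulse_control[OF assms(3) c obs] by blast
    then show ?thesis
      by (intro exI[of _ Fc]) (auto simp: c_def exp_minus divide_inverse mult.commute)
  qed
  then obtain Fc where Fc: "\<And>m. bounded_linear (Fc m)" "\<And>m z. norm (Fc m z) \<le> exp (2 * C * real (s m)) * norm z"
      "\<And>m z b. b \<in> B \<Longrightarrow> lam b \<le> (real (s m))\<^sup>2 \<Longrightarrow> (z + cutoff \<omega> (Fc m z)) \<bullet> b = 0"
    by metis
  \<comment> \<open>If z is the state at \<open>t m\<close>, then \<open>sg (h m) z\<close> is the
    state just before the jump, on which the control \<open>Fc m\<close> is meant to act.\<close>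
  define F where "F m z = Fc m (sg (h m) z)" for m z
  have Fbl: "bounded_linear (F m)" for m
    unfolding F_def[abs_def]
    by (rule bounded_linear_compose[OF Fc(1) bounded_linear_sg[OF less_imp_le[OF h0]]])
  have lim: "((\<lambda>r. norm (trajectory t F \<omega> z0 r)) \<longlongrightarrow> 0) (at_left T)" for z0
  proof -
    let ?z = "trajectory t F \<omega> z0" and ?w = "state t F \<omega> z0"
    define a where "a m = norm (?z (t m))" for m
    note jt_t' = jt_t[of t, OF t1 t2 t3]
    have ztm: "?z (t m) = sg (t m - jt t m) (?w m)" for m
      using trajectory_eq[of t T m "t m" F \<omega> z0] t1 t2 t3 jt_t'[of m] by auto
    have w_eq: "?w (Suc m) = sg (h m) (?z (t m)) + cutoff \<omega> (Fc m (sg (h m) (?z (t m))))" for m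
    proof -
      have "sg (jt t (Suc m) - jt t m) (?w m) = sg (h m + (t m - jt t m)) (?w m)"
        using jt1[of m] by (simp add: algebra_simps)
      also have "\<dots> = sg (h m) (?z (t m))"
        unfolding ztm using h0[of m] jt_t'(1)[of m] by (intro sg_add) auto
      finally show ?thesis by (simp add: F_def ztm)
    qed
    have w_le: "norm (?w (Suc m)) \<le> exp (C' * real (s m)) * a m" for m
    proof -
      have n1: "norm (sg (h m) (?z (t m))) \<le> a m" unfolding a_def by (rule norm_sg_le[OF less_imp_le[OF h0]])
      have "norm (cutoff \<omega> (Fc m (sg (h m) (?z (t m))))) \<le> norm (Fc m (sg (h m) (?z (t m))))"
        by (rule norm_cutoff_le[OF \<omega>m])
      also have "\<dots> \<le> exp (2 * C * real (s m)) * a m"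
        using order_trans[OF Fc(2) mult_left_mono[OF n1]] by simp
      finally have "norm (?w (Suc m)) \<le> a m + exp (2 * C * real (s m)) * a m"
        unfolding w_eq using n1 by (meson add_mono norm_triangle_le)
      also have "\<dots> = (1 + exp (2 * C * real (s m))) * a m" by (simp add: algebra_simps)
      also have "\<dots> \<le> exp (C' * real (s m)) * a m"
      proof (rule mult_right_mono)
        have "1 + exp (2 * C * real (s m)) \<le> 2 * exp (2 * C * real (s m))" using C by simp
        also have "\<dots> \<le> exp (real (s m)) * exp (2 * C * real (s m))"
        proof (rule mult_right_mono)
          show "2 \<le> exp (real (s m))"
            using exp_ge_add_one_self[of "real (s m)"] s1[of m] by linarith
        qed simp
        also have "\<dots> = exp (C' * real (s m))" by (simp add: C'_def exp_add[symmetric] algebra_simps)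
        finally show "1 + exp (2 * C * real (s m)) \<le> exp (C' * real (s m))" .
      qed (simp add: a_def)
      finally show ?thesis .
    qed
    have a_step: "a (Suc m) \<le> exp (- (9 * C' * real (s m))) * a m" for m
    proof -
      have "?z (t (Suc m)) = sg (h m) (?w (Suc m))" using ztm[of "Suc m"] jt2[of m] by simp
      then have "a (Suc m) \<le> exp (- (real (s m))\<^sup>2 * h m) * norm (?w (Suc m))"
        unfolding a_def
        using high_frequency_decay[of "h m" "(real (s m))\<^sup>2" "?w (Suc m)"] Fc(3)[of _ m] h0[of m] w_eq[of m] by simp
      also have "\<dots> \<le> exp (- (real (s m))\<^sup>2 * h m) * (exp (C' * real (s m)) * a m)"
        by (intro mult_left_mono w_le) simp
      also have "\<dots> = exp (C' * real (s m) - (real (s m))\<^sup>2 * h m) * a m"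
        by (simp add: exp_add[symmetric] algebra_simps exp_diff exp_minus divide_inverse)
      also have "\<dots> \<le> exp (- (9 * C' * real (s m))) * a m"
      proof (rule mult_right_mono)
        have e: "real (s m) * h m = real R * T / 8 * 2 ^ m"
          by (simp add: s_def h_def power_add field_simps power_mult_distrib[symmetric])
        have "10 * C' * 1 \<le> real R * T / 8 * 2 ^ m" using RT C' by (intro mult_mono) auto
        then have "real (s m) * (10 * C') \<le> real (s m) * (real (s m) * h m)"
          unfolding e by (intro mult_left_mono) auto
        then show "exp (C' * real (s m) - (real (s m))\<^sup>2 * h m) \<le> exp (- (9 * C' * real (s m)))"
          by (simp add: power2_eq_square algebra_simps)
      qed (simp add: a_def)
      finally show ?thesis .
    qed
    have ee: "exp x * (exp y * c) = exp (x + y) * c" for x y c :: real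
      by (simp add: exp_add)
    \<comment> \<open>The rate 2 C' outweighs the factor exp (C' s) by which the next impulse may
      enlarge the solution. The induction closes because 9 + 2 exceeds 2 times 4, where 4 is the
      growth factor of \<open>s\<close>.\<close>
    have a_le: "a m \<le> exp (- (2 * C' * real (s m))) * (exp (2 * C' * real (s 0)) * a 0)" for m
    proof (induction m)
      case 0
      show ?case by (simp add: mult.assoc[symmetric] exp_add[symmetric])
    next
      case (Suc m)
      have "a (Suc m) \<le> exp (- (9 * C' * real (s m))) * (exp (- (2 * C' * real (s m))) * (exp (2 * C' * real (s 0)) * a 0))"
        using order_trans[OF a_step mult_left_mono[OF Suc]] by simp
      also have "\<dots> = exp (- (11 * C' * real (s m))) * (exp (2 * C' * real (s 0)) * a 0)"
        unfolding ee[of "- (9 * C' * real (s m))"] by (rule arg_cong[of _ _ "\<lambda>x. exp x * _"]) simp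
      also have "\<dots> \<le> exp (- (2 * C' * real (s (Suc m)))) * (exp (2 * C' * real (s 0)) * a 0)"
        using C' by (intro mult_right_mono) (auto simp: s_def a_def)
      finally show ?case .
    qed
    define A0 where "A0 = exp (2 * C' * real (s 0)) * a 0"
    have A0: "0 \<le> A0" by (simp add: A0_def a_def)
    \<comment> \<open>Between jumps the norm does not increase, so it is at most exp (C' s)
      \<open>a m\<close>; half of the rate 2 C' survives, and m \<le> s m turns it into a decay in
      m.\<close>
    have bound: "norm (?z r) \<le> exp (- (C' * real m)) * A0" if r: "jt t (Suc m) \<le> r" "r < jt t (Suc (Suc m))" for m r
    proof -
      have "?z r = sg (r - jt t (Suc m)) (?w (Suc m))"
        using trajectory_eq[of t T "Suc m" r F \<omega> z0] t1 t2 t3 r by auto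
      then have "norm (?z r) \<le> norm (?w (Suc m))" using norm_sg_le[of "r - jt t (Suc m)" "?w (Suc m)"] r by simp
      also have "\<dots> \<le> exp (C' * real (s m)) * (exp (- (2 * C' * real (s m))) * A0)"
        using order_trans[OF w_le mult_left_mono[OF a_le]] by (simp add: A0_def)
      also have "\<dots> = exp (- (C' * real (s m))) * A0"
        unfolding ee by (rule arg_cong[of _ _ "\<lambda>x. exp x * _"]) simp
      also have "\<dots> \<le> exp (- (C' * real m)) * A0"
      proof (rule mult_right_mono[OF _ A0])
        have "m \<le> 4 ^ m" by (rule less_imp_le) (simp add: power_gt_expt)
        also have "\<dots> \<le> s m" using R1 by (simp add: s_def)
        finally have "real m \<le> real (s m)" by simp
        then show "exp (- (C' * real (s m))) \<le> exp (- (C' * real m))" using C' by simp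
      qed
      finally show ?thesis .
    qed
    show ?thesis
    proof (rule tendstoI)
      fix e :: real assume e: "0 < e"
      have "(\<lambda>m. (exp (- C')) ^ m * A0) \<longlonglongrightarrow> 0 * A0"
        by (intro tendsto_intros LIMSEQ_realpow_zero) (use C' in auto)
      then have "\<forall>\<^sub>F m in sequentially. (exp (- C')) ^ m * A0 < e" using e by (intro order_tendstoD) auto
      then obtain m0 where m0: "\<And>m. m0 \<le> m \<Longrightarrow> (exp (- C')) ^ m * A0 < e" by (auto simp: eventually_sequentially)
      have lt: "jt t (Suc m0) < T" using jt_less[of t T] t1 t2 t3 by blast
      have "norm (?z r) < e" if r: "jt t (Suc m0) < r" "r < T" for r
      proof -
        have r0: "0 \<le> r" using jt_nonneg[of t T "Suc m0"] t1 t2 t3 r by (meson less_imp_le order_trans)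
        obtain n where n: "jt t n \<le> r" "r < jt t (Suc n)" using jt_index[of t T r] t1 t2 t3 r0 r by blast
        have "jt t (Suc m0) < jt t (Suc n)" using r n by linarith
        then have "m0 < n" using strict_mono_less[OF jt_mono[of t T]] t1 t2 t3 by blast
        then obtain m where m: "n = Suc m" "m0 \<le> m" by (cases n) auto
        have "norm (?z r) \<le> exp (- (C' * real m)) * A0" using bound[of m r] n m by simp
        also have "exp (- (C' * real m)) = (exp (- C')) ^ m"
          by (simp add: exp_of_nat_mult[symmetric] mult.commute)
        finally show ?thesis using m0[OF m(2)] by linarith
      qed
      then have "\<forall>\<^sub>F r in at_left T. norm (?z r) < e"
        unfolding eventually_at_left_field using lt by blast
      then show "\<forall>\<^sub>F r in at_left T. dist (norm (?z r)) 0 < e" by simp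
    qed
  qed
  have sol: "impulse_solution \<alpha> \<omega> t F z0 (trajectory t F \<omega> z0)" for z0
    by (rule impulse_solution_trajectory[OF t1 t2 t3])
  have uniq: "y r = trajectory t F \<omega> z0 r" if "impulse_solution \<alpha> \<omega> t F z0 y" "r \<in> {0..<T}" for y z0 r
    by (rule impulse_solution_unique[OF t1 t2 t3 that])
  show ?thesis
    using t1 t2 t3 Fbl sol uniq lim by blast
qed

end
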